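(* Let $u\in H^1(\Omega)$ and $\omega\in(H^1(\Omega))'$ be such that \[ \int_\Omega A(x,u)\nabla u\cdot\nabla v+\frac12\int_\Omega\bigl(D_sA(x,u)\nabla u\cdot\nabla u\bigr)v=\langle\omega,v\rangle\quad\forall v\in C^\infty(\overline\Omega). \] Let $w\in H^1(\Omega)$ be such that $\bigl[(D_sA(x,u)\nabla u\cdot\nabla u)w\bigr]^-\in L^1(\Omega)$. Then $w\,D_sA(x,u)\nabla u\cdot\nabla u\in L^1(\Omega)$ and \[ \int_\Omega A(x,u)\nabla u\cdot\nabla w+\frac12\int_\Omega\bigl(D_sA(x,u)\nabla u\cdot\nabla u\bigr)w=\langle\omega,w\rangle. \]
   Context: $N\ge2$, $\Omega\subset\mathbb{R}^N$ bounded Lipschitz domain. $A(x,s)=(a_{ij}(x,s))$ symmetric $N\times N$ with $a_{ij}:\Omega\times\mathbb{R}\to\mathbb{R}$ $C^1$-Carathéodory, $D_sA(x,s)=(\partial_sa_{ij}(x,s))$, and there are $C,\nu>0$ with $|a_{ij}(x,s)|,|D_sa_{ij}(x,s)|\le C$ and $A(x,s)\xi\cdot\xi\ge\nu|\xi|^2$ for a.e. $x$, all $s,\xi$. $[\cdot]^-$ denotes the negative part. *)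

theory Defs
  imports "HOL-Analysis.Analysis"
begin

definition lipschitz_domain :: "(real^'n::finite) set \<Rightarrow> bool" where
  "lipschitz_domain \<Omega> \<longleftrightarrow> open \<Omega> \<and> connected \<Omega> \<and> bounded \<Omega> \<and> \<Omega> \<noteq> {} \<and>
     (\<forall>p\<in>frontier \<Omega>. \<exists>r>0. \<exists>(Q::real^'n \<Rightarrow> real^'n) (k::'n) (g::real^'n \<Rightarrow> real) L.
        orthogonal_transformation Q \<and>
        (\<forall>y t. g (\<chi> j. if j = k then t else y $ j) = g y) \<and>
        L-lipschitz_on UNIV g \<and>
        \<Omega> \<inter> ball p r = {x \<in> ball p r. Q (x - p) $ k < g (Q (x - p))})"

definition partial_deriv :: "'n::finite \<Rightarrow> (real^'n \<Rightarrow> real) \<Rightarrow> real^'n \<Rightarrow> real" where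
  "partial_deriv i f x = frechet_derivative f (at x) (axis i 1)"

definition grad :: "(real^'n::finite \<Rightarrow> real) \<Rightarrow> real^'n \<Rightarrow> real^'n" where
  "grad f x = (\<chi> i. partial_deriv i f x)"

primrec C_k :: "nat \<Rightarrow> (real^'n::finite \<Rightarrow> real) \<Rightarrow> bool" where
  "C_k 0 f = continuous_on UNIV f"
| "C_k (Suc k) f = (continuous_on UNIV f \<and> (\<forall>x. f differentiable (at x)) \<and>
                    (\<forall>i. C_k k (partial_deriv i f)))"

definition smooth :: "(real^'n::finite \<Rightarrow> real) \<Rightarrow> bool" where
  "smooth f \<longleftrightarrow> (\<forall>k. C_k k f)"

definition test_fun :: "(real^'n::finite) set \<Rightarrow> (real^'n \<Rightarrow> real) \<Rightarrow> bool" where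
  "test_fun \<Omega> \<phi> \<longleftrightarrow> smooth \<phi> \<and> compact (closure {x. \<phi> x \<noteq> 0}) \<and> closure {x. \<phi> x \<noteq> 0} \<subseteq> \<Omega>"

definition smooth_up_to_boundary :: "(real^'n::finite) set \<Rightarrow> (real^'n \<Rightarrow> real) \<Rightarrow> bool" where
  "smooth_up_to_boundary \<Omega> v \<longleftrightarrow> (\<exists>\<phi>. smooth \<phi> \<and> (\<forall>x\<in>closure \<Omega>. v x = \<phi> x))"

definition L2 :: "(real^'n::finite) set \<Rightarrow> (real^'n \<Rightarrow> real) \<Rightarrow> bool" where
  "L2 \<Omega> f \<longleftrightarrow> f \<in> borel_measurable (lebesgue_on \<Omega>) \<and> integrable (lebesgue_on \<Omega>) (\<lambda>x. (f x)\<^sup>2)"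

definition weak_grad :: "(real^'n::finite) set \<Rightarrow> (real^'n \<Rightarrow> real) \<Rightarrow> (real^'n \<Rightarrow> real^'n) \<Rightarrow> bool" where
  "weak_grad \<Omega> u G \<longleftrightarrow> L2 \<Omega> u \<and> (\<forall>i. L2 \<Omega> (\<lambda>x. G x $ i)) \<and>
     (\<forall>\<phi> i. test_fun \<Omega> \<phi> \<longrightarrow>
        integral\<^sup>L (lebesgue_on \<Omega>) (\<lambda>x. u x * partial_deriv i \<phi> x)
        = - integral\<^sup>L (lebesgue_on \<Omega>) (\<lambda>x. G x $ i * \<phi> x))"

definition H1 :: "(real^'n::finite) set \<Rightarrow> (real^'n \<Rightarrow> real) \<Rightarrow> bool" where
  "H1 \<Omega> u \<longleftrightarrow> (\<exists>G. weak_grad \<Omega> u G)"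

definition H1_dual :: "(real^'n::finite) set \<Rightarrow> ((real^'n \<Rightarrow> real) \<Rightarrow> real) \<Rightarrow> bool" where
  "H1_dual \<Omega> \<omega> \<longleftrightarrow>
     (\<forall>u v. H1 \<Omega> u \<longrightarrow> H1 \<Omega> v \<longrightarrow> \<omega> (\<lambda>x. u x + v x) = \<omega> u + \<omega> v) \<and>
     (\<forall>c u. H1 \<Omega> u \<longrightarrow> \<omega> (\<lambda>x. c * u x) = c * \<omega> u) \<and>
     (\<exists>C. \<forall>u G. weak_grad \<Omega> u G \<longrightarrow>
        \<bar>\<omega> u\<bar> \<le> C * sqrt (integral\<^sup>L (lebesgue_on \<Omega>) (\<lambda>x. (u x)\<^sup>2)
                          + integral\<^sup>L (lebesgue_on \<Omega>) (\<lambda>x. (norm (G x))\<^sup>2)))"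

definition coeff_assms ::
  "(real^'n::finite) set \<Rightarrow> (real^'n \<Rightarrow> real \<Rightarrow> real^'n^'n) \<Rightarrow> (real^'n \<Rightarrow> real \<Rightarrow> real^'n^'n)
   \<Rightarrow> real \<Rightarrow> real \<Rightarrow> bool" where
  "coeff_assms \<Omega> A DA C \<nu> \<longleftrightarrow> C > 0 \<and> \<nu> > 0 \<and>
     (\<forall>s i j. (\<lambda>x. A x s $ i $ j) \<in> borel_measurable (lebesgue_on \<Omega>) \<and>
              (\<lambda>x. DA x s $ i $ j) \<in> borel_measurable (lebesgue_on \<Omega>)) \<and>
     (AE x in lebesgue_on \<Omega>.
        (\<forall>s. transpose (A x s) = A x s) \<and>
        (\<forall>s i j. ((\<lambda>t. A x t $ i $ j) has_real_derivative DA x s $ i $ j) (at s)) \<and>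
        (\<forall>i j. continuous_on UNIV (\<lambda>s. DA x s $ i $ j)) \<and>
        (\<forall>s i j. \<bar>A x s $ i $ j\<bar> \<le> C \<and> \<bar>DA x s $ i $ j\<bar> \<le> C) \<and>
        (\<forall>s \<xi>. (A x s *v \<xi>) \<bullet> \<xi> \<ge> \<nu> * (norm \<xi>)\<^sup>2))"

end

theory Submission
  imports Defs
begin

text \<open>On a bounded Lipschitz domain every function of \<open>H1\<close> is a limit of functions smooth up to the
  boundary: localize with a partition of unity and convolve with kernels supported in a small ball
  off the origin, chosen so that near the boundary only values inside the domain are averaged.
  Composing such approximations with the bounded smooth function \<open>t / (1 + (d t)\<^sup>2)\<close> shows that the
  truncation of \<open>w\<close> is an admissible test function, because the quadratic gradient term is
  integrable. The truncations have the same sign as \<open>w\<close> and increase to it in modulus as \<open>d\<close>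
  tends to \<open>0\<close>; since the negative part of the product is integrable, monotone convergence gives
  the integrability of the positive part, and dominated convergence the equation.\<close>

subsection \<open>Smooth functions\<close>

text \<open>The obstacle is that D_sA(x,u) grad u . grad u is only in L1, so H1-density alone does
  not extend the equation to \<open>w\<close>: the test functions must also be bounded, and the
  bound 1/d of the truncation supplies a dominating function for each fixed d. Writing the
  truncation as t times inverse (1 + (d t)^2) isolates a factor in (0, 1] that increases to 1 as d
  decreases; this factor, not monotonicity of the truncation in t, carries the monotone limit. The
  derivative of the truncation is bounded by 1 uniformly in d, so the gradients also converge by
  domination. Density is reached without an extension operator. A localized \<open>w\<close> is
  extended by zero, which may create a jump across the boundary, but a kernel displaced along a
  suitable cone never looks across the boundary from a point of the domain. With L the Lipschitz
  constant of the graph, the opening 1 / (2 (L + 1)) of the cone makes the drop in height exceed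
  both the variation of the graph and the vertical error.\<close>

lemma has_derivative_partial:
  assumes "(f has_derivative f') (at x)"
  shows "partial_deriv i f x = f' (axis i 1)"
  using frechet_derivative_at[OF assms] by (simp add: partial_deriv_def)

lemma C_k_continuous: "C_k k f \<Longrightarrow> continuous_on UNIV f"
  by (cases k) auto

lemma C_k_Suc_imp: "C_k (Suc k) f \<Longrightarrow> C_k k f"
  by (induction k arbitrary: f) auto

lemma partial_deriv_const: "partial_deriv i (\<lambda>x. c) x = 0"
  by (rule has_derivative_partial[OF has_derivative_const])

lemma C_k_const: "C_k k (\<lambda>x. c)"
proof (induction k arbitrary: c)
  case (Suc k)
  have "partial_deriv i (\<lambda>x. c) = (\<lambda>x. 0)" for i :: 'a
    by (simp add: partial_deriv_const fun_eq_iff)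
  with Suc show ?case by simp
qed simp

lemma C_k_component: "C_k k (\<lambda>x. x $ j)"
proof (cases k)
  case (Suc l)
  have d: "((\<lambda>x. x $ j) has_derivative (\<lambda>h. h $ j)) (at x)" for x :: "real^'a"
    by (rule bounded_linear_imp_has_derivative) (rule bounded_linear_vec_nth)
  have "partial_deriv i (\<lambda>x. x $ j) = (\<lambda>x. axis i 1 $ j)" for i :: 'a
    using has_derivative_partial[OF d] by (simp add: fun_eq_iff)
  with Suc show ?thesis
    using d by (auto simp: C_k_const differentiable_def intro!: continuous_intros)
qed (auto intro!: continuous_intros)

lemma partial_deriv_add:
  assumes "f differentiable (at x)" "g differentiable (at x)"
  shows "partial_deriv i (\<lambda>x. f x + g x) x = partial_deriv i f x + partial_deriv i g x"
proof -
  obtain f' g' where d: "(f has_derivative f') (at x)" "(g has_derivative g') (at x)"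
    using assms by (auto simp: differentiable_def)
  show ?thesis
    using has_derivative_partial[OF has_derivative_add[OF d]] d[THEN has_derivative_partial] by simp
qed

lemma partial_deriv_mult:
  fixes f g :: "real^'n \<Rightarrow> real"
  assumes "f differentiable (at x)" "g differentiable (at x)"
  shows "partial_deriv i (\<lambda>x. f x * g x) x = f x * partial_deriv i g x + partial_deriv i f x * g x"
proof -
  obtain f' g' where d: "(f has_derivative f') (at x)" "(g has_derivative g') (at x)"
    using assms by (auto simp: differentiable_def)
  show ?thesis
    using has_derivative_partial[OF has_derivative_mult[OF d]] d[THEN has_derivative_partial] by simp
qed

lemma partial_deriv_chain:
  fixes f :: "real^'n \<Rightarrow> real"
  assumes "f differentiable (at x)" "(h has_real_derivative h') (at (f x))"
  shows "partial_deriv i (\<lambda>x. h (f x)) x = h' * partial_deriv i f x"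
    and "(\<lambda>x. h (f x)) differentiable (at x)"
proof -
  obtain f' where d: "(f has_derivative f') (at x)"
    using assms by (auto simp: differentiable_def)
  have c: "((\<lambda>x. h (f x)) has_derivative (\<lambda>y. h' * f' y)) (at x)"
    using has_derivative_compose[OF d, of h "(*) h'"] assms(2) by (simp add: has_field_derivative_def)
  show "partial_deriv i (\<lambda>x. h (f x)) x = h' * partial_deriv i f x"
    using has_derivative_partial[OF c] has_derivative_partial[OF d] by simp
  show "(\<lambda>x. h (f x)) differentiable (at x)" using c by (auto simp: differentiable_def)
qed

lemma C_k_add: "C_k k f \<Longrightarrow> C_k k g \<Longrightarrow> C_k k (\<lambda>x. f x + g x)"
proof (induction k arbitrary: f g)
  case (Suc k)
  have "partial_deriv i (\<lambda>x. f x + g x) = (\<lambda>x. partial_deriv i f x + partial_deriv i g x)" for i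
    using Suc.prems by (simp add: fun_eq_iff partial_deriv_add)
  with Suc show ?case by (auto intro!: continuous_intros)
qed (auto intro!: continuous_intros)

lemma C_k_mult: "C_k k f \<Longrightarrow> C_k k g \<Longrightarrow> C_k k (\<lambda>x. f x * g x)"
proof (induction k arbitrary: f g)
  case (Suc k)
  have "partial_deriv i (\<lambda>x. f x * g x) = (\<lambda>x. f x * partial_deriv i g x + partial_deriv i f x * g x)" for i
    using Suc.prems by (simp add: fun_eq_iff partial_deriv_mult)
  moreover have "C_k k f" "C_k k g" using Suc.prems by (auto intro: C_k_Suc_imp)
  ultimately show ?case using Suc by (auto intro!: continuous_intros C_k_add)
qed (auto intro!: continuous_intros)

lemma C_k_minus: "C_k k f \<Longrightarrow> C_k k (\<lambda>x. - f x)"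
  using C_k_mult[OF C_k_const[of k "-1"]] by simp

lemma C_k_diff: "C_k k f \<Longrightarrow> C_k k g \<Longrightarrow> C_k k (\<lambda>x. f x - g x)"
  using C_k_add[OF _ C_k_minus] by simp

text \<open>The derivative of 1/f is a product of two copies of 1/f with a partial derivative of f,
  so the induction only asks for 1/f itself at one order less.\<close>

lemma C_k_inverse: "C_k k f \<Longrightarrow> (\<And>x. f x \<noteq> 0) \<Longrightarrow> C_k k (\<lambda>x. inverse (f x))"
proof (induction k arbitrary: f)
  case (Suc k)
  have d: "(inverse has_real_derivative - (inverse (f x) * inverse (f x))) (at (f x))" for x
    using DERIV_inverse[OF Suc.prems(2)] by (simp add: power2_eq_square)
  have "partial_deriv i (\<lambda>x. inverse (f x)) =
      (\<lambda>x. - (inverse (f x) * inverse (f x) * partial_deriv i f x))" for i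
    using Suc.prems by (simp add: fun_eq_iff partial_deriv_chain(1)[OF _ d])
  moreover have "(\<lambda>x. inverse (f x)) differentiable (at x)" for x
    using Suc.prems by (simp add: partial_deriv_chain(2)[OF _ d])
  moreover have "C_k k (\<lambda>x. inverse (f x))"
    using Suc.IH Suc.prems C_k_Suc_imp by blast
  ultimately show ?case
    using Suc.prems by (auto intro!: continuous_intros C_k_minus C_k_mult C_k_const)
qed (auto intro!: continuous_intros)

text \<open>This family is closed under differentiation up to linear combinations, which makes all
  its members smooth; the member with index \<open>0\<close> is the usual flat function.\<close>

definition flat :: "nat \<Rightarrow> real \<Rightarrow> real" where
  "flat n t = (if t > 0 then (1/t) ^ n * exp (- (1/t)) else 0)"

lemma flat_nonneg: "flat n t \<ge> 0"
  by (simp add: flat_def)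

lemma flat_pos_iff: "flat n t > 0 \<longleftrightarrow> t > 0"
  by (simp add: flat_def)

lemma flat_eq_0_iff: "flat n t = 0 \<longleftrightarrow> t \<le> 0"
  by (simp add: flat_def)

text \<open>Substituting s = 1/t turns the right-hand limit into that of s^n / exp s at infinity; on
  the left the function is identically 0.\<close>

lemma flat_tendsto_0: "(flat n \<longlongrightarrow> 0) (at 0)"
proof -
  have "((\<lambda>t. (1/t) ^ n / exp (1/t)) \<longlongrightarrow> (0::real)) (at_right 0)"
    using filterlim_compose[OF tendsto_power_div_exp_0 filterlim_inverse_at_top_right]
    by (simp add: inverse_eq_divide)
  moreover have "\<forall>\<^sub>F t in at_right 0. (1/t) ^ n / exp (1/t) = flat n t"
    by (auto simp: eventually_at_filter flat_def exp_minus field_simps)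
  ultimately have "(flat n \<longlongrightarrow> 0) (at_right 0)"
    by (rule Lim_transform_eventually)
  moreover have "(flat n \<longlongrightarrow> 0) (at_left 0)"
    by (rule tendsto_eventually) (auto simp: eventually_at_filter flat_def)
  ultimately show ?thesis by (simp add: filterlim_at_split)
qed

text \<open>For t > 0 the exponential contributes a factor (1/t)^2 and the power contributes - n
  (1/t)^(n+1), whence the indices n + 2 and n + 1.\<close>

lemma DERIV_flat: "(flat n has_real_derivative flat (n+2) t - of_nat n * flat (Suc n) t) (at t)"
proof -
  consider "t > 0" | "t < 0" | "t = 0" by linarith
  then show ?thesis
  proof cases
    case 1
    have "((\<lambda>t. (1/t) ^ n * exp (- (1/t))) has_real_derivative flat (n+2) t - of_nat n * flat (Suc n) t) (at t)"
    proof -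
      have "((\<lambda>t. (1/t) ^ n) has_real_derivative - of_nat n * (1/t) ^ Suc n) (at t)"
      proof (induction n)
        case (Suc n)
        have "((\<lambda>t. 1/t) has_real_derivative - (1/t) * (1/t)) (at t)"
          using 1 by (auto intro!: derivative_eq_intros)
        from DERIV_mult[OF this Suc] show ?case
          by (simp add: algebra_simps diff_divide_distrib)
      qed simp
      moreover have "((\<lambda>t. exp (- (1/t))) has_real_derivative exp (- (1/t)) * (1/t)\<^sup>2) (at t)"
        using 1 by (auto intro!: derivative_eq_intros simp: power2_eq_square)
      ultimately have "((\<lambda>t. (1/t) ^ n * exp (- (1/t))) has_real_derivative
          - of_nat n * (1/t) ^ Suc n * exp (- (1/t)) + exp (- (1/t)) * (1/t)\<^sup>2 * (1/t) ^ n) (at t)"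
        by (rule DERIV_mult)
      then show ?thesis
        using 1 by (simp add: flat_def power2_eq_square mult_ac)
    qed
    then show ?thesis
      by (rule DERIV_cong_ev[THEN iffD1, rotated -1])
         (use 1 in \<open>auto simp: flat_def intro!: eventually_mono[OF order_tendstoD(1)[OF tendsto_ident_at 1]]
            eventually_nhds_in_open[of "{0<..}", THEN eventually_mono]\<close>)
  next
    case 2
    have "((\<lambda>t. 0) has_real_derivative 0) (at t)" by simp
    moreover have "\<forall>\<^sub>F x in nhds t. 0 = flat n x"
      using 2 eventually_nhds_in_open[of "{..<0}" t] by (auto simp: flat_def elim!: eventually_mono)
    ultimately show ?thesis using 2
      by (subst DERIV_cong_ev[OF refl _ refl, of _ "\<lambda>t. 0"]) (auto simp: flat_def elim!: eventually_mono)
  next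
    case 3
    \<comment> \<open>At 0 the difference quotient of \<open>flat n\<close> is
      \<open>flat (Suc n)\<close>, so the limit for the next index gives the derivative 0.\<close>
    have "((\<lambda>h. (flat n (0 + h) - flat n 0) / h) \<longlongrightarrow> 0) (at 0)"
      using flat_tendsto_0[of "Suc n"] by (rule Lim_transform_eventually) (auto simp: flat_def eventually_at_filter)
    then show ?thesis using 3 by (simp add: DERIV_def flat_def)
  qed
qed

text \<open>The index \<open>n\<close> is generalized in the induction because differentiation moves
  it to n + 1 and n + 2.\<close>

lemma C_k_flat: "C_k k f \<Longrightarrow> C_k k (\<lambda>x. flat n (f x))"
proof (induction k arbitrary: n)
  case 0
  have "continuous_on UNIV (flat n)" for n
    by (intro continuous_at_imp_continuous_on ballI DERIV_isCont[OF DERIV_flat])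
  from continuous_on_compose2[OF this] 0 show ?case by simp
next
  case (Suc k)
  have "continuous_on UNIV (\<lambda>x. flat n (f x))"
    using Suc.IH[of n] Suc.prems by (metis C_k_Suc_imp C_k_continuous)
  moreover have "partial_deriv i (\<lambda>x. flat n (f x)) =
      (\<lambda>x. (flat (n+2) (f x) - of_nat n * flat (Suc n) (f x)) * partial_deriv i f x)" for i
    using Suc.prems by (simp add: fun_eq_iff partial_deriv_chain(1)[OF _ DERIV_flat])
  moreover have "(\<lambda>x. flat n (f x)) differentiable (at x)" for x
    using Suc.prems by (simp add: partial_deriv_chain(2)[OF _ DERIV_flat])
  moreover have "C_k k (\<lambda>x. flat n (f x))" for n
    using Suc C_k_Suc_imp by blast
  ultimately show ?case
    using Suc.prems by (auto intro!: C_k_diff C_k_mult C_k_const simp del: add_2_eq_Suc' of_nat_Suc)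
qed

section \<open>Closure properties of smooth functions\<close>

lemma smooth_const: "smooth (\<lambda>x. c)"
  and smooth_component: "smooth (\<lambda>x. x $ j)"
  and smooth_add: "smooth f \<Longrightarrow> smooth g \<Longrightarrow> smooth (\<lambda>x. f x + g x)"
  and smooth_mult: "smooth f \<Longrightarrow> smooth g \<Longrightarrow> smooth (\<lambda>x. f x * g x)"
  and smooth_inverse: "smooth f \<Longrightarrow> (\<And>x. f x \<noteq> 0) \<Longrightarrow> smooth (\<lambda>x. inverse (f x))"
  and smooth_flat: "smooth f \<Longrightarrow> smooth (\<lambda>x. flat n (f x))"
  by (simp_all add: smooth_def C_k_const C_k_component C_k_add C_k_mult C_k_inverse C_k_flat)

lemma smooth_diff: "smooth f \<Longrightarrow> smooth g \<Longrightarrow> smooth (\<lambda>x. f x - g x)"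
  by (simp add: smooth_def C_k_diff)

lemma smooth_sum: "(\<And>i. i \<in> I \<Longrightarrow> smooth (f i)) \<Longrightarrow> smooth (\<lambda>x. \<Sum>i\<in>I. f i x)"
  by (induction I rule: infinite_finite_induct) (auto intro: smooth_const smooth_add)

text \<open>The squared norm is a polynomial in the coordinates; bump functions are built from it
  because the norm itself is not smooth at the centre.\<close>

lemma smooth_norm2: "smooth (\<lambda>x. (norm (x - p))\<^sup>2)"
proof -
  have "smooth (\<lambda>x. \<Sum>j\<in>UNIV. (x $ j - p $ j) * (x $ j - p $ j))"
    by (intro smooth_sum smooth_mult smooth_diff smooth_component smooth_const)
  then show ?thesis by (simp add: power2_norm_eq_inner inner_vec_def)
qed

lemma smooth_partial_deriv: "smooth f \<Longrightarrow> smooth (partial_deriv i f)"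
  unfolding smooth_def by (metis C_k.simps(2))

lemma smooth_differentiable: "smooth f \<Longrightarrow> f differentiable (at x)"
  unfolding smooth_def by (metis C_k.simps(2))

lemma smooth_continuous: "smooth f \<Longrightarrow> continuous_on UNIV f"
  unfolding smooth_def using C_k_continuous by blast

lemma smooth_imp_borel [measurable_dest]: "smooth f \<Longrightarrow> f \<in> borel_measurable borel"
  by (rule borel_measurable_continuous_onI[OF smooth_continuous])

text \<open>Linearity on the standard basis recovers the total derivative from the vector of partial
  derivatives.\<close>

lemma smooth_has_derivative:
  fixes f :: "real^'n \<Rightarrow> real"
  assumes "smooth f"
  shows "(f has_derivative (\<lambda>h. h \<bullet> grad f x)) (at x)"
proof -
  let ?f' = "frechet_derivative f (at x)"
  have d: "(f has_derivative ?f') (at x)"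
    using smooth_differentiable[OF assms] by (simp add: frechet_derivative_works)
  interpret linear ?f' using d by (rule has_derivative_linear)
  have "?f' h = h \<bullet> grad f x" for h
  proof -
    have "?f' h = ?f' (\<Sum>i\<in>UNIV. h $ i *\<^sub>R axis i 1)"
      by (simp add: basis_expansion scalar_mult_eq_scaleR[symmetric])
    also have "\<dots> = (\<Sum>i\<in>UNIV. h $ i *\<^sub>R ?f' (axis i 1))"
      by (simp add: sum scale)
    finally show ?thesis by (simp add: grad_def partial_deriv_def inner_vec_def)
  qed
  then have "?f' = (\<lambda>h. h \<bullet> grad f x)" by (simp add: fun_eq_iff)
  with d show ?thesis by simp
qed

subsection \<open>Convolution with smooth kernels\<close>

text \<open>\<open>frechet_derivative\<close> chooses some f' satisfying
  \<open>has_derivative\<close>; local agreement makes this predicate the same for both functions,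
  so the choices coincide even where neither is differentiable.\<close>

lemma partial_deriv_cong_open:
  assumes "open S" "x \<in> S" "\<And>y. y \<in> S \<Longrightarrow> f y = g y"
  shows "partial_deriv i f x = partial_deriv i g x"
proof -
  have "(f has_derivative f') (at x) \<longleftrightarrow> (g has_derivative f') (at x)" for f'
    using has_derivative_transform_within_open[of f f' x UNIV S g]
      has_derivative_transform_within_open[of g f' x UNIV S f] assms by auto
  then show ?thesis by (simp add: partial_deriv_def frechet_derivative_def)
qed

text \<open>One-dimensional mean value theorem along the segment from x to x + h.\<close>

lemma smooth_mvt:
  fixes f :: "real^'n \<Rightarrow> real"
  assumes "smooth f"
  shows "\<exists>t\<in>{0<..<1}. f (x + h) - f x = h \<bullet> grad f (x + t *\<^sub>R h)"
proof -
  have "((\<lambda>t. f (x + t *\<^sub>R h)) has_derivative (\<lambda>s. (s *\<^sub>R h) \<bullet> grad f (x + t *\<^sub>R h))) (at t)" for t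
    by (rule has_derivative_compose[OF _ smooth_has_derivative[OF assms]])
      (auto intro!: derivative_eq_intros)
  then have "((\<lambda>t. f (x + t *\<^sub>R h)) has_real_derivative h \<bullet> grad f (x + t *\<^sub>R h)) (at t)" for t
    by (simp add: has_field_derivative_def mult_commute_abs)
  from MVT2[OF zero_less_one this] show ?thesis by (auto simp: mult.commute)
qed

text \<open>Compact support without reference to a domain: vanishing off a ball survives
  multiplication by smooth functions and differentiation, and gives integrability over the whole
  space.\<close>

definition smooth_compact :: "(real^'n::finite \<Rightarrow> real) \<Rightarrow> bool" where
  "smooth_compact f \<longleftrightarrow> smooth f \<and> (\<exists>R. \<forall>x. norm x > R \<longrightarrow> f x = 0)"

lemma smooth_compact_smooth: "smooth_compact f \<Longrightarrow> smooth f"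
  by (simp add: smooth_compact_def)

lemma smooth_compact_partial_deriv:
  assumes "smooth_compact f"
  shows "smooth_compact (partial_deriv i f)"
proof -
  obtain R where R: "\<And>x. norm x > R \<Longrightarrow> f x = 0" using assms by (auto simp: smooth_compact_def)
  have "open {x::real^'a. norm x > R}"
    by (intro open_Collect_less continuous_intros)
  then have "partial_deriv i f x = 0" if "norm x > R" for x
    using partial_deriv_cong_open[of "{x. norm x > R}" x f "\<lambda>x. 0"] R that
    by (simp add: partial_deriv_const)
  with assms show ?thesis by (auto simp: smooth_compact_def intro: smooth_partial_deriv)
qed

lemma smooth_compact_mult:
  "smooth f \<Longrightarrow> smooth_compact g \<Longrightarrow> smooth_compact (\<lambda>x. f x * g x)"
  by (auto simp: smooth_compact_def intro: smooth_mult)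

lemma test_fun_smooth_compact:
  assumes "test_fun \<Omega> \<phi>"
  shows "smooth_compact \<phi>"
proof -
  have "bounded (closure {x. \<phi> x \<noteq> 0})"
    using assms by (simp add: test_fun_def compact_imp_bounded)
  then obtain R where "\<forall>x\<in>closure {x. \<phi> x \<noteq> 0}. norm x \<le> R"
    by (auto simp: bounded_iff)
  then have "\<phi> x = 0" if "norm x > R" for x
    using closure_subset[of "{x. \<phi> x \<noteq> 0}"] that by force
  then show ?thesis using assms by (auto simp: smooth_compact_def test_fun_def)
qed

section \<open>Continuous functions of compact support\<close>

lemma compact_support_uniformly_continuous:
  fixes f :: "'a::euclidean_space \<Rightarrow> real"
  assumes "continuous_on UNIV f" "\<And>x. norm x > R \<Longrightarrow> f x = 0" "e > 0"
  shows "\<exists>d>0. \<forall>x y. dist x y < d \<longrightarrow> \<bar>f x - f y\<bar> < e"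
proof -
  have "uniformly_continuous_on (cball 0 (R+1)) f"
    using assms(1) by (intro compact_uniformly_continuous) (auto intro: continuous_on_subset)
  from uniformly_continuous_onE[OF this assms(3)] obtain d where d: "d > 0"
    "\<And>x y. x \<in> cball 0 (R+1) \<Longrightarrow> y \<in> cball 0 (R+1) \<Longrightarrow> dist y x < d \<Longrightarrow> dist (f y) (f x) < e"
    by metis
  \<comment> \<open>The cap 1 matches the radius R + 1: of two points closer than 1, either both lie
    in that ball or both have norm above R, where \<open>f\<close> vanishes.\<close>
  have "\<bar>f x - f y\<bar> < e" if "dist x y < min d 1" for x y
  proof (cases "x \<in> cball 0 (R+1) \<and> y \<in> cball 0 (R+1)")
    case True
    then show ?thesis using d(2)[of y x] that by (simp add: dist_real_def)
  next
    case False
    moreover have "norm x \<le> norm y + dist x y" "norm y \<le> norm x + dist x y"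
      using norm_triangle_sub[of x y] norm_triangle_sub[of y x]
      by (simp_all add: dist_norm norm_minus_commute)
    ultimately have "norm x > R" "norm y > R" using that by auto
    then show ?thesis using assms by simp
  qed
  then show ?thesis using d(1) by (intro exI[of _ "min d 1"]) auto
qed

lemma compact_support_bounded:
  fixes f :: "'a::euclidean_space \<Rightarrow> real"
  assumes "continuous_on UNIV f" "\<And>x. norm x > R \<Longrightarrow> f x = 0"
  shows "\<exists>M>0. \<forall>x. \<bar>f x\<bar> \<le> M"
proof -
  have "bounded (f ` cball 0 R)"
    using assms(1) by (intro compact_imp_bounded compact_continuous_image) (auto intro: continuous_on_subset)
  then obtain M where M: "M > 0" "\<And>x. norm x \<le> R \<Longrightarrow> \<bar>f x\<bar> \<le> M"
    by (auto simp: bounded_pos)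
  have "\<bar>f x\<bar> \<le> M" for x using M assms(2)[of x] by (cases "norm x \<le> R") auto
  with M(1) show ?thesis by auto
qed

lemma bounded_support_integrable:
  fixes f :: "'a::euclidean_space \<Rightarrow> real"
  assumes [measurable]: "f \<in> borel_measurable borel"
    and "\<And>x. norm x > R \<Longrightarrow> f x = 0" "\<And>x. \<bar>f x\<bar> \<le> M"
  shows "integrable lborel f"
proof (rule Bochner_Integration.integrable_bound[where f="\<lambda>x. indicator (cball 0 R) x * M"])
  show "integrable lborel (\<lambda>x::'a. indicator (cball 0 R) x * M)"
    by (intro integrable_mult_left integrable_real_indicator) (auto simp: emeasure_lborel_cball_finite[unfolded infinity_ennreal_def])
  show "AE x in lborel. norm (f x) \<le> norm (indicator (cball 0 R) x * M)"
  proof (rule AE_I2)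
    fix x :: 'a
    show "norm (f x) \<le> norm (indicator (cball 0 R) x * M)"
      using assms(2)[of x] assms(3)[of x] by (cases "norm x \<le> R") auto
  qed
qed simp

lemma smooth_compact_bounded:
  assumes "smooth_compact f"
  shows "\<exists>M>0. \<forall>x. \<bar>f x\<bar> \<le> M"
proof -
  obtain R where "\<And>x. norm x > R \<Longrightarrow> f x = 0" using assms by (auto simp: smooth_compact_def)
  then show ?thesis
    by (intro compact_support_bounded smooth_continuous smooth_compact_smooth assms)
qed

lemma smooth_compact_integrable:
  assumes "smooth_compact f"
  shows "integrable lborel f"
proof -
  obtain R where R: "\<And>x. norm x > R \<Longrightarrow> f x = 0" using assms by (auto simp: smooth_compact_def)
  obtain M where M: "\<And>x. \<bar>f x\<bar> \<le> M" using smooth_compact_bounded[OF assms] by blast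
  show ?thesis
    using smooth_imp_borel[OF smooth_compact_smooth[OF assms]] R M by (rule bounded_support_integrable)
qed

lemma lborel_integral_shift:
  fixes f :: "real^'n \<Rightarrow> real"
  assumes "f \<in> borel_measurable borel"
  shows "(\<integral>x. f (x + c) \<partial>lborel) = (\<integral>x. f x \<partial>lborel)"
  using integral_distr[of "(+) c" lborel borel f] assms by (simp add: lborel_distr_plus add.commute)

lemma lborel_integrable_shift:
  fixes f :: "real^'n \<Rightarrow> real"
  assumes "integrable lborel f"
  shows "integrable lborel (\<lambda>x. f (x + c))"
  using integrable_distr[of "(+) c" lborel borel f] assms by (simp add: lborel_distr_plus add.commute)

lemma inner_axis_grad: "axis i 1 \<bullet> grad f x = partial_deriv i f x"
  by (simp add: grad_def inner_axis' )

text \<open>Translation invariance makes the integral of every difference quotient vanish; the mean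
  value theorem bounds the quotients by a bound of the derivative, so dominated convergence
  applies.\<close>

lemma integral_partial_deriv_eq_0:
  fixes h :: "real^'n \<Rightarrow> real"
  assumes h: "smooth_compact h"
  shows "(\<integral>x. partial_deriv i h x \<partial>lborel) = 0"
proof -
  let ?D = "partial_deriv i h" and ?e = "\<lambda>n. (1 / real (Suc n)) *\<^sub>R axis i 1 :: real^'n"
  define F where "F = (\<lambda>n x. real (Suc n) * (h (x + ?e n) - h x))"
  note [measurable] = smooth_imp_borel[OF smooth_compact_smooth[OF h]]
    smooth_imp_borel[OF smooth_partial_deriv[OF smooth_compact_smooth[OF h]]]
  obtain M where M: "\<And>x. \<bar>?D x\<bar> \<le> M"
    using smooth_compact_bounded[OF smooth_compact_partial_deriv[OF h]] by blast
  obtain R where R: "\<And>x. norm x > R \<Longrightarrow> h x = 0" using h by (auto simp: smooth_compact_def)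
  have mv: "\<exists>z. norm z \<le> 1 / real (Suc n) \<and> F n x = ?D (x + z)" for n x
  proof -
    obtain t where t: "t \<in> {0<..<1}" "h (x + ?e n) - h x = ?e n \<bullet> grad h (x + t *\<^sub>R ?e n)"
      using smooth_mvt[OF smooth_compact_smooth[OF h], of x "?e n"] by blast
    have "F n x = ?D (x + t *\<^sub>R ?e n)"
      unfolding F_def t(2) by (simp add: inner_axis_grad)
    moreover have "norm (t *\<^sub>R ?e n) \<le> 1 / real (Suc n)"
      using t(1) by (simp add: norm_axis_1 divide_right_mono)
    ultimately show ?thesis by blast
  qed
  \<comment> \<open>The quotients use steps of length at most 1, so all of them vanish outside the
    ball of radius R + 1.\<close>
  have "(\<lambda>n. \<integral>x. F n x \<partial>lborel) \<longlonglongrightarrow> (\<integral>x. ?D x \<partial>lborel)"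
  proof (rule integral_dominated_convergence[where w="\<lambda>x. indicator (cball 0 (R+1)) x * M"])
    show "integrable lborel (\<lambda>x::real^'n. indicator (cball 0 (R+1)) x * M)"
      by (intro integrable_mult_left integrable_real_indicator) (auto simp: emeasure_lborel_cball_finite[unfolded infinity_ennreal_def])
    show "F n \<in> borel_measurable lborel" for n unfolding F_def by measurable
    show "AE x in lborel. norm (F n x) \<le> indicator (cball 0 (R+1)) x * M" for n
    proof (rule AE_I2)
      fix x :: "real^'n"
      show "norm (F n x) \<le> indicator (cball 0 (R+1)) x * M"
      proof (cases "norm x \<le> R + 1")
        case True
        then show ?thesis using mv[of n x] M by auto
      next
        case False
        have "norm x \<le> norm (x + ?e n) + norm (?e n)"
          using norm_triangle_ineq4[of "x + ?e n" "?e n"] by simp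
        moreover have "norm (?e n) \<le> 1" by (simp add: norm_axis_1)
        ultimately have "norm (x + ?e n) > R" using False by linarith
        then show ?thesis using False R by (simp add: F_def)
      qed
    qed
    show "AE x in lborel. (\<lambda>n. F n x) \<longlonglongrightarrow> ?D x"
    proof (rule AE_I2)
      fix x
      obtain z where z: "\<And>n. norm (z n) \<le> 1 / real (Suc n)" "\<And>n. F n x = ?D (x + z n)"
        using choice[of "\<lambda>n z. norm z \<le> 1 / real (Suc n) \<and> F n x = ?D (x + z)"] mv by auto
      have "z \<longlonglongrightarrow> 0"
        by (rule Lim_null_comparison[OF always_eventually[OF allI[OF z(1)]]])
          (use LIMSEQ_inverse_real_of_nat in \<open>simp add: inverse_eq_divide\<close>)
      then have "(\<lambda>n. x + z n) \<longlonglongrightarrow> x" using tendsto_add[OF tendsto_const] by fastforce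
      then have "(\<lambda>n. ?D (x + z n)) \<longlonglongrightarrow> ?D x"
        using smooth_continuous[OF smooth_partial_deriv[OF smooth_compact_smooth[OF h]]]
        by (intro isCont_tendsto_compose[of x ?D]) (auto simp: continuous_on_eq_continuous_at)
      then show "(\<lambda>n. F n x) \<longlonglongrightarrow> ?D x" by (simp add: z(2))
    qed
  qed simp
  moreover have "(\<integral>x. F n x \<partial>lborel) = 0" for n
    using lborel_integrable_shift[OF smooth_compact_integrable[OF h]] smooth_compact_integrable[OF h]
    by (simp add: F_def lborel_integral_shift)
  ultimately show ?thesis by (simp add: LIMSEQ_const_iff)
qed

definition conv :: "(real^'n::finite \<Rightarrow> real) \<Rightarrow> (real^'n \<Rightarrow> real) \<Rightarrow> real^'n \<Rightarrow> real" where
  "conv \<eta> f x = (\<integral>y. \<eta> (x - y) * f y \<partial>lborel)"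

lemma bounded_mult_integrable:
  fixes f :: "real^'n \<Rightarrow> real"
  assumes "integrable lborel f" "\<eta> \<in> borel_measurable borel" "\<And>x. \<bar>\<eta> x\<bar> \<le> M"
  shows "integrable lborel (\<lambda>y. \<eta> y * f y)"
proof (rule Bochner_Integration.integrable_bound[where f="\<lambda>x. M * f x"])
  show "AE x in lborel. norm (\<eta> x * f x) \<le> norm (M * f x)"
  proof (rule AE_I2)
    fix x
    have "\<bar>\<eta> x\<bar> \<le> \<bar>M\<bar>" using assms(3)[of x] by linarith
    then show "norm (\<eta> x * f x) \<le> norm (M * f x)" by (simp add: abs_mult mult_right_mono)
  qed
qed (use assms in auto)

lemma conv_integrable:
  fixes f :: "real^'n \<Rightarrow> real"
  assumes "integrable lborel f" "smooth_compact \<eta>"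
  shows "integrable lborel (\<lambda>y. \<eta> (x - y) * f y)"
proof -
  note [measurable] = smooth_imp_borel[OF smooth_compact_smooth[OF assms(2)]]
  obtain M where "\<And>x. \<bar>\<eta> x\<bar> \<le> M" using smooth_compact_bounded[OF assms(2)] by blast
  then show ?thesis
    by (intro bounded_mult_integrable[where M=M and \<eta>="\<lambda>y. \<eta> (x - y)"] assms) auto
qed

text \<open>Uniformity in z comes from the mean value theorem and the uniform continuity of the
  compactly supported partial derivatives. It allows the remainder to be integrated against any L1
  function.\<close>

lemma smooth_compact_uniform_derivative:
  fixes \<eta> :: "real^'n \<Rightarrow> real"
  assumes \<eta>: "smooth_compact \<eta>" and "e > 0"
  shows "\<exists>d>0. \<forall>z h. norm h < d \<longrightarrow> \<bar>\<eta> (z + h) - \<eta> z - h \<bullet> grad \<eta> z\<bar> \<le> e * norm h"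
proof -
  \<comment> \<open>The Euclidean norm of the gradient difference is estimated by the sum of its
    \<open>CARD('n)\<close> components, each of which receives the share e'.\<close>
  define e' where "e' = e / real CARD('n)"
  have "e' > 0" using \<open>e > 0\<close> by (simp add: e'_def)
  have "\<exists>d>0. \<forall>x y. dist x y < d \<longrightarrow> \<bar>partial_deriv i \<eta> x - partial_deriv i \<eta> y\<bar> < e'" for i
  proof -
    obtain R where "\<And>x. norm x > R \<Longrightarrow> partial_deriv i \<eta> x = 0"
      using smooth_compact_partial_deriv[OF \<eta>] by (auto simp: smooth_compact_def)
    then show ?thesis
      using \<open>e' > 0\<close> by (intro compact_support_uniformly_continuous smooth_continuous
          smooth_compact_smooth smooth_compact_partial_deriv \<eta>)
  qed
  then obtain d where d: "\<And>i. d i > 0"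
    "\<And>i x y. dist x y < d i \<Longrightarrow> \<bar>partial_deriv i \<eta> x - partial_deriv i \<eta> y\<bar> < e'" by metis
  let ?d = "Min (range d)"
  have "\<bar>\<eta> (z + h) - \<eta> z - h \<bullet> grad \<eta> z\<bar> \<le> e * norm h" if h: "norm h < ?d" for z h
  proof -
    obtain t where t: "t \<in> {0<..<1}" "\<eta> (z + h) - \<eta> z = h \<bullet> grad \<eta> (z + t *\<^sub>R h)"
      using smooth_mvt[OF smooth_compact_smooth[OF \<eta>], of z h] by blast
    have "norm (t *\<^sub>R h) \<le> norm h" using t(1) by (simp add: mult_left_le_one_le)
    then have "dist (z + t *\<^sub>R h) z < d i" for i
    proof -
      have "norm h < d i" using h by (simp add: Min_gr_iff)
      with \<open>norm (t *\<^sub>R h) \<le> norm h\<close> have "norm (t *\<^sub>R h) < d i" by (rule order_le_less_trans)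
      then show ?thesis by (simp add: dist_norm)
    qed
    note b = d(2)[OF this]
    have "norm (grad \<eta> (z + t *\<^sub>R h) - grad \<eta> z) \<le> (\<Sum>i\<in>UNIV. \<bar>(grad \<eta> (z + t *\<^sub>R h) - grad \<eta> z) $ i\<bar>)"
      by (rule norm_le_l1_cart)
    also have "\<dots> \<le> (\<Sum>i\<in>(UNIV::'n set). e')"
      using b by (intro sum_mono less_imp_le) (simp add: grad_def)
    also have "\<dots> = e" by (simp add: e'_def)
    finally have "norm h * norm (grad \<eta> (z + t *\<^sub>R h) - grad \<eta> z) \<le> norm h * e"
      by (rule mult_left_mono) simp
    then have "\<bar>h \<bullet> (grad \<eta> (z + t *\<^sub>R h) - grad \<eta> z)\<bar> \<le> norm h * e"
      using Cauchy_Schwarz_ineq2 order_trans by blast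
    then show ?thesis unfolding t(2) by (simp add: inner_diff_right mult.commute)
  qed
  moreover have "?d > 0" using d(1) by simp
  ultimately show ?thesis by blast
qed

text \<open>The first-order remainder of the kernel is uniformly small; multiplied by |f| and
  integrated, it costs only the factor \<open>I\<close>, the L1 norm of \<open>f\<close>.\<close>

lemma conv_has_derivative:
  fixes f :: "real^'n \<Rightarrow> real"
  assumes f: "integrable lborel f" and \<eta>: "smooth_compact \<eta>"
  shows "(conv \<eta> f has_derivative (\<lambda>h. \<Sum>i\<in>UNIV. h $ i * conv (partial_deriv i \<eta>) f x)) (at x)"
    (is "(_ has_derivative ?L) _")
  unfolding has_derivative_at_alt
proof (intro conjI allI impI)
  show "bounded_linear ?L"
    by (intro bounded_linear_sum bounded_linear_compose[OF bounded_linear_mult_left bounded_linear_vec_nth])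
  fix e :: real assume "e > 0"
  define I where "I = (\<integral>y. \<bar>f y\<bar> \<partial>lborel)"
  have I: "I \<ge> 0" by (simp add: I_def)
  \<comment> \<open>Dividing by I + 1 instead of \<open>I\<close> covers the case I = 0.\<close>
  then obtain d where d: "d > 0"
    "\<And>z h. norm h < d \<Longrightarrow> \<bar>\<eta> (z + h) - \<eta> z - h \<bullet> grad \<eta> z\<bar> \<le> (e / (I + 1)) * norm h"
    using smooth_compact_uniform_derivative[OF \<eta>, of "e / (I + 1)"] \<open>e > 0\<close> by auto
  have "norm (conv \<eta> f y - conv \<eta> f x - ?L (y - x)) \<le> e * norm (y - x)" if "norm (y - x) < d" for y
  proof -
    define h where "h = y - x"
    note int = conv_integrable[OF f \<eta>] conv_integrable[OF f smooth_compact_partial_deriv[OF \<eta>]]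
    have "?L h = (\<integral>z. (\<Sum>i\<in>UNIV. h $ i * (partial_deriv i \<eta> (x - z) * f z)) \<partial>lborel)"
      unfolding conv_def using int by simp
    also have "\<dots> = (\<integral>z. (h \<bullet> grad \<eta> (x - z)) * f z \<partial>lborel)"
      by (simp add: inner_vec_def grad_def sum_distrib_right mult.assoc)
    finally have L: "?L h = \<dots>" .
    have iL: "integrable lborel (\<lambda>z. (h \<bullet> grad \<eta> (x - z)) * f z)"
    proof -
      have "integrable lborel (\<lambda>z. (\<Sum>i\<in>UNIV. h $ i * (partial_deriv i \<eta> (x - z) * f z)))"
        using int by simp
      then show ?thesis by (simp add: inner_vec_def grad_def sum_distrib_right mult.assoc)
    qed
    have "conv \<eta> f y - conv \<eta> f x - ?L h =
        (\<integral>z. \<eta> (y - z) * f z - \<eta> (x - z) * f z - (h \<bullet> grad \<eta> (x - z)) * f z \<partial>lborel)"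
      unfolding L unfolding conv_def using int iL by simp
    also have "norm \<dots> \<le> (\<integral>z. (e / (I + 1)) * norm h * \<bar>f z\<bar> \<partial>lborel)"
    proof (rule order_trans[OF integral_norm_bound integral_mono])
      fix z
      have "\<bar>\<eta> (x - z + h) - \<eta> (x - z) - h \<bullet> grad \<eta> (x - z)\<bar> \<le> (e / (I + 1)) * norm h"
        using that by (intro d(2)) (simp add: h_def)
      then have "\<bar>\<eta> (y - z) - \<eta> (x - z) - h \<bullet> grad \<eta> (x - z)\<bar> * \<bar>f z\<bar> \<le> (e / (I + 1)) * norm h * \<bar>f z\<bar>"
        by (intro mult_right_mono) (simp_all add: h_def)
      then show "norm (\<eta> (y - z) * f z - \<eta> (x - z) * f z - (h \<bullet> grad \<eta> (x - z)) * f z)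
          \<le> (e / (I + 1)) * norm h * \<bar>f z\<bar>"
        by (simp add: abs_mult[symmetric] left_diff_distrib)
    qed (use int iL f in auto)
    also have "\<dots> = e * norm h * (I / (I + 1))" by (simp add: I_def)
    also have "\<dots> \<le> e * norm h * 1"
      using I \<open>e > 0\<close> by (intro mult_left_mono) auto
    finally show ?thesis by (simp add: h_def)
  qed
  with d(1) show "\<exists>d>0. \<forall>y. norm (y - x) < d \<longrightarrow>
      norm (conv \<eta> f y - conv \<eta> f x - ?L (y - x)) \<le> e * norm (y - x)" by blast
qed

lemma partial_deriv_conv:
  assumes "integrable lborel f" "smooth_compact \<eta>"
  shows "partial_deriv i (conv \<eta> f) = conv (partial_deriv i \<eta>) f"
proof
  fix x
  show "partial_deriv i (conv \<eta> f) x = conv (partial_deriv i \<eta>) f x"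
    using has_derivative_partial[OF conv_has_derivative[OF assms]]
    by (simp add: axis_def if_distrib[of "\<lambda>c. c * _"] cong: if_cong)
qed

text \<open>Every derivative falls on the kernel, which stays \<open>smooth_compact\<close>, so the
  induction runs over all kernels with \<open>f\<close> fixed.\<close>

lemma smooth_conv:
  assumes "integrable lborel f" "smooth_compact \<eta>"
  shows "smooth (conv \<eta> f)"
proof -
  have "C_k k (conv \<eta> f)" for k
    using assms(2)
  proof (induction k arbitrary: \<eta>)
    case 0
    then show ?case
      using has_derivative_continuous[OF conv_has_derivative[OF assms(1)]]
      by (simp add: continuous_on_eq_continuous_at)
  next
    case (Suc k)
    then show ?case
      using has_derivative_continuous[OF conv_has_derivative[OF assms(1)]]
        differentiableI[OF conv_has_derivative[OF assms(1)]]
      by (auto simp: continuous_on_eq_continuous_at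
          partial_deriv_conv[OF assms(1)] smooth_compact_partial_deriv)
  qed
  then show ?thesis by (simp add: smooth_def)
qed

subsection \<open>Mollification of square integrable functions\<close>

text \<open>The support must lie in the ball of radius d about 0, but neither symmetry nor mass near
  0 is demanded; this admits the displaced kernels that the boundary calls for.\<close>

definition mollifier :: "real \<Rightarrow> (real^'n::finite \<Rightarrow> real) \<Rightarrow> bool" where
  "mollifier d \<eta> \<longleftrightarrow> smooth_compact \<eta> \<and> (\<forall>z. \<eta> z \<ge> 0) \<and> (\<integral>z. \<eta> z \<partial>lborel) = 1 \<and>
     (\<forall>z. \<eta> z \<noteq> 0 \<longrightarrow> norm z < d)"

lemma lborel_distr_reflect:
  "distr lborel borel (\<lambda>y. x - y) = (lborel :: (real^'n) measure)"
proof -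
  have "density (distr lborel borel (\<lambda>y. x - y)) (\<lambda>_. 1) = (lborel :: (real^'n) measure)"
    using lborel_affine[of "-1" x] by simp
  then show ?thesis by (simp add: density_1)
qed

lemma lborel_integral_reflect:
  fixes f :: "real^'n \<Rightarrow> real"
  assumes "f \<in> borel_measurable borel"
  shows "(\<integral>y. f (x - y) \<partial>lborel) = (\<integral>y. f y \<partial>lborel)"
  using integral_distr[of "\<lambda>y. x - y" lborel borel f] assms by (simp add: lborel_distr_reflect)

lemma nn_integral_lborel_shift:
  fixes f :: "real^'n \<Rightarrow> ennreal"
  assumes "f \<in> borel_measurable borel"
  shows "(\<integral>\<^sup>+x. f (x + c) \<partial>lborel) = (\<integral>\<^sup>+x. f x \<partial>lborel)"
  using nn_integral_distr[of "(+) c" lborel borel f] assms by (simp add: lborel_distr_plus add.commute)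

lemma nn_integral_eq_integral_nonneg: 
  "integrable M f \<Longrightarrow> (\<And>x. f x \<ge> 0) \<Longrightarrow> (\<integral>\<^sup>+x. ennreal (f x) \<partial>M) = ennreal (\<integral>x. f x \<partial>M)"
  by (rule nn_integral_eq_integral) auto

text \<open>Averaging against a probability density contracts L2: Jensen's inequality pointwise,
  combined with Tonelli and translation invariance. With a nonnegative integral on the left, its
  finiteness is part of the conclusion.\<close>

lemma conv_L2_bound:
  fixes f :: "real^'n \<Rightarrow> real"
  assumes \<eta>: "mollifier d \<eta>" and f: "integrable lborel f" "integrable lborel (\<lambda>x. (f x)\<^sup>2)"
  shows "(\<integral>\<^sup>+x. ennreal ((conv \<eta> f x)\<^sup>2) \<partial>lborel) \<le> ennreal (\<integral>x. (f x)\<^sup>2 \<partial>lborel)"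
proof -
  have sc: "smooth_compact \<eta>" and nonneg: "\<And>z. \<eta> z \<ge> 0" and one: "(\<integral>z. \<eta> z \<partial>lborel) = 1"
    using \<eta> by (auto simp: mollifier_def)
  note [measurable] = smooth_imp_borel[OF smooth_compact_smooth[OF sc]]
  have [measurable]: "f \<in> borel_measurable borel" using f(1) by auto
  have i1: "integrable lborel (\<lambda>y. \<eta> (x - y))" for x
  proof (rule integrableI_nn_integral_finite[where x=1])
    have "(\<integral>\<^sup>+y. ennreal (\<eta> (x - y)) \<partial>lborel) = (\<integral>\<^sup>+y. ennreal (\<eta> y) \<partial>lborel)"
      using nn_integral_distr[of "\<lambda>y. x - y" lborel borel "\<lambda>y. ennreal (\<eta> y)"]
      by (simp add: lborel_distr_reflect)
    then show "(\<integral>\<^sup>+y. ennreal (\<eta> (x - y)) \<partial>lborel) = ennreal 1"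
      using nonneg one smooth_compact_integrable[OF sc] by (simp add: nn_integral_eq_integral_nonneg)
  qed (use nonneg in auto)
  have one': "(\<integral>y. \<eta> (x - y) \<partial>lborel) = 1" for x
    using one by (simp add: lborel_integral_reflect)
  text \<open>Cauchy-Schwarz for the probability density \<open>\<lambda>y. \<eta> (x - y)\<close>, as nonnegativity of a variance.\<close>
  have jensen: "(conv \<eta> f x)\<^sup>2 \<le> (\<integral>y. \<eta> (x - y) * (f y)\<^sup>2 \<partial>lborel)" for x
  proof -
    define c where "c = conv \<eta> f x"
    note i = i1[of x] conv_integrable[OF f(1) sc, of x] conv_integrable[OF f(2) sc, of x]
    have "0 \<le> (\<integral>y. \<eta> (x - y) * (f y - c)\<^sup>2 \<partial>lborel)"
      using nonneg by (intro integral_nonneg_AE AE_I2) auto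
    also have "\<dots> = (\<integral>y. \<eta> (x - y) * (f y)\<^sup>2 - 2 * c * (\<eta> (x - y) * f y) + c\<^sup>2 * \<eta> (x - y) \<partial>lborel)"
      by (simp add: power2_diff algebra_simps)
    also have "\<dots> = (\<integral>y. \<eta> (x - y) * (f y)\<^sup>2 \<partial>lborel) - 2 * c * c + c\<^sup>2 * 1"
      unfolding one'[of x, symmetric] c_def conv_def using i by simp
    finally show ?thesis by (simp add: c_def power2_eq_square)
  qed
  have "(\<integral>\<^sup>+x. ennreal ((conv \<eta> f x)\<^sup>2) \<partial>lborel) \<le>
      (\<integral>\<^sup>+x. (\<integral>\<^sup>+y. ennreal (\<eta> (x - y) * (f y)\<^sup>2) \<partial>lborel) \<partial>lborel)"
    using jensen nonneg by (intro nn_integral_mono)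
      (simp add: nn_integral_eq_integral_nonneg conv_integrable[OF f(2) sc])
  also have "\<dots> = (\<integral>\<^sup>+y. (\<integral>\<^sup>+x. ennreal (\<eta> (x - y) * (f y)\<^sup>2) \<partial>lborel) \<partial>lborel)"
    by (rule lborel_pair.Fubini'[symmetric]) measurable
  also have "\<dots> = (\<integral>\<^sup>+y. ennreal ((f y)\<^sup>2) \<partial>lborel)"
  proof (rule nn_integral_cong)
    fix y
    have "(\<integral>\<^sup>+x. ennreal (\<eta> (x - y) * (f y)\<^sup>2) \<partial>lborel) = (\<integral>\<^sup>+x. ennreal (\<eta> (x - y)) \<partial>lborel) * ennreal ((f y)\<^sup>2)"
      using nonneg by (simp add: ennreal_mult nn_integral_multc)
    also have "(\<integral>\<^sup>+x. ennreal (\<eta> (x - y)) \<partial>lborel) = (\<integral>\<^sup>+x. ennreal (\<eta> x) \<partial>lborel)"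
      using nn_integral_lborel_shift[of "\<lambda>x. ennreal (\<eta> x)" "- y"] by simp
    also have "\<dots> = 1" using nonneg one smooth_compact_integrable[OF sc] by (simp add: nn_integral_eq_integral_nonneg)
    finally show "(\<integral>\<^sup>+x. ennreal (\<eta> (x - y) * (f y)\<^sup>2) \<partial>lborel) = ennreal ((f y)\<^sup>2)" by simp
  qed
  also have "\<dots> = ennreal (\<integral>x. (f x)\<^sup>2 \<partial>lborel)" using f(2) by (simp add: nn_integral_eq_integral_nonneg)
  finally show ?thesis .
qed

text \<open>\<open>conv \<eta> g x\<close> is an average of values of \<open>g\<close> at points
  closer than d to x.\<close>

lemma conv_uniform:
  fixes g :: "real^'n \<Rightarrow> real"
  assumes \<eta>: "mollifier d \<eta>" and g: "integrable lborel g"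
    and e: "\<And>x y. dist x y < d \<Longrightarrow> \<bar>g x - g y\<bar> \<le> e"
  shows "\<bar>conv \<eta> g x - g x\<bar> \<le> e"
proof -
  have sc: "smooth_compact \<eta>" and nonneg: "\<And>z. \<eta> z \<ge> 0" and one: "(\<integral>z. \<eta> z \<partial>lborel) = 1"
    and supp: "\<And>z. \<eta> z \<noteq> 0 \<Longrightarrow> norm z < d"
    using \<eta> by (auto simp: mollifier_def)
  note [measurable] = smooth_imp_borel[OF smooth_compact_smooth[OF sc]]
  have one': "(\<integral>y. \<eta> (x - y) \<partial>lborel) = 1" for x
    using one by (simp add: lborel_integral_reflect)
  have i1: "integrable lborel (\<lambda>y. \<eta> (x - y))"
    \<comment> \<open>The value 1 certifies integrability, since the integral of a non-integrable
      function is 0 by convention.\<close>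
    using not_integrable_integral_eq[of lborel "\<lambda>y. \<eta> (x - y)"] one'[of x] by fastforce
  have "conv \<eta> g x - g x = (\<integral>y. \<eta> (x - y) * g y - g x * \<eta> (x - y) \<partial>lborel)"
    using conv_integrable[OF g sc] i1 by (simp add: conv_def one')
  also have "\<bar>\<dots>\<bar> \<le> (\<integral>y. e * \<eta> (x - y) \<partial>lborel)"
  proof (rule order_trans[OF integral_abs_bound integral_mono])
    fix y
    have "\<bar>\<eta> (x - y)\<bar> * \<bar>g y - g x\<bar> \<le> \<bar>\<eta> (x - y)\<bar> * e"
    proof (cases "\<eta> (x - y) = 0")
      case False
      then show ?thesis using supp[OF False] e[of y x]
        by (intro mult_left_mono) (auto simp: dist_norm norm_minus_commute)
    qed simp
    moreover have "\<eta> (x - y) * g y - g x * \<eta> (x - y) = \<eta> (x - y) * (g y - g x)"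
      by (simp add: algebra_simps)
    ultimately show "\<bar>\<eta> (x - y) * g y - g x * \<eta> (x - y)\<bar> \<le> e * \<eta> (x - y)"
      using nonneg[of "x - y"] by (simp add: abs_mult mult.commute)
  qed (use conv_integrable[OF g sc] i1 in auto)
  also have "\<dots> = e" by (simp add: one')
  finally show ?thesis .
qed

lemma conv_support:
  assumes \<eta>: "mollifier d \<eta>" and "\<And>x. norm x > R \<Longrightarrow> g x = 0" "norm x > R + d"
  shows "conv \<eta> g x = 0"
proof -
  have "\<eta> (x - y) * g y = 0" for y
  proof (rule ccontr)
    assume "\<eta> (x - y) * g y \<noteq> 0"
    then have "norm (x - y) < d" "norm y \<le> R"
      using assms by (auto simp: mollifier_def not_less[symmetric])
    then show False using assms(3) norm_triangle_sub[of x y] by linarith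
  qed
  then have "(\<lambda>y. \<eta> (x - y) * g y) = (\<lambda>y. 0)" by (rule ext)
  then show ?thesis by (simp only: conv_def integral_zero)
qed

text \<open>Obtained from the approximation of a measurable function by continuous ones almost
  everywhere, after two truncations that make dominated convergence applicable.\<close>

lemma L2_dense_continuous:
  fixes f :: "real^'n \<Rightarrow> real"
  assumes [measurable]: "f \<in> borel_measurable borel" and f2: "integrable lborel (\<lambda>x. (f x)\<^sup>2)"
    and R: "\<And>x. norm x > R \<Longrightarrow> f x = 0" and "e > 0"
  shows "\<exists>g. continuous_on UNIV g \<and> (\<forall>x. norm x > R + 1 \<longrightarrow> g x = 0) \<and>
    integrable lborel (\<lambda>x. (f x - g x)\<^sup>2) \<and> (\<integral>x. (f x - g x)\<^sup>2 \<partial>lborel) < e"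
proof -
  \<comment> \<open>Clipping at level M: the error is dominated by |f| and vanishes at x as soon as
    M is at least |f x|.\<close>
  define c :: "real \<Rightarrow> real \<Rightarrow> real" where "c = (\<lambda>M t. max (-M) (min M t))"
  have cM: "\<bar>c M t\<bar> \<le> M" "\<bar>t - c M t\<bar> \<le> \<bar>t\<bar>" if "M \<ge> 0" for M t using that by (auto simp: c_def)
  have ccont: "continuous_on UNIV (c M)" for M unfolding c_def by (intro continuous_intros)
  have [measurable]: "c M \<in> borel_measurable borel" for M
    using ccont by (rule borel_measurable_continuous_onI)
  have "(\<lambda>n. \<integral>x. (f x - c (real n) (f x))\<^sup>2 \<partial>lborel) \<longlonglongrightarrow> (\<integral>x. 0 \<partial>(lborel::(real^'n) measure))"
  proof (rule integral_dominated_convergence[where w="\<lambda>x. (f x)\<^sup>2"])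
    show "AE x in lborel. (\<lambda>n. (f x - c (real n) (f x))\<^sup>2) \<longlonglongrightarrow> 0"
    proof (rule AE_I2, rule tendsto_eventually)
      fix x
      show "\<forall>\<^sub>F n in sequentially. (f x - c (real n) (f x))\<^sup>2 = 0"
        using eventually_ge_at_top[of "nat \<lceil>\<bar>f x\<bar>\<rceil>"]
      proof eventually_elim
        case (elim n)
        then have "\<bar>f x\<bar> \<le> real n" by linarith
        then show ?case by (auto simp: c_def)
      qed
    qed
    show "AE x in lborel. norm ((f x - c (real n) (f x))\<^sup>2) \<le> (f x)\<^sup>2" for n
      using cM(2)[of "real n"] by (intro AE_I2) (simp add: abs_le_square_iff)
  qed (use f2 in auto)
  \<comment> \<open>Two errors below e / 4 suffice, since the square of a sum of two terms costs a
    factor 2 on each square.\<close>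
  then have "\<forall>\<^sub>F n in sequentially. (\<integral>x. (f x - c (real n) (f x))\<^sup>2 \<partial>lborel) < e / 4"
    using \<open>e > 0\<close> by (intro order_tendstoD) auto
  then obtain n where n: "(\<integral>x. (f x - c (real n) (f x))\<^sup>2 \<partial>lborel) < e / 4"
    by (auto simp: eventually_sequentially)
  define M f1 where "M = real n" and "f1 = (\<lambda>x. c M (f x))"
  have "M \<ge> 0" by (simp add: M_def)
  have [measurable]: "f1 \<in> borel_measurable borel" unfolding f1_def by measurable
  have if1: "integrable lborel (\<lambda>x. (f x - f1 x)\<^sup>2)"
    using cM(2)[OF \<open>M \<ge> 0\<close>]
    by (intro Bochner_Integration.integrable_bound[OF f2]) (auto simp: f1_def abs_le_square_iff)
  have "f1 measurable_on UNIV"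
    by (intro lebesgue_measurable_imp_measurable_on) (auto simp: lebesgue_on_UNIV_eq intro: measurable_completion)
  then obtain N h where N: "negligible N" and h: "\<And>n. continuous_on UNIV (h n)"
    "\<And>x. x \<notin> N \<Longrightarrow> (\<lambda>n. h n x) \<longlonglongrightarrow> f1 x"
    unfolding measurable_on_def by auto
  \<comment> \<open>Clipping at M and the cutoff \<open>\<kappa>\<close> give the approximants a
    common bound and a common bounded support. They leave the limit \<open>f1\<close> unchanged,
    because \<open>f1\<close> is bounded by M and vanishes beyond radius R.\<close>
  define \<kappa> :: "real^'n \<Rightarrow> real" where "\<kappa> = (\<lambda>x. max 0 (min 1 (R + 1 - norm x)))"
  define g where "g = (\<lambda>n x. \<kappa> x * c M (h n x))"
  have \<kappa>: "0 \<le> \<kappa> x" "\<kappa> x \<le> 1" "norm x \<le> R \<Longrightarrow> \<kappa> x = 1" "norm x > R + 1 \<Longrightarrow> \<kappa> x = 0" for x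
    by (auto simp: \<kappa>_def)
  have gcont: "continuous_on UNIV (g n)" for n
    unfolding g_def \<kappa>_def
    by (intro continuous_intros continuous_on_compose2[OF ccont h(1)]) auto
  note [measurable] = borel_measurable_continuous_onI[OF gcont]
  have gM: "\<bar>g n x\<bar> \<le> M" for n x
    using \<kappa>(1,2)[of x] cM(1)[OF \<open>M \<ge> 0\<close>, of "h n x"] mult_mono[of "\<bar>\<kappa> x\<bar>" 1 "\<bar>c M (h n x)\<bar>" M]
    by (simp add: g_def abs_mult)
  have dom: "(f1 x - g n x)\<^sup>2 \<le> indicator (cball 0 (R + 1)) x * (2 * M)\<^sup>2" for n x
  proof (cases "norm x \<le> R + 1")
    case True
    have "\<bar>f1 x - g n x\<bar> \<le> 2 * M" using gM[of n x] cM(1)[OF \<open>M \<ge> 0\<close>, of "f x"] by (simp add: f1_def)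
    then show ?thesis using True \<open>M \<ge> 0\<close> abs_le_square_iff[of "f1 x - g n x" "2 * M"] by simp
  next
    case False
    then show ?thesis using \<kappa>(4)[of x] R[of x] \<open>M \<ge> 0\<close> by (simp add: f1_def g_def c_def)
  qed
  have idom: "integrable lborel (\<lambda>x::real^'n. indicator (cball 0 (R+1)) x * (2 * M)\<^sup>2)"
    by (intro integrable_mult_left integrable_real_indicator)
      (auto simp: emeasure_lborel_cball_finite[unfolded infinity_ennreal_def])
  have "(\<lambda>n. \<integral>x. (f1 x - g n x)\<^sup>2 \<partial>lborel) \<longlonglongrightarrow> (\<integral>x. 0 \<partial>(lborel::(real^'n) measure))"
  proof (rule integral_dominated_convergence[OF _ _ idom])
    have "AE x in lebesgue. x \<notin> N"
      using N by (simp add: negligible_iff_null_sets AE_not_in)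
    then have "AE x in lborel. x \<notin> N" by (simp add: AE_completion_iff)
    then show "AE x in lborel. (\<lambda>n. (f1 x - g n x)\<^sup>2) \<longlonglongrightarrow> 0"
    proof eventually_elim
      case (elim x)
      have "(\<lambda>n. c M (h n x)) \<longlonglongrightarrow> c M (f1 x)"
        using ccont h(2)[OF elim] by (intro isCont_tendsto_compose[of _ "c M"])
          (auto simp: continuous_on_eq_continuous_at)
      moreover have "c M (f1 x) = f1 x" using \<open>M \<ge> 0\<close> by (auto simp: f1_def c_def)
      moreover have "\<kappa> x * f1 x = f1 x"
        using \<kappa>(3)[of x] R[of x] \<open>M \<ge> 0\<close> by (cases "norm x \<le> R") (auto simp: f1_def c_def)
      ultimately have "(\<lambda>n. g n x) \<longlonglongrightarrow> f1 x"
        unfolding g_def using tendsto_mult[OF tendsto_const[of "\<kappa> x"]] by fastforce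
      from tendsto_power[OF tendsto_diff[OF tendsto_const[of "f1 x"] this], of 2] show ?case by simp
    qed
    show "AE x in lborel. norm ((f1 x - g n x)\<^sup>2) \<le> indicator (cball 0 (R+1)) x * (2 * M)\<^sup>2" for n
      using dom by (intro AE_I2) simp
  qed auto
  then have "\<forall>\<^sub>F n in sequentially. (\<integral>x. (f1 x - g n x)\<^sup>2 \<partial>lborel) < e / 4"
    using \<open>e > 0\<close> by (intro order_tendstoD) auto
  then obtain m where m: "(\<integral>x. (f1 x - g m x)\<^sup>2 \<partial>lborel) < e / 4"
    by (auto simp: eventually_sequentially)
  have ig: "integrable lborel (\<lambda>x. (f1 x - g m x)\<^sup>2)"
    using dom by (intro Bochner_Integration.integrable_bound[OF idom]) (auto intro: order_trans[OF _ abs_ge_self])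
  have sq: "(f x - g m x)\<^sup>2 \<le> 2 * (f x - f1 x)\<^sup>2 + 2 * (f1 x - g m x)\<^sup>2" for x
    using sum_squares_bound[of "f x - f1 x" "f1 x - g m x"]
    by (simp add: power2_eq_square algebra_simps)
  have isum: "integrable lborel (\<lambda>x. 2 * (f x - f1 x)\<^sup>2 + 2 * (f1 x - g m x)\<^sup>2)"
    using if1 ig by simp
  have i: "integrable lborel (\<lambda>x. (f x - g m x)\<^sup>2)"
    using sq by (intro Bochner_Integration.integrable_bound[OF isum]) auto
  have "(\<integral>x. (f x - g m x)\<^sup>2 \<partial>lborel) \<le> (\<integral>x. 2 * (f x - f1 x)\<^sup>2 + 2 * (f1 x - g m x)\<^sup>2 \<partial>lborel)"
    by (intro integral_mono i isum sq)
  also have "\<dots> < e" using n m if1 ig by (simp add: f1_def M_def)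
  finally show ?thesis
    using gcont i \<kappa>(4) by (intro exI[of _ "g m"]) (auto simp: g_def)
qed

text \<open>Density argument: mollification converges uniformly on a continuous compactly supported
  \<open>g\<close> that is close to \<open>f\<close>, and it contracts the error f - g in
  L2.\<close>

lemma conv_L2_tendsto:
  fixes f :: "real^'n \<Rightarrow> real"
  assumes [measurable]: "f \<in> borel_measurable borel" and f2: "integrable lborel (\<lambda>x. (f x)\<^sup>2)"
    and R: "\<And>x. norm x > R \<Longrightarrow> f x = 0"
    and \<eta>: "\<And>n::nat. mollifier (d n) (\<eta> n)" and d: "d \<longlonglongrightarrow> 0"
  shows "(\<lambda>n. \<integral>\<^sup>+x. ennreal ((conv (\<eta> n) f x - f x)\<^sup>2) \<partial>lborel) \<longlonglongrightarrow> 0"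
proof -
  have "\<forall>\<^sub>F n in sequentially. (\<integral>\<^sup>+x. ennreal ((conv (\<eta> n) f x - f x)\<^sup>2) \<partial>lborel) \<le> ennreal e"
    if "e > 0" for e
  proof -
    \<comment> \<open>The budget is e / 2 for \<open>g\<close> and 3 e / 12 for each of the two
      occurrences of f - g; the factor 3 comes from squaring a sum of three terms.\<close>
    obtain g where g: "continuous_on UNIV g" "\<And>x. norm x > R + 1 \<Longrightarrow> g x = 0"
      and ir: "integrable lborel (\<lambda>x. (f x - g x)\<^sup>2)" and r: "(\<integral>x. (f x - g x)\<^sup>2 \<partial>lborel) < e / 12"
      using L2_dense_continuous[OF assms(1,2) R, where e="e / 12"] \<open>e > 0\<close> by auto
    note [measurable] = borel_measurable_continuous_onI[OF g(1)]
    \<comment> \<open>\<open>g\<close> lives in radius R + 1, and kernels of size below 1 enlarge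
      the support by at most 1.\<close>
    define V where "V = measure lborel (cball (0::real^'n) (R + 2))"
    have V: "emeasure lborel (cball (0::real^'n) (R + 2)) = ennreal V" "V \<ge> 0"
      using emeasure_eq_ennreal_measure[of lborel "cball (0::real^'n) (R + 2)"]
        emeasure_lborel_cball_finite[of "0::real^'n" "R + 2"] by (auto simp: V_def)
    \<comment> \<open>Chosen so that 3 \<delta>^2 V is at most e / 2; the denominator V + 1 is
      positive for every V \<ge> 0.\<close>
    define \<delta> where "\<delta> = sqrt (e / (6 * (V + 1)))"
    have "\<delta> > 0" using \<open>e > 0\<close> V(2) by (simp add: \<delta>_def)
    then obtain t where t: "t > 0" "\<And>x y. dist x y < t \<Longrightarrow> \<bar>g x - g y\<bar> < \<delta>"
      using compact_support_uniformly_continuous[OF g] by blast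
    have ig: "integrable lborel g"
    proof -
      obtain M where M: "\<And>x. \<bar>g x\<bar> \<le> M" using compact_support_bounded[OF g] by blast
      show ?thesis by (rule bounded_support_integrable[OF _ g(2) M]) simp
    qed
    \<comment> \<open>On the ball, |t| \<le> 1 + t^2 turns square integrability into the
      integrability that the convolution of f - g requires.\<close>
    have irl: "integrable lborel (\<lambda>x. f x - g x)"
    proof (rule Bochner_Integration.integrable_bound)
      show "integrable lborel (\<lambda>x. indicator (cball 0 (R+1)) x * 1 + (f x - g x)\<^sup>2)"
        by (intro Bochner_Integration.integrable_add integrable_mult_left integrable_real_indicator ir)
          (auto simp: emeasure_lborel_cball_finite[unfolded infinity_ennreal_def])
      show "AE x in lborel. norm (f x - g x) \<le> norm (indicator (cball 0 (R+1)) x * 1 + (f x - g x)\<^sup>2)"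
      proof (rule AE_I2)
        fix x
        show "norm (f x - g x) \<le> norm (indicator (cball 0 (R+1)) x * 1 + (f x - g x)\<^sup>2)"
        proof (cases "norm x \<le> R + 1")
          case True
          have "2 * \<bar>f x - g x\<bar> * 1 \<le> \<bar>f x - g x\<bar>\<^sup>2 + 1\<^sup>2" by (rule sum_squares_bound)
          then have "2 * \<bar>f x - g x\<bar> \<le> (f x - g x)\<^sup>2 + 1" by simp
          moreover have "\<bar>f x - g x\<bar> \<le> 2 * \<bar>f x - g x\<bar>" by simp
          ultimately have "\<bar>f x - g x\<bar> \<le> 1 + (f x - g x)\<^sup>2" by (metis add.commute order_trans)
          then show ?thesis using True by simp
        next
          case False
          then show ?thesis using R[of x] g(2)[of x] by simp
        qed
      qed
    qed simp
    have "\<forall>\<^sub>F n in sequentially. d n < min t 1"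
      using d t(1) by (intro order_tendstoD) auto
    then show ?thesis
    proof eventually_elim
      case (elim n)
      note sc = \<eta>[of n, unfolded mollifier_def, THEN conjunct1]
      have [measurable]: "conv (\<eta> n) g \<in> borel_measurable borel" "conv (\<eta> n) (\<lambda>x. f x - g x) \<in> borel_measurable borel"
        using ig irl by (auto intro: smooth_imp_borel smooth_conv sc)
      have split: "conv (\<eta> n) f x = conv (\<eta> n) g x + conv (\<eta> n) (\<lambda>x. f x - g x) x" for x
        unfolding conv_def using conv_integrable[OF ig sc] conv_integrable[OF irl sc]
        by (simp flip: Bochner_Integration.integral_add add: algebra_simps)
      have sq: "(conv (\<eta> n) f x - f x)\<^sup>2 \<le> 3 * (conv (\<eta> n) g x - g x)\<^sup>2
          + (3 * (conv (\<eta> n) (\<lambda>x. f x - g x) x)\<^sup>2 + 3 * (f x - g x)\<^sup>2)" for x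
      proof -
        \<comment> \<open>The right side minus the left side is exactly (a - b)^2 + (a + c)^2 + (b +
          c)^2.\<close>
        have tri: "(a + b - c)\<^sup>2 \<le> 3 * a\<^sup>2 + (3 * b\<^sup>2 + 3 * c\<^sup>2)" for a b c :: real
        proof -
          have "0 \<le> (a - b)\<^sup>2 + (a + c)\<^sup>2 + (b + c)\<^sup>2" by simp
          then show ?thesis by (simp add: power2_eq_square algebra_simps)
        qed
        show ?thesis unfolding split
          using tri[of "conv (\<eta> n) g x - g x" "conv (\<eta> n) (\<lambda>x. f x - g x) x" "f x - g x"] by (simp add: algebra_simps)
      qed
      have b1: "(conv (\<eta> n) g x - g x)\<^sup>2 \<le> \<delta>\<^sup>2 * indicator (cball 0 (R + 2)) x" for x
      proof (cases "norm x \<le> R + 2")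
        case True
        have "\<bar>conv (\<eta> n) g x - g x\<bar> \<le> \<delta>"
          using elim t(2) by (intro conv_uniform[OF \<eta> ig]) (auto intro: less_imp_le)
        then show ?thesis using True \<open>\<delta> > 0\<close> abs_le_square_iff[of "conv (\<eta> n) g x - g x" \<delta>] by simp
      next
        case False
        then show ?thesis using conv_support[OF \<eta> g(2), where x=x] g(2)[of x] elim by auto
      qed
      have "(\<integral>\<^sup>+x. ennreal ((conv (\<eta> n) f x - f x)\<^sup>2) \<partial>lborel) \<le>
          (\<integral>\<^sup>+x. 3 * ennreal ((conv (\<eta> n) g x - g x)\<^sup>2)
          + (3 * ennreal ((conv (\<eta> n) (\<lambda>x. f x - g x) x)\<^sup>2) + 3 * ennreal ((f x - g x)\<^sup>2)) \<partial>lborel)"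
      proof (rule nn_integral_mono)
        fix x
        show "ennreal ((conv (\<eta> n) f x - f x)\<^sup>2) \<le> 3 * ennreal ((conv (\<eta> n) g x - g x)\<^sup>2)
          + (3 * ennreal ((conv (\<eta> n) (\<lambda>x. f x - g x) x)\<^sup>2) + 3 * ennreal ((f x - g x)\<^sup>2))"
          using ennreal_leI[OF sq[of x]] by (simp add: ennreal_plus ennreal_mult)
      qed
      also have "\<dots> = 3 * (\<integral>\<^sup>+x. ennreal ((conv (\<eta> n) g x - g x)\<^sup>2) \<partial>lborel)
          + (3 * (\<integral>\<^sup>+x. ennreal ((conv (\<eta> n) (\<lambda>x. f x - g x) x)\<^sup>2) \<partial>lborel)
          + 3 * (\<integral>\<^sup>+x. ennreal ((f x - g x)\<^sup>2) \<partial>lborel))"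
        by (simp add: nn_integral_add nn_integral_cmult)
      also have "\<dots> \<le> 3 * ennreal (\<delta>\<^sup>2 * V) + (3 * ennreal (e / 12) + 3 * ennreal (e / 12))"
      proof (intro add_mono mult_left_mono)
        have "(\<integral>\<^sup>+x. ennreal ((conv (\<eta> n) g x - g x)\<^sup>2) \<partial>lborel) \<le>
            (\<integral>\<^sup>+x. ennreal (\<delta>\<^sup>2) * indicator (cball (0::real^'n) (R + 2)) x \<partial>lborel)"
        proof (rule nn_integral_mono)
          fix x
          show "ennreal ((conv (\<eta> n) g x - g x)\<^sup>2) \<le> ennreal (\<delta>\<^sup>2) * indicator (cball 0 (R + 2)) x"
            using b1[of x] by (cases "norm x \<le> R + 2") (auto intro: ennreal_leI)
        qed
        also have "\<dots> = ennreal (\<delta>\<^sup>2 * V)" using V by (simp add: nn_integral_cmult_indicator ennreal_mult)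
        finally show "(\<integral>\<^sup>+x. ennreal ((conv (\<eta> n) g x - g x)\<^sup>2) \<partial>lborel) \<le> ennreal (\<delta>\<^sup>2 * V)" .
        show "(\<integral>\<^sup>+x. ennreal ((conv (\<eta> n) (\<lambda>x. f x - g x) x)\<^sup>2) \<partial>lborel) \<le> ennreal (e / 12)"
          using conv_L2_bound[OF \<eta> irl ir] r by (rule order_trans[OF _ ennreal_leI[OF less_imp_le]])
        show "(\<integral>\<^sup>+x. ennreal ((f x - g x)\<^sup>2) \<partial>lborel) \<le> ennreal (e / 12)"
          using r ir by (simp add: nn_integral_eq_integral_nonneg ennreal_leI)
      qed auto
      also have "\<dots> = ennreal (3 * (\<delta>\<^sup>2 * V) + (3 * (e / 12) + 3 * (e / 12)))"
      proof -
        have "3 * ennreal a = ennreal (3 * a)" if "a \<ge> 0" for a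
          using that by (simp add: ennreal_mult)
        moreover have "0 \<le> \<delta>\<^sup>2 * V" "0 \<le> e / 12" using \<open>e > 0\<close> V(2) by auto
        ultimately show ?thesis by (simp only: ennreal_plus[symmetric] mult_nonneg_nonneg zero_le_numeral add_nonneg_nonneg)
      qed
      also have "\<dots> \<le> ennreal e"
      proof (rule ennreal_leI)
        have "V / (V + 1) \<le> 1" using V(2) by simp
        then have "e / 2 * (V / (V + 1)) \<le> e / 2 * 1" using \<open>e > 0\<close> by (intro mult_left_mono) auto
        then show "3 * (\<delta>\<^sup>2 * V) + (3 * (e / 12) + 3 * (e / 12)) \<le> e"
        proof -
          have "\<delta>\<^sup>2 = e / (6 * (V + 1))" using \<open>e > 0\<close> V(2) by (simp add: \<delta>_def)
          moreover have "3 * (e / (6 * (V + 1)) * V) = e / 2 * (V / (V + 1))"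
            using V(2) by (simp add: divide_simps)
          ultimately have "3 * (\<delta>\<^sup>2 * V) = e / 2 * (V / (V + 1))" by (simp only:)
          then show ?thesis using \<open>e / 2 * (V / (V + 1)) \<le> e / 2 * 1\<close> by linarith
        qed
      qed
      finally show ?case .
    qed
  qed
  note ev = this
  show ?thesis
  proof (rule order_tendstoI)
    fix a :: ennreal assume "0 < a"
    then obtain b where b: "0 < b" "b < a" by (auto dest: dense)
    then obtain e where e: "b = ennreal e" "e > 0"
      by (cases b) (auto simp: ennreal_zero_less_top)
    show "\<forall>\<^sub>F n in sequentially. (\<integral>\<^sup>+x. ennreal ((conv (\<eta> n) f x - f x)\<^sup>2) \<partial>lborel) < a"
      using ev[OF e(2)] b(2) unfolding e(1) by (auto elim!: eventually_mono intro: le_less_trans)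
  qed simp
qed

subsection \<open>Square integrable functions on a domain\<close>

lemma borel_imp_lebesgue_on: "f \<in> borel_measurable borel \<Longrightarrow> f \<in> borel_measurable (lebesgue_on \<Omega>)"
  by (intro measurable_restrict_space1 measurable_completion) simp

lemma square_sum_le: "(a + b)\<^sup>2 \<le> 2 * a\<^sup>2 + 2 * b\<^sup>2" for a b :: real
  using sum_squares_bound[of a b] by (simp add: power2_sum)

lemma L2_measurable: "L2 \<Omega> f \<Longrightarrow> f \<in> borel_measurable (lebesgue_on \<Omega>)"
  by (simp add: L2_def)

lemma L2_AE_bound:
  assumes "L2 \<Omega> h" "f \<in> borel_measurable (lebesgue_on \<Omega>)" "AE x in lebesgue_on \<Omega>. \<bar>f x\<bar> \<le> \<bar>h x\<bar>"
  shows "L2 \<Omega> f"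
  unfolding L2_def
proof
  show "integrable (lebesgue_on \<Omega>) (\<lambda>x. (f x)\<^sup>2)"
  proof (rule Bochner_Integration.integrable_bound)
    show "integrable (lebesgue_on \<Omega>) (\<lambda>x. (h x)\<^sup>2)" using assms by (simp add: L2_def)
    show "AE x in lebesgue_on \<Omega>. norm ((f x)\<^sup>2) \<le> norm ((h x)\<^sup>2)"
      using assms(3) by eventually_elim (simp add: abs_le_square_iff)
  qed (use assms(2) in measurable)
qed fact

lemma L2_add:
  assumes "L2 \<Omega> f" "L2 \<Omega> g"
  shows "L2 \<Omega> (\<lambda>x. f x + g x)"
  unfolding L2_def
proof
  note [measurable] = assms[THEN L2_measurable]
  show "(\<lambda>x. f x + g x) \<in> borel_measurable (lebesgue_on \<Omega>)" by measurable
  show "integrable (lebesgue_on \<Omega>) (\<lambda>x. (f x + g x)\<^sup>2)"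
  proof (rule Bochner_Integration.integrable_bound)
    show "integrable (lebesgue_on \<Omega>) (\<lambda>x. 2 * (f x)\<^sup>2 + 2 * (g x)\<^sup>2)" using assms by (simp add: L2_def)
    show "AE x in lebesgue_on \<Omega>. norm ((f x + g x)\<^sup>2) \<le> norm (2 * (f x)\<^sup>2 + 2 * (g x)\<^sup>2)"
      using square_sum_le by (intro AE_I2) simp
  qed measurable
qed

lemma L2_cmult: "L2 \<Omega> f \<Longrightarrow> L2 \<Omega> (\<lambda>x. c * f x)"
  by (auto simp: L2_def power_mult_distrib)

lemma L2_diff: "L2 \<Omega> f \<Longrightarrow> L2 \<Omega> g \<Longrightarrow> L2 \<Omega> (\<lambda>x. f x - g x)"
  using L2_add[OF _ L2_cmult[of \<Omega> g "-1"], of f] by simp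

lemma L2_zero: "L2 \<Omega> (\<lambda>x. 0)"
  by (simp add: L2_def)

lemma L2_sum: "(\<And>i. i \<in> I \<Longrightarrow> L2 \<Omega> (f i)) \<Longrightarrow> L2 \<Omega> (\<lambda>x. \<Sum>i\<in>I. f i x)"
  by (induction I rule: infinite_finite_induct) (auto intro: L2_add L2_zero)

lemma L2_bounded_mult:
  assumes "L2 \<Omega> f" "b \<in> borel_measurable (lebesgue_on \<Omega>)" "AE x in lebesgue_on \<Omega>. \<bar>b x\<bar> \<le> B"
  shows "L2 \<Omega> (\<lambda>x. b x * f x)"
proof (rule L2_AE_bound[OF L2_cmult[OF assms(1), of B]])
  note [measurable] = assms(2) L2_measurable[OF assms(1)]
  show "(\<lambda>x. b x * f x) \<in> borel_measurable (lebesgue_on \<Omega>)" by measurable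
  show "AE x in lebesgue_on \<Omega>. \<bar>b x * f x\<bar> \<le> \<bar>B * f x\<bar>"
    using assms(3) by eventually_elim (auto simp: abs_mult intro: mult_right_mono)
qed

lemma L2_mult_integrable:
  assumes "L2 \<Omega> f" "L2 \<Omega> g"
  shows "integrable (lebesgue_on \<Omega>) (\<lambda>x. f x * g x)"
proof (rule Bochner_Integration.integrable_bound)
  show "integrable (lebesgue_on \<Omega>) (\<lambda>x. (f x)\<^sup>2 + (g x)\<^sup>2)" using assms by (simp add: L2_def)
  show "AE x in lebesgue_on \<Omega>. norm (f x * g x) \<le> norm ((f x)\<^sup>2 + (g x)\<^sup>2)"
  proof (rule AE_I2)
    fix x
    have "2 * \<bar>f x\<bar> * \<bar>g x\<bar> \<le> (f x)\<^sup>2 + (g x)\<^sup>2" using sum_squares_bound[of "\<bar>f x\<bar>" "\<bar>g x\<bar>"] by simp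
    moreover have "0 \<le> \<bar>f x\<bar> * \<bar>g x\<bar>" by simp
    ultimately have "\<bar>f x\<bar> * \<bar>g x\<bar> \<le> (f x)\<^sup>2 + (g x)\<^sup>2" by linarith
    then show "norm (f x * g x) \<le> norm ((f x)\<^sup>2 + (g x)\<^sup>2)" by (simp add: abs_mult)
  qed
  note [measurable] = assms[THEN L2_measurable]
  show "(\<lambda>x. f x * g x) \<in> borel_measurable (lebesgue_on \<Omega>)" by measurable
qed

text \<open>The integral of (s f + t g)^2 is a nonnegative quadratic form in s and t; two choices of
  the arguments give the inequality.\<close>

lemma L2_Cauchy_Schwarz:
  assumes f: "L2 \<Omega> f" and g: "L2 \<Omega> g"
  shows "\<bar>\<integral>x. f x * g x \<partial>lebesgue_on \<Omega>\<bar> \<le>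
    sqrt (\<integral>x. (f x)\<^sup>2 \<partial>lebesgue_on \<Omega>) * sqrt (\<integral>x. (g x)\<^sup>2 \<partial>lebesgue_on \<Omega>)"
proof -
  define F where "F = (\<integral>x. (f x)\<^sup>2 \<partial>lebesgue_on \<Omega>)"
  define H where "H = (\<integral>x. (g x)\<^sup>2 \<partial>lebesgue_on \<Omega>)"
  define I where "I = (\<integral>x. f x * g x \<partial>lebesgue_on \<Omega>)"
  have i: "integrable (lebesgue_on \<Omega>) (\<lambda>x. (f x)\<^sup>2)" "integrable (lebesgue_on \<Omega>) (\<lambda>x. (g x)\<^sup>2)"
    "integrable (lebesgue_on \<Omega>) (\<lambda>x. f x * g x)"
    using f g L2_mult_integrable[OF f g] by (auto simp: L2_def)
  have q: "0 \<le> s\<^sup>2 * F + 2 * s * t * I + t\<^sup>2 * H" for s t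
  proof -
    have "0 \<le> (\<integral>x. (s * f x + t * g x)\<^sup>2 \<partial>lebesgue_on \<Omega>)" by (intro integral_nonneg_AE AE_I2) simp
    also have "\<dots> = (\<integral>x. s\<^sup>2 * (f x)\<^sup>2 + 2 * s * t * (f x * g x) + t\<^sup>2 * (g x)\<^sup>2 \<partial>lebesgue_on \<Omega>)"
      by (simp add: power2_sum power_mult_distrib algebra_simps)
    also have "\<dots> = s\<^sup>2 * F + 2 * s * t * I + t\<^sup>2 * H" using i by (simp add: F_def H_def I_def)
    finally show ?thesis .
  qed
  have "F \<ge> 0" "H \<ge> 0" by (auto simp: F_def H_def intro!: integral_nonneg_AE)
  have "I\<^sup>2 \<le> F * H"
  proof (cases "H = 0")
    case True
    have "I = 0"
    proof (rule ccontr)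
      assume "I \<noteq> 0"
      \<comment> \<open>With H = 0 and s = 1 the form is affine in t, and this t brings it down to
        -1.\<close>
      have "0 \<le> F - 2 * ((F + 1) / (2 * I)) * I" using q[of 1 "- ((F + 1) / (2 * I))"] True by simp
      also have "\<dots> = -1" using \<open>I \<noteq> 0\<close> by (simp add: field_simps)
      finally show False by simp
    qed
    then show ?thesis using \<open>F \<ge> 0\<close> \<open>H \<ge> 0\<close> by simp
  next
    case False
    \<comment> \<open>For s = H and t = -I the form collapses to H (F H - I^2).\<close>
    have "0 \<le> H * (F * H - I\<^sup>2)" using q[of H "- I"] by (simp add: power2_eq_square algebra_simps)
    then show ?thesis using False \<open>H \<ge> 0\<close> by (simp add: zero_le_mult_iff)
  qed
  then have "\<bar>I\<bar> \<le> sqrt (F * H)" by (metis real_sqrt_abs real_sqrt_le_mono)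
  then show ?thesis by (simp add: F_def H_def I_def real_sqrt_mult)
qed

text \<open>Square integrability is part of the notion because the integral of a non-integrable
  square is 0, so the last clause alone would admit sequences that do not converge.\<close>

definition L2_lim :: "(real^'n::finite) set \<Rightarrow> (nat \<Rightarrow> real^'n \<Rightarrow> real) \<Rightarrow> (real^'n \<Rightarrow> real) \<Rightarrow> bool" where
  "L2_lim \<Omega> f g \<longleftrightarrow> (\<forall>n. L2 \<Omega> (f n)) \<and> L2 \<Omega> g \<and>
     (\<lambda>n. \<integral>x. (f n x - g x)\<^sup>2 \<partial>lebesgue_on \<Omega>) \<longlonglongrightarrow> 0"

lemma L2_limD: "L2_lim \<Omega> f g \<Longrightarrow> L2 \<Omega> (f n)" "L2_lim \<Omega> f g \<Longrightarrow> L2 \<Omega> g"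
  by (auto simp: L2_lim_def)

lemma L2_lim_subseq: "L2_lim \<Omega> f g \<Longrightarrow> strict_mono r \<Longrightarrow> L2_lim \<Omega> (\<lambda>n. f (r n)) g"
  unfolding L2_lim_def
  using LIMSEQ_subseq_LIMSEQ[of "\<lambda>n. \<integral>x. (f n x - g x)\<^sup>2 \<partial>lebesgue_on \<Omega>" 0 r] by (auto simp: o_def)

lemma L2_lim_const: "L2 \<Omega> f \<Longrightarrow> L2_lim \<Omega> (\<lambda>n. f) f"
  by (simp add: L2_lim_def)

lemma L2_lim_add:
  assumes "L2_lim \<Omega> f f'" "L2_lim \<Omega> g g'"
  shows "L2_lim \<Omega> (\<lambda>n x. f n x + g n x) (\<lambda>x. f' x + g' x)"
  unfolding L2_lim_def
proof (intro conjI allI)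
  show "L2 \<Omega> (\<lambda>x. f n x + g n x)" for n using assms by (auto simp: L2_lim_def intro: L2_add)
  show "L2 \<Omega> (\<lambda>x. f' x + g' x)" using assms by (auto simp: L2_lim_def intro: L2_add)
  show "(\<lambda>n. \<integral>x. (f n x + g n x - (f' x + g' x))\<^sup>2 \<partial>lebesgue_on \<Omega>) \<longlonglongrightarrow> 0"
  proof (rule tendsto_sandwich[OF _ _ tendsto_const])
    show "(\<lambda>n. 2 * (\<integral>x. (f n x - f' x)\<^sup>2 \<partial>lebesgue_on \<Omega>) + 2 * (\<integral>x. (g n x - g' x)\<^sup>2 \<partial>lebesgue_on \<Omega>)) \<longlonglongrightarrow> 0"
      using assms by (auto simp: L2_lim_def intro!: tendsto_eq_intros)
    show "\<forall>\<^sub>F n in sequentially. (\<integral>x. (f n x + g n x - (f' x + g' x))\<^sup>2 \<partial>lebesgue_on \<Omega>) \<le>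
        2 * (\<integral>x. (f n x - f' x)\<^sup>2 \<partial>lebesgue_on \<Omega>) + 2 * (\<integral>x. (g n x - g' x)\<^sup>2 \<partial>lebesgue_on \<Omega>)"
    proof (rule always_eventually, rule allI)
      fix n
      have d: "L2 \<Omega> (\<lambda>x. f n x - f' x)" "L2 \<Omega> (\<lambda>x. g n x - g' x)"
        using assms by (auto simp: L2_lim_def intro: L2_diff)
      have "(\<integral>x. (f n x + g n x - (f' x + g' x))\<^sup>2 \<partial>lebesgue_on \<Omega>) \<le>
        (\<integral>x. 2 * (f n x - f' x)\<^sup>2 + 2 * (g n x - g' x)\<^sup>2 \<partial>lebesgue_on \<Omega>)"
      proof (rule integral_mono)
        show "integrable (lebesgue_on \<Omega>) (\<lambda>x. (f n x + g n x - (f' x + g' x))\<^sup>2)"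
          using L2_add[OF d] by (simp add: L2_def algebra_simps)
        show "integrable (lebesgue_on \<Omega>) (\<lambda>x. 2 * (f n x - f' x)\<^sup>2 + 2 * (g n x - g' x)\<^sup>2)"
          using d by (simp add: L2_def)
        show "(f n x + g n x - (f' x + g' x))\<^sup>2 \<le> 2 * (f n x - f' x)\<^sup>2 + 2 * (g n x - g' x)\<^sup>2" for x
          using square_sum_le[of "f n x - f' x" "g n x - g' x"] by (simp add: algebra_simps)
      qed
      also have "\<dots> = 2 * (\<integral>x. (f n x - f' x)\<^sup>2 \<partial>lebesgue_on \<Omega>) + 2 * (\<integral>x. (g n x - g' x)\<^sup>2 \<partial>lebesgue_on \<Omega>)"
        using d by (simp add: L2_def)
      finally show "(\<integral>x. (f n x + g n x - (f' x + g' x))\<^sup>2 \<partial>lebesgue_on \<Omega>) \<le>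
        2 * (\<integral>x. (f n x - f' x)\<^sup>2 \<partial>lebesgue_on \<Omega>) + 2 * (\<integral>x. (g n x - g' x)\<^sup>2 \<partial>lebesgue_on \<Omega>)" .
    qed
  qed (auto intro!: always_eventually integral_nonneg_AE)
qed

lemma L2_lim_sum:
  assumes "\<And>i. i \<in> I \<Longrightarrow> L2_lim \<Omega> (f i) (g i)"
  shows "L2_lim \<Omega> (\<lambda>n x. \<Sum>i\<in>I. f i n x) (\<lambda>x. \<Sum>i\<in>I. g i x)"
  using assms
  by (induction I rule: infinite_finite_induct) (auto intro: L2_lim_add L2_lim_const L2_zero)

text \<open>Dominated convergence for the squares: the limit inherits the bound |h|, so (f n - g)^2
  stays below (2 h)^2.\<close>

lemma L2_lim_dominated:
  assumes h: "L2 \<Omega> h" and meas: "\<And>n. f n \<in> borel_measurable (lebesgue_on \<Omega>)" "g \<in> borel_measurable (lebesgue_on \<Omega>)"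
    and dom: "\<And>n. AE x in lebesgue_on \<Omega>. \<bar>f n x\<bar> \<le> \<bar>h x\<bar>"
    and lim: "AE x in lebesgue_on \<Omega>. (\<lambda>n. f n x) \<longlonglongrightarrow> g x"
  shows "L2_lim \<Omega> f g"
  unfolding L2_lim_def
proof (intro conjI allI)
  show "L2 \<Omega> (f n)" for n by (rule L2_AE_bound[OF h meas(1) dom])
  have "AE x in lebesgue_on \<Omega>. \<forall>n. \<bar>f n x\<bar> \<le> \<bar>h x\<bar>" using dom by (simp add: AE_all_countable)
  with lim have dom': "AE x in lebesgue_on \<Omega>. \<bar>g x\<bar> \<le> \<bar>h x\<bar>"
  proof eventually_elim
    case (elim x)
    from tendsto_rabs[OF elim(1)] show ?case by (rule LIMSEQ_le_const2) (use elim(2) in auto)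
  qed
  show "L2 \<Omega> g" by (rule L2_AE_bound[OF h meas(2) dom'])
  note [measurable] = meas
  have "(\<lambda>n. \<integral>x. (f n x - g x)\<^sup>2 \<partial>lebesgue_on \<Omega>) \<longlonglongrightarrow> (\<integral>x. 0 \<partial>lebesgue_on \<Omega>)"
  proof (rule integral_dominated_convergence)
    show "integrable (lebesgue_on \<Omega>) (\<lambda>x. 4 * (h x)\<^sup>2)" using h by (simp add: L2_def)
    show "AE x in lebesgue_on \<Omega>. (\<lambda>n. (f n x - g x)\<^sup>2) \<longlonglongrightarrow> 0"
      using lim
    proof eventually_elim
      case (elim x)
      from tendsto_power[OF tendsto_diff[OF elim tendsto_const[of "g x"]], of 2] show ?case by simp
    qed
    show "AE x in lebesgue_on \<Omega>. norm ((f n x - g x)\<^sup>2) \<le> 4 * (h x)\<^sup>2" for n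
      using dom[of n] dom'
    proof eventually_elim
      case (elim x)
      then have "\<bar>f n x - g x\<bar> \<le> \<bar>2 * h x\<bar>" by simp
      then have "(f n x - g x)\<^sup>2 \<le> (2 * h x)\<^sup>2" by (simp only: abs_le_square_iff)
      then show ?case by (simp add: power_mult_distrib)
    qed
  qed auto
  then show "(\<lambda>n. \<integral>x. (f n x - g x)\<^sup>2 \<partial>lebesgue_on \<Omega>) \<longlonglongrightarrow> 0" by simp
qed

text \<open>The product splits into b n (f n - g), small by the uniform bound B, and b n g, which
  converges by domination. Bounded a.e. convergence of \<open>b\<close> is what the derivative of a
  truncation provides along an a.e. convergent sequence.\<close>

lemma L2_lim_bounded_mult:
  assumes fg: "L2_lim \<Omega> f g"
    and meas: "\<And>n. b n \<in> borel_measurable (lebesgue_on \<Omega>)" "c \<in> borel_measurable (lebesgue_on \<Omega>)"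
    and bd: "\<And>n. AE x in lebesgue_on \<Omega>. \<bar>b n x\<bar> \<le> B"
    and lim: "AE x in lebesgue_on \<Omega>. (\<lambda>n. b n x) \<longlonglongrightarrow> c x"
  shows "L2_lim \<Omega> (\<lambda>n x. b n x * f n x) (\<lambda>x. c x * g x)"
proof -
  have d: "L2 \<Omega> (\<lambda>x. f n x - g x)" for n using fg by (auto simp: L2_lim_def intro: L2_diff)
  note dm = L2_bounded_mult[OF d meas(1) bd]
  have "L2_lim \<Omega> (\<lambda>n x. b n x * (f n x - g x)) (\<lambda>x. 0)"
    unfolding L2_lim_def
  proof (intro conjI allI dm L2_zero)
    show "(\<lambda>n. \<integral>x. (b n x * (f n x - g x) - 0)\<^sup>2 \<partial>lebesgue_on \<Omega>) \<longlonglongrightarrow> 0"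
    proof (rule tendsto_sandwich[OF _ _ tendsto_const])
      show "(\<lambda>n. B\<^sup>2 * (\<integral>x. (f n x - g x)\<^sup>2 \<partial>lebesgue_on \<Omega>)) \<longlonglongrightarrow> 0"
        using fg by (auto simp: L2_lim_def intro!: tendsto_eq_intros)
      show "\<forall>\<^sub>F n in sequentially. (\<integral>x. (b n x * (f n x - g x) - 0)\<^sup>2 \<partial>lebesgue_on \<Omega>)
          \<le> B\<^sup>2 * (\<integral>x. (f n x - g x)\<^sup>2 \<partial>lebesgue_on \<Omega>)"
      proof (rule always_eventually, rule allI)
        fix n
        have "(\<integral>x. (b n x * (f n x - g x) - 0)\<^sup>2 \<partial>lebesgue_on \<Omega>) \<le> (\<integral>x. B\<^sup>2 * (f n x - g x)\<^sup>2 \<partial>lebesgue_on \<Omega>)"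
        proof (rule integral_mono_AE)
          show "AE x in lebesgue_on \<Omega>. (b n x * (f n x - g x) - 0)\<^sup>2 \<le> B\<^sup>2 * (f n x - g x)\<^sup>2"
            using bd[of n]
          proof eventually_elim
            case (elim x)
            then have "\<bar>b n x\<bar> \<le> \<bar>B\<bar>" by linarith
            then have "(b n x)\<^sup>2 \<le> B\<^sup>2" by (simp only: abs_le_square_iff)
            then show ?case by (simp add: power_mult_distrib mult_right_mono)
          qed
        qed (use d[of n] dm[of n] in \<open>simp_all add: L2_def\<close>)
        then show "(\<integral>x. (b n x * (f n x - g x) - 0)\<^sup>2 \<partial>lebesgue_on \<Omega>)
          \<le> B\<^sup>2 * (\<integral>x. (f n x - g x)\<^sup>2 \<partial>lebesgue_on \<Omega>)" by simp
      qed
    qed (auto intro!: always_eventually integral_nonneg_AE)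
  qed
  moreover have "L2_lim \<Omega> (\<lambda>n x. b n x * g x) (\<lambda>x. c x * g x)"
  proof (rule L2_lim_dominated)
    note [measurable] = meas L2_measurable[OF L2_limD(2)[OF fg]]
    show "L2 \<Omega> (\<lambda>x. B * g x)" using fg by (intro L2_cmult) (simp add: L2_lim_def)
    show "(\<lambda>x. b n x * g x) \<in> borel_measurable (lebesgue_on \<Omega>)" for n by measurable
    show "(\<lambda>x. c x * g x) \<in> borel_measurable (lebesgue_on \<Omega>)" by measurable
    show "AE x in lebesgue_on \<Omega>. \<bar>b n x * g x\<bar> \<le> \<bar>B * g x\<bar>" for n
      using bd[of n] by eventually_elim (auto simp: abs_mult intro: mult_right_mono)
    show "AE x in lebesgue_on \<Omega>. (\<lambda>n. b n x * g x) \<longlonglongrightarrow> c x * g x"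
      using lim by eventually_elim (intro tendsto_intros)
  qed
  ultimately show ?thesis
    using L2_lim_add[of \<Omega> "\<lambda>n x. b n x * (f n x - g x)" "\<lambda>x. 0" "\<lambda>n x. b n x * g x" "\<lambda>x. c x * g x"]
    by (simp add: right_diff_distrib)
qed

lemma L2_lim_integral:
  assumes fg: "L2_lim \<Omega> f g" and h: "L2 \<Omega> h"
  shows "(\<lambda>n. \<integral>x. f n x * h x \<partial>lebesgue_on \<Omega>) \<longlonglongrightarrow> (\<integral>x. g x * h x \<partial>lebesgue_on \<Omega>)"
proof -
  let ?H = "sqrt (\<integral>x. (h x)\<^sup>2 \<partial>lebesgue_on \<Omega>)"
  have d: "L2 \<Omega> (\<lambda>x. f n x - g x)" for n using fg by (auto simp: L2_lim_def intro: L2_diff)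
  have "(\<lambda>n. \<integral>x. (f n x - g x) * h x \<partial>lebesgue_on \<Omega>) \<longlonglongrightarrow> 0"
  proof (rule Lim_null_comparison[OF always_eventually])
    show "\<forall>n. norm (\<integral>x. (f n x - g x) * h x \<partial>lebesgue_on \<Omega>) \<le> sqrt (\<integral>x. (f n x - g x)\<^sup>2 \<partial>lebesgue_on \<Omega>) * ?H"
      using L2_Cauchy_Schwarz[OF d h] by simp
    have "(\<lambda>n. sqrt (\<integral>x. (f n x - g x)\<^sup>2 \<partial>lebesgue_on \<Omega>)) \<longlonglongrightarrow> 0"
      using tendsto_real_sqrt[of "\<lambda>n. \<integral>x. (f n x - g x)\<^sup>2 \<partial>lebesgue_on \<Omega>" 0] fg by (simp add: L2_lim_def)
    then show "(\<lambda>n. sqrt (\<integral>x. (f n x - g x)\<^sup>2 \<partial>lebesgue_on \<Omega>) * ?H) \<longlonglongrightarrow> 0"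
      by (rule tendsto_mult_left_zero)
  qed
  moreover have "(\<integral>x. (f n x - g x) * h x \<partial>lebesgue_on \<Omega>) =
      (\<integral>x. f n x * h x \<partial>lebesgue_on \<Omega>) - (\<integral>x. g x * h x \<partial>lebesgue_on \<Omega>)" for n
    using L2_mult_integrable[OF L2_limD(1)[OF fg] h] L2_mult_integrable[OF L2_limD(2)[OF fg] h]
    by (simp add: left_diff_distrib)
  ultimately show ?thesis by (simp add: LIM_zero_iff)
qed

text \<open>The squares (f n - g)^2 tend to 0 in L1, and L1 convergence yields a.e. convergence
  along a subsequence.\<close>

lemma L2_lim_AE_subseq:
  assumes "L2_lim \<Omega> f g"
  shows "\<exists>r::nat\<Rightarrow>nat. strict_mono r \<and> (AE x in lebesgue_on \<Omega>. (\<lambda>n. f (r n) x) \<longlonglongrightarrow> g x)"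
proof -
  have d: "L2 \<Omega> (\<lambda>x. f n x - g x)" for n using assms by (auto simp: L2_lim_def intro: L2_diff)
  have "\<exists>r::nat\<Rightarrow>nat. strict_mono r \<and> (AE x in lebesgue_on \<Omega>. (\<lambda>n. (f (r n) x - g x)\<^sup>2) \<longlonglongrightarrow> 0)"
    by (rule tendsto_L1_AE_subseq) (use d assms in \<open>auto simp: L2_def L2_lim_def\<close>)
  then obtain r :: "nat \<Rightarrow> nat" where r: "strict_mono r"
    "AE x in lebesgue_on \<Omega>. (\<lambda>n. (f (r n) x - g x)\<^sup>2) \<longlonglongrightarrow> 0" by blast
  from r(2) have "AE x in lebesgue_on \<Omega>. (\<lambda>n. f (r n) x) \<longlonglongrightarrow> g x"
  proof eventually_elim
    case (elim x)
    from tendsto_real_sqrt[OF elim] have "(\<lambda>n. f (r n) x - g x) \<longlonglongrightarrow> 0"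
      by (simp add: tendsto_rabs_zero_iff)
    then show ?case by (rule LIM_zero_cancel)
  qed
  with r(1) show ?thesis by blast
qed

section \<open>From Lebesgue measure on the domain to Borel functions on the whole space\<close>

context
  fixes \<Omega> :: "(real^'n) set"
  assumes open_\<Omega>: "open \<Omega>"
begin

lemma sets_lebesgue_domain: "\<Omega> \<in> sets lebesgue"
  using open_\<Omega> by simp

lemma nn_integral_domain_le:
  assumes "f \<in> borel_measurable borel"
  shows "(\<integral>\<^sup>+x. f x \<partial>lebesgue_on \<Omega>) \<le> (\<integral>\<^sup>+x. f x \<partial>lborel)"
proof -
  have "(\<integral>\<^sup>+x. f x \<partial>lebesgue_on \<Omega>) = (\<integral>\<^sup>+x. f x * indicator \<Omega> x \<partial>lebesgue)"
    using sets_lebesgue_domain by (intro nn_integral_restrict_space) auto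
  also have "\<dots> \<le> (\<integral>\<^sup>+x. f x \<partial>lebesgue)" by (intro nn_integral_mono) (simp add: indicator_def)
  finally show ?thesis by (simp add: nn_integral_completion)
qed

lemma integral_domain_eq_lborel:
  fixes f :: "real^'n \<Rightarrow> real"
  assumes "f \<in> borel_measurable borel" "\<And>x. x \<notin> \<Omega> \<Longrightarrow> f x = 0"
  shows "(\<integral>x. f x \<partial>lebesgue_on \<Omega>) = (\<integral>x. f x \<partial>lborel)"
    and "integrable (lebesgue_on \<Omega>) f \<longleftrightarrow> integrable lborel f"
proof -
  have eq: "(\<lambda>x. indicator \<Omega> x *\<^sub>R f x) = f" using assms(2) by (auto simp: indicator_def fun_eq_iff)
  have s: "\<Omega> \<inter> space lebesgue \<in> sets lebesgue" using sets_lebesgue_domain by simp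
  show "(\<integral>x. f x \<partial>lebesgue_on \<Omega>) = (\<integral>x. f x \<partial>lborel)"
    using integral_restrict_space[OF s, of f] assms(1) unfolding eq by (simp add: integral_completion)
  show "integrable (lebesgue_on \<Omega>) f \<longleftrightarrow> integrable lborel f"
    using integrable_restrict_space[OF s, of f] assms(1) unfolding eq by (simp add: integrable_completion)
qed

text \<open>The convolution estimates concern Borel functions on the whole space, whereas members of
  L2 are Lebesgue measurable on the domain; a Borel representative extended by zero
  mediates.\<close>

lemma borel_version:
  fixes f :: "real^'n \<Rightarrow> real"
  assumes "f \<in> borel_measurable (lebesgue_on \<Omega>)"
  shows "\<exists>f'\<in>borel_measurable borel. (\<forall>x. x \<notin> \<Omega> \<longrightarrow> f' x = 0) \<and> (AE x in lebesgue_on \<Omega>. f' x = f x)"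
proof -
  have "(\<lambda>x. if x \<in> \<Omega> then f x else 0) \<in> borel_measurable lebesgue"
    using assms sets_lebesgue_domain by (simp add: borel_measurable_if)
  then obtain g where [measurable]: "g \<in> borel_measurable lborel"
    and g: "AE x in lborel. (if x \<in> \<Omega> then f x else 0) = g x"
    using completion_ex_borel_measurable_real by blast
  from g have "AE x in lebesgue. x \<in> \<Omega> \<longrightarrow> g x = f x"
    unfolding AE_completion_iff by eventually_elim auto
  then have "AE x in lebesgue_on \<Omega>. indicator \<Omega> x * g x = f x"
    using sets_lebesgue_domain by (subst AE_restrict_space_iff) (auto elim!: eventually_mono)
  moreover have "(\<lambda>x. indicator \<Omega> x * g x) \<in> borel_measurable borel"
    using open_\<Omega> by (intro borel_measurable_times borel_measurable_indicator) auto
  ultimately show ?thesis by (intro bexI[of _ "\<lambda>x. indicator \<Omega> x * g x"]) auto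
qed

end

subsection \<open>Weak gradients and density of smooth functions\<close>

lemma L2_cong: "(\<And>x. x \<in> \<Omega> \<Longrightarrow> f x = g x) \<Longrightarrow> L2 \<Omega> f \<longleftrightarrow> L2 \<Omega> g"
  unfolding L2_def
  by (intro conj_cong measurable_cong Bochner_Integration.integrable_cong) auto

lemma L2_lim_cong:
  assumes "\<And>n x. x \<in> \<Omega> \<Longrightarrow> f n x = f' n x" "\<And>x. x \<in> \<Omega> \<Longrightarrow> g x = g' x"
  shows "L2_lim \<Omega> f g \<longleftrightarrow> L2_lim \<Omega> f' g'"
proof -
  have "(\<integral>x. (f n x - g x)\<^sup>2 \<partial>lebesgue_on \<Omega>) = (\<integral>x. (f' n x - g' x)\<^sup>2 \<partial>lebesgue_on \<Omega>)" for n
    using assms by (intro Bochner_Integration.integral_cong) auto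
  moreover have "L2 \<Omega> (f n) \<longleftrightarrow> L2 \<Omega> (f' n)" "L2 \<Omega> g \<longleftrightarrow> L2 \<Omega> g'" for n
    using assms by (auto intro!: L2_cong)
  ultimately show ?thesis by (simp add: L2_lim_def)
qed

lemma partial_deriv_sum:
  fixes f :: "'i \<Rightarrow> real^'n \<Rightarrow> real"
  assumes "\<And>i. i \<in> I \<Longrightarrow> smooth (f i)"
  shows "partial_deriv j (\<lambda>x. \<Sum>i\<in>I. f i x) x = (\<Sum>i\<in>I. partial_deriv j (f i) x)"
  using assms
proof (induction I rule: infinite_finite_induct)
  case (insert i I)
  then show ?case
    using partial_deriv_add[of "f i" x "\<lambda>x. \<Sum>i\<in>I. f i x" j]
    by (simp add: smooth_differentiable smooth_sum)
qed (simp_all add: partial_deriv_const)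

lemma partial_deriv_reflect:
  fixes f :: "real^'n \<Rightarrow> real"
  assumes "f differentiable (at (x - y))"
  shows "partial_deriv i (\<lambda>y. f (x - y)) y = - partial_deriv i f (x - y)"
    and "(\<lambda>y. f (x - y)) differentiable (at y)"
proof -
  obtain f' where d: "(f has_derivative f') (at (x - y))" using assms by (auto simp: differentiable_def)
  interpret linear f' using d by (rule has_derivative_linear)
  have "((\<lambda>y. f (x - y)) has_derivative (\<lambda>h. f' (- h))) (at y)"
  proof (rule has_derivative_compose[of "\<lambda>y. x - y" "\<lambda>h. - h" y UNIV f f', OF _ d])
    show "((\<lambda>y. x - y) has_derivative (\<lambda>h. - h)) (at y)" by (auto intro!: derivative_eq_intros)
  qed
  from has_derivative_partial[OF this] has_derivative_partial[OF d] this
  show "partial_deriv i (\<lambda>y. f (x - y)) y = - partial_deriv i f (x - y)"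
    and "(\<lambda>y. f (x - y)) differentiable (at y)"
    by (auto simp: neg differentiable_def)
qed

lemma C_k_reflect: "C_k k f \<Longrightarrow> C_k k (\<lambda>y. f (x - y))"
proof (induction k arbitrary: f)
  case 0
  then have "continuous_on UNIV f" by simp
  moreover have "continuous_on UNIV (\<lambda>y. x - y)" by (intro continuous_intros)
  ultimately show ?case using continuous_on_compose2[of UNIV f UNIV "\<lambda>y. x - y"] by simp
next
  case (Suc k)
  have "continuous_on UNIV f" using Suc.prems by simp
  moreover have "continuous_on UNIV (\<lambda>y. x - y)" by (intro continuous_intros)
  ultimately have "continuous_on UNIV (\<lambda>y. f (x - y))"
    using continuous_on_compose2[of UNIV f UNIV "\<lambda>y. x - y"] by simp
  moreover have "partial_deriv i (\<lambda>y. f (x - y)) = (\<lambda>y. - partial_deriv i f (x - y))" for i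
    using Suc.prems by (simp add: fun_eq_iff partial_deriv_reflect)
  ultimately show ?case using Suc by (auto intro!: C_k_minus simp: partial_deriv_reflect)
qed

lemma smooth_reflect: "smooth f \<Longrightarrow> smooth (\<lambda>y. f (x - y))"
  by (simp add: smooth_def C_k_reflect)

text \<open>The complement of the support is open and \<open>\<phi>\<close> vanishes on it, so its
  derivatives vanish there too.\<close>

lemma test_fun_zero:
  assumes "test_fun \<Omega> \<phi>" "x \<notin> \<Omega>"
  shows "\<phi> x = 0" "partial_deriv i \<phi> x = 0"
proof -
  let ?S = "- closure {x. \<phi> x \<noteq> 0}"
  have x: "x \<in> ?S" using assms by (auto simp: test_fun_def)
  have S: "\<phi> y = 0" if "y \<in> ?S" for y using that closure_subset[of "{x. \<phi> x \<noteq> 0}"] by auto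
  show "\<phi> x = 0" using x S by blast
  show "partial_deriv i \<phi> x = 0"
    using partial_deriv_cong_open[of ?S x \<phi> "\<lambda>_. 0" i, OF _ x S]
    by (simp only: partial_deriv_const open_Compl closed_closure)
qed

lemma test_fun_smooth: "test_fun \<Omega> \<phi> \<Longrightarrow> smooth \<phi>"
  by (simp add: test_fun_def)

section \<open>Weak gradients, H1 limits and the dual on a bounded open set\<close>

context
  fixes \<Omega> :: "(real^'n) set"
  assumes open_\<Omega>: "open \<Omega>" and bounded_\<Omega>: "bounded \<Omega>"
begin

lemma smooth_bounded_on:
  assumes "smooth f"
  shows "\<exists>M. \<forall>x\<in>\<Omega>. \<bar>f x\<bar> \<le> M"
proof -
  have "compact (f ` closure \<Omega>)"
    using smooth_continuous[OF assms] bounded_\<Omega>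
    by (intro compact_continuous_image) (auto intro: continuous_on_subset)
  then obtain M where "\<forall>y\<in>f ` closure \<Omega>. norm y \<le> M"
    using compact_imp_bounded bounded_iff by blast
  then show ?thesis using closure_subset by (intro exI[of _ M]) auto
qed

lemma L2_const: "L2 \<Omega> (\<lambda>x. c)"
proof -
  interpret finite_measure "lebesgue_on \<Omega>"
    using open_\<Omega> bounded_\<Omega> by (intro finite_measure_lebesgue_on lmeasurable_open)
  show ?thesis by (simp add: L2_def)
qed

lemma L2_bounded:
  assumes "f \<in> borel_measurable (lebesgue_on \<Omega>)" "AE x in lebesgue_on \<Omega>. \<bar>f x\<bar> \<le> M"
  shows "L2 \<Omega> f"
  using L2_bounded_mult[OF L2_const[of 1] assms] by simp

lemma L2_smooth:
  assumes "smooth f"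
  shows "L2 \<Omega> f"
proof -
  obtain M where "\<forall>x\<in>\<Omega>. \<bar>f x\<bar> \<le> M" using smooth_bounded_on[OF assms] by blast
  then show ?thesis
    by (intro L2_bounded[where M=M] borel_imp_lebesgue_on smooth_imp_borel assms AE_I2) auto
qed

lemma L2_smooth_mult:
  assumes "smooth b" "L2 \<Omega> f"
  shows "L2 \<Omega> (\<lambda>x. b x * f x)"
proof -
  obtain M where "\<forall>x\<in>\<Omega>. \<bar>b x\<bar> \<le> M" using smooth_bounded_on[OF assms(1)] by blast
  then show ?thesis
    by (intro L2_bounded_mult[where B=M] assms borel_imp_lebesgue_on smooth_imp_borel AE_I2) auto
qed

text \<open>Integration by parts without boundary term: the product of \<open>v\<close> with a test
  function has compact support in the whole space, so its partial derivative integrates to 0, and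
  both halves of the product rule vanish off the domain.\<close>

lemma smooth_weak_grad:
  assumes v: "smooth v"
  shows "weak_grad \<Omega> v (grad v)"
  unfolding weak_grad_def
proof (intro conjI allI impI)
  show "L2 \<Omega> v" using v by (rule L2_smooth)
  show "L2 \<Omega> (\<lambda>x. grad v x $ i)" for i
    using L2_smooth[OF smooth_partial_deriv[OF v]] by (simp add: grad_def)
  fix \<phi> :: "real^'n \<Rightarrow> real" and i assume \<phi>: "test_fun \<Omega> \<phi>"
  note sc = test_fun_smooth_compact[OF \<phi>] and s\<phi> = test_fun_smooth[OF \<phi>]
  have sc1: "smooth_compact (\<lambda>x. v x * partial_deriv i \<phi> x)"
    by (intro smooth_compact_mult v smooth_compact_partial_deriv sc)
  have sc2: "smooth_compact (\<lambda>x. partial_deriv i v x * \<phi> x)"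
    by (intro smooth_compact_mult smooth_partial_deriv v sc)
  have "0 = (\<integral>x. partial_deriv i (\<lambda>x. v x * \<phi> x) x \<partial>lborel)"
    by (rule integral_partial_deriv_eq_0[symmetric]) (intro smooth_compact_mult v sc)
  also have "\<dots> = (\<integral>x. v x * partial_deriv i \<phi> x + partial_deriv i v x * \<phi> x \<partial>lborel)"
    using v s\<phi> by (simp add: partial_deriv_mult smooth_differentiable)
  also have "\<dots> = (\<integral>x. v x * partial_deriv i \<phi> x \<partial>lborel) + (\<integral>x. partial_deriv i v x * \<phi> x \<partial>lborel)"
    by (intro Bochner_Integration.integral_add smooth_compact_integrable sc1 sc2)
  also have "(\<integral>x. v x * partial_deriv i \<phi> x \<partial>lborel) = (\<integral>x. v x * partial_deriv i \<phi> x \<partial>lebesgue_on \<Omega>)"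
    using smooth_imp_borel[OF smooth_compact_smooth[OF sc1]] test_fun_zero[OF \<phi>]
    by (intro integral_domain_eq_lborel(1)[OF open_\<Omega>, symmetric]) auto
  also have "(\<integral>x. partial_deriv i v x * \<phi> x \<partial>lborel) = (\<integral>x. partial_deriv i v x * \<phi> x \<partial>lebesgue_on \<Omega>)"
    using smooth_imp_borel[OF smooth_compact_smooth[OF sc2]] test_fun_zero[OF \<phi>]
    by (intro integral_domain_eq_lborel(1)[OF open_\<Omega>, symmetric]) auto
  finally show "(\<integral>x. v x * partial_deriv i \<phi> x \<partial>lebesgue_on \<Omega>) = - (\<integral>x. grad v x $ i * \<phi> x \<partial>lebesgue_on \<Omega>)"
    by (simp add: grad_def)
qed

text \<open>Both sides of the defining identity are pairings with fixed L2 functions and hence pass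
  to the limit.\<close>

lemma weak_grad_lim:
  assumes wg: "\<And>n. weak_grad \<Omega> (v n) (H n)" and v: "L2_lim \<Omega> v w"
    and H: "\<And>i. L2_lim \<Omega> (\<lambda>n x. H n x $ i) (\<lambda>x. G x $ i)"
  shows "weak_grad \<Omega> w G"
  unfolding weak_grad_def
proof (intro conjI allI impI)
  show "L2 \<Omega> w" "L2 \<Omega> (\<lambda>x. G x $ i)" for i using v H by (auto simp: L2_lim_def)
  fix \<phi> :: "real^'n \<Rightarrow> real" and i assume \<phi>: "test_fun \<Omega> \<phi>"
  have "(\<lambda>n. \<integral>x. v n x * partial_deriv i \<phi> x \<partial>lebesgue_on \<Omega>) \<longlonglongrightarrow> (\<integral>x. w x * partial_deriv i \<phi> x \<partial>lebesgue_on \<Omega>)"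
    by (intro L2_lim_integral v L2_smooth smooth_partial_deriv test_fun_smooth[OF \<phi>])
  moreover have "(\<lambda>n. - (\<integral>x. H n x $ i * \<phi> x \<partial>lebesgue_on \<Omega>)) \<longlonglongrightarrow> - (\<integral>x. G x $ i * \<phi> x \<partial>lebesgue_on \<Omega>)"
    by (intro tendsto_minus L2_lim_integral H L2_smooth test_fun_smooth[OF \<phi>])
  moreover have "(\<integral>x. v n x * partial_deriv i \<phi> x \<partial>lebesgue_on \<Omega>) = - (\<integral>x. H n x $ i * \<phi> x \<partial>lebesgue_on \<Omega>)" for n
    using wg \<phi> by (simp add: weak_grad_def)
  ultimately show "(\<integral>x. w x * partial_deriv i \<phi> x \<partial>lebesgue_on \<Omega>) = - (\<integral>x. G x $ i * \<phi> x \<partial>lebesgue_on \<Omega>)"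
    using LIMSEQ_unique by simp
qed

lemma weak_grad_diff:
  assumes u: "weak_grad \<Omega> u G" and v: "weak_grad \<Omega> v H"
  shows "weak_grad \<Omega> (\<lambda>x. u x - v x) (\<lambda>x. G x - H x)"
  unfolding weak_grad_def
proof (intro conjI allI impI)
  have L: "L2 \<Omega> u" "L2 \<Omega> v" "L2 \<Omega> (\<lambda>x. G x $ i)" "L2 \<Omega> (\<lambda>x. H x $ i)" for i
    using u v by (auto simp: weak_grad_def)
  show "L2 \<Omega> (\<lambda>x. u x - v x)" "L2 \<Omega> (\<lambda>x. (G x - H x) $ i)" for i
    using L by (simp_all add: L2_diff)
  fix \<phi> :: "real^'n \<Rightarrow> real" and i assume \<phi>: "test_fun \<Omega> \<phi>"
  note s = L2_smooth[OF test_fun_smooth[OF \<phi>]] L2_smooth[OF smooth_partial_deriv[OF test_fun_smooth[OF \<phi>]]]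
  show "(\<integral>x. (u x - v x) * partial_deriv i \<phi> x \<partial>lebesgue_on \<Omega>) = - (\<integral>x. (G x - H x) $ i * \<phi> x \<partial>lebesgue_on \<Omega>)"
    using u v \<phi> L2_mult_integrable[OF L(1) s(2)] L2_mult_integrable[OF L(2) s(2)]
      L2_mult_integrable[OF L(3) s(1)] L2_mult_integrable[OF L(4) s(1)]
    by (simp add: left_diff_distrib weak_grad_def)
qed

text \<open>Obtained as (v - v) - v. The factor \<open>- 1\<close> stays visible to match the
  homogeneity clause of \<open>H1_dual\<close>.\<close>

lemma weak_grad_uminus:
  assumes v: "weak_grad \<Omega> v H"
  shows "weak_grad \<Omega> (\<lambda>x. - 1 * v x) (\<lambda>x. - H x)"
  using weak_grad_diff[OF weak_grad_diff[OF v v] v] by simp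

text \<open>The bound in \<open>H1_dual\<close> holds for every weak gradient, so it applies to v n
  - w together with H n - G, whose norms tend to 0.\<close>

lemma H1_dual_tendsto:
  assumes \<omega>: "H1_dual \<Omega> \<omega>" and wg: "\<And>n. weak_grad \<Omega> (v n) (H n)" "weak_grad \<Omega> w G"
    and v: "L2_lim \<Omega> v w" and H: "\<And>i. L2_lim \<Omega> (\<lambda>n x. H n x $ i) (\<lambda>x. G x $ i)"
  shows "(\<lambda>n. \<omega> (v n)) \<longlonglongrightarrow> \<omega> w"
proof -
  obtain C where C: "\<And>u G. weak_grad \<Omega> u G \<Longrightarrow> \<bar>\<omega> u\<bar> \<le> C * sqrt ((\<integral>x. (u x)\<^sup>2 \<partial>lebesgue_on \<Omega>)
                          + (\<integral>x. (norm (G x))\<^sup>2 \<partial>lebesgue_on \<Omega>))"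
    using \<omega> by (auto simp: H1_dual_def)
  have lin: "\<omega> (\<lambda>x. v n x - w x) = \<omega> (v n) - \<omega> w" for n
  proof -
    have "H1 \<Omega> (v n)" "H1 \<Omega> w" "H1 \<Omega> (\<lambda>x. - 1 * w x)"
      using wg(1)[of n] wg(2) weak_grad_uminus[OF wg(2)] unfolding H1_def by blast+
    then have "\<omega> (\<lambda>x. v n x + - 1 * w x) = \<omega> (v n) + \<omega> (\<lambda>x. - 1 * w x)" "\<omega> (\<lambda>x. - 1 * w x) = - 1 * \<omega> w"
      using \<omega> unfolding H1_dual_def by blast+
    then show ?thesis by simp
  qed
  have "(\<lambda>n. \<omega> (v n) - \<omega> w) \<longlonglongrightarrow> 0"
  proof (rule Lim_null_comparison[OF always_eventually])
    let ?b = "\<lambda>n. C * sqrt ((\<integral>x. (v n x - w x)\<^sup>2 \<partial>lebesgue_on \<Omega>)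
        + (\<Sum>i\<in>UNIV. \<integral>x. (H n x $ i - G x $ i)\<^sup>2 \<partial>lebesgue_on \<Omega>))"
    show "\<forall>n. norm (\<omega> (v n) - \<omega> w) \<le> ?b n"
    proof
      fix n
      have d: "L2 \<Omega> (\<lambda>x. H n x $ i - G x $ i)" for i
        using H[of i] by (auto simp: L2_lim_def intro: L2_diff)
      have "(\<integral>x. (norm (H n x - G x))\<^sup>2 \<partial>lebesgue_on \<Omega>) = (\<integral>x. (\<Sum>i\<in>UNIV. (H n x $ i - G x $ i)\<^sup>2) \<partial>lebesgue_on \<Omega>)"
        by (simp add: norm_vec_def L2_set_def sum_nonneg)
      also have "\<dots> = (\<Sum>i\<in>UNIV. \<integral>x. (H n x $ i - G x $ i)\<^sup>2 \<partial>lebesgue_on \<Omega>)"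
        using d by (intro Bochner_Integration.integral_sum) (simp add: L2_def)
      finally show "norm (\<omega> (v n) - \<omega> w) \<le> ?b n"
        using C[OF weak_grad_diff[OF wg(1)[of n] wg(2)]] by (simp add: lin)
    qed
    have "?b \<longlonglongrightarrow> C * sqrt (0 + (\<Sum>i\<in>(UNIV::'n set). 0))"
      using v H by (intro tendsto_intros) (auto simp: L2_lim_def)
    then show "?b \<longlonglongrightarrow> 0" by simp
  qed
  then show ?thesis by (rule LIM_zero_cancel)
qed

text \<open>On a bounded domain L2 is contained in L1; this supplies the integrability over the
  whole space that the convolution requires.\<close>

lemma L2_borel_version:
  assumes "L2 \<Omega> f"
  shows "\<exists>f'. f' \<in> borel_measurable borel \<and> (\<forall>x. x \<notin> \<Omega> \<longrightarrow> f' x = 0) \<and> (AE x in lebesgue_on \<Omega>. f' x = f x) \<and>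
    integrable lborel f' \<and> integrable lborel (\<lambda>x. (f' x)\<^sup>2)"
proof -
  obtain f' where f': "f' \<in> borel_measurable borel" "\<And>x. x \<notin> \<Omega> \<Longrightarrow> f' x = 0"
      "AE x in lebesgue_on \<Omega>. f' x = f x"
    using borel_version[OF open_\<Omega> L2_measurable[OF assms]] by blast
  have L: "L2 \<Omega> f'"
  proof (rule L2_AE_bound[OF assms borel_imp_lebesgue_on[OF f'(1)]])
    show "AE x in lebesgue_on \<Omega>. \<bar>f' x\<bar> \<le> \<bar>f x\<bar>" using f'(3) by eventually_elim simp
  qed
  have "integrable lborel f'"
    using L2_mult_integrable[OF L L2_const[of 1]] integral_domain_eq_lborel(2)[OF open_\<Omega> f'(1,2)] by simp
  moreover have "integrable lborel (\<lambda>x. (f' x)\<^sup>2)"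
  proof (rule integral_domain_eq_lborel(2)[OF open_\<Omega>, THEN iffD1])
    show "(\<lambda>x. (f' x)\<^sup>2) \<in> borel_measurable borel" using f'(1) by measurable
  qed (use L f' in \<open>auto simp: L2_def\<close>)
  ultimately show ?thesis using f' by blast
qed

text \<open>Brings a whole-space convolution into the form of an integral over the domain, where the
  weak gradient identity can be applied.\<close>

lemma conv_eq_domain:
  assumes f': "f' \<in> borel_measurable borel" "\<And>x. x \<notin> \<Omega> \<Longrightarrow> f' x = 0" "AE x in lebesgue_on \<Omega>. f' x = f x"
    and f: "f \<in> borel_measurable (lebesgue_on \<Omega>)" and \<eta>: "smooth \<eta>"
  shows "conv \<eta> f' x = (\<integral>y. \<eta> (x - y) * f y \<partial>lebesgue_on \<Omega>)"
proof -
  note [measurable] = f' smooth_imp_borel[OF smooth_reflect[OF \<eta>, of x]] f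
  have "conv \<eta> f' x = (\<integral>y. \<eta> (x - y) * f' y \<partial>lebesgue_on \<Omega>)"
    unfolding conv_def using f'(2)
    by (intro integral_domain_eq_lborel(1)[OF open_\<Omega>, symmetric]) auto
  also have "\<dots> = (\<integral>y. \<eta> (x - y) * f y \<partial>lebesgue_on \<Omega>)"
  proof (rule integral_cong_AE)
    show "AE y in lebesgue_on \<Omega>. \<eta> (x - y) * f' y = \<eta> (x - y) * f y"
      using f'(3) by eventually_elim simp
    show "(\<lambda>y. \<eta> (x - y) * f' y) \<in> borel_measurable (lebesgue_on \<Omega>)"
      by (intro borel_imp_lebesgue_on) measurable
    have "(\<lambda>y. \<eta> (x - y)) \<in> borel_measurable (lebesgue_on \<Omega>)"
      by (intro borel_imp_lebesgue_on) measurable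
    then show "(\<lambda>y. \<eta> (x - y) * f y) \<in> borel_measurable (lebesgue_on \<Omega>)"
      using f by (rule borel_measurable_times)
  qed
  finally show ?thesis .
qed

text \<open>Restricting the whole-space error to the domain can only lower it.\<close>

lemma conv_L2_lim:
  assumes f: "L2 \<Omega> f"
    and f': "f' \<in> borel_measurable borel" "\<And>x. x \<notin> \<Omega> \<Longrightarrow> f' x = 0" "AE x in lebesgue_on \<Omega>. f' x = f x"
      "integrable lborel f'" "integrable lborel (\<lambda>x. (f' x)\<^sup>2)"
    and \<eta>: "\<And>n::nat. mollifier (d n) (\<eta> n)" and d: "d \<longlonglongrightarrow> 0"
  shows "L2_lim \<Omega> (\<lambda>n. conv (\<eta> n) f') f"
  unfolding L2_lim_def
proof (intro conjI allI)
  have sc: "smooth_compact (\<eta> n)" for n using \<eta> by (simp add: mollifier_def)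
  have sm: "smooth (conv (\<eta> n) f')" for n by (rule smooth_conv[OF f'(4) sc])
  note [measurable] = f'(1) smooth_imp_borel[OF sm]
  show L: "L2 \<Omega> (conv (\<eta> n) f')" for n using sm by (rule L2_smooth)
  show "L2 \<Omega> f" by fact
  obtain R where R: "\<And>x. x \<in> \<Omega> \<Longrightarrow> norm x \<le> R" using bounded_\<Omega> by (auto simp: bounded_iff)
  have "(\<lambda>n. \<integral>\<^sup>+x. ennreal ((conv (\<eta> n) f' x - f' x)\<^sup>2) \<partial>lborel) \<longlonglongrightarrow> 0"
    by (rule conv_L2_tendsto[OF f'(1,5) _ \<eta> d, of R]) (use f'(2) R in \<open>auto simp: not_le[symmetric]\<close>)
  moreover have "ennreal (\<integral>x. (conv (\<eta> n) f' x - f x)\<^sup>2 \<partial>lebesgue_on \<Omega>)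
      \<le> (\<integral>\<^sup>+x. ennreal ((conv (\<eta> n) f' x - f' x)\<^sup>2) \<partial>lborel)" for n
  proof -
    have "ennreal (\<integral>x. (conv (\<eta> n) f' x - f x)\<^sup>2 \<partial>lebesgue_on \<Omega>) = (\<integral>\<^sup>+x. ennreal ((conv (\<eta> n) f' x - f x)\<^sup>2) \<partial>lebesgue_on \<Omega>)"
      using L2_diff[OF L f] by (intro nn_integral_eq_integral_nonneg[symmetric]) (auto simp: L2_def)
    also have "\<dots> = (\<integral>\<^sup>+x. ennreal ((conv (\<eta> n) f' x - f' x)\<^sup>2) \<partial>lebesgue_on \<Omega>)"
      by (rule nn_integral_cong_AE) (use f'(3) in \<open>eventually_elim, simp\<close>)
    also have "\<dots> \<le> (\<integral>\<^sup>+x. ennreal ((conv (\<eta> n) f' x - f' x)\<^sup>2) \<partial>lborel)"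
      by (rule nn_integral_domain_le[OF open_\<Omega>]) measurable
    finally show ?thesis .
  qed
  ultimately have "(\<lambda>n. ennreal (\<integral>x. (conv (\<eta> n) f' x - f x)\<^sup>2 \<partial>lebesgue_on \<Omega>)) \<longlonglongrightarrow> 0"
    by - (rule tendsto_sandwich[OF always_eventually always_eventually tendsto_const]; simp)
  then show "(\<lambda>n. \<integral>x. (conv (\<eta> n) f' x - f x)\<^sup>2 \<partial>lebesgue_on \<Omega>) \<longlonglongrightarrow> 0"
    by (subst (asm) ennreal_tendsto_0_iff) (auto intro: integral_nonneg_AE)
qed

end

text \<open>Near \<open>p\<close>, mollifying at a point of \<open>\<Omega>\<close> with these kernels only uses values inside \<open>\<Omega>\<close>.\<close>

definition inward_mollifiers :: "(real^'n::finite) set \<Rightarrow> real^'n \<Rightarrow> real \<Rightarrow> bool" where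
  "inward_mollifiers \<Omega> p r \<longleftrightarrow> r > 0 \<and> (\<exists>\<eta> d K. d \<longlonglongrightarrow> 0 \<and> (\<forall>n::nat. mollifier (d n) (\<eta> n) \<and>
     closed (K n) \<and> (\<forall>z. z \<notin> K n \<longrightarrow> \<eta> n z = 0) \<and>
     (\<forall>x\<in>\<Omega>. \<forall>z\<in>K n. x - z \<in> ball p r \<longrightarrow> x - z \<in> \<Omega>)))"

context
  fixes \<Omega> :: "(real^'n) set"
  assumes open_\<Omega>: "open \<Omega>" and bounded_\<Omega>: "bounded \<Omega>"
begin

text \<open>Extending \<zeta> w by zero may destroy weak differentiability across the boundary. For
  x in the domain, however, \<zeta> times the reflected kernel at x is a test function, so the weak
  gradient identity moves the derivative from the kernel onto \<open>w\<close> at such x.\<close>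

lemma localized_approximation:
  assumes wG: "weak_grad \<Omega> w G" and inw: "inward_mollifiers \<Omega> p r"
    and \<zeta>: "smooth \<zeta>" "\<And>x. \<zeta> x \<noteq> 0 \<Longrightarrow> x \<in> cball p \<rho>" "\<rho> < r"
  shows "\<exists>v. (\<forall>n::nat. smooth (v n)) \<and> L2_lim \<Omega> v (\<lambda>x. \<zeta> x * w x) \<and>
    (\<forall>j. L2_lim \<Omega> (\<lambda>n. partial_deriv j (v n)) (\<lambda>x. \<zeta> x * G x $ j + partial_deriv j \<zeta> x * w x))"
proof -
  obtain \<eta> d K where d: "d \<longlonglongrightarrow> 0" and \<eta>: "\<And>n::nat. mollifier (d n) (\<eta> n)"
    and K: "\<And>n. closed (K n)" "\<And>n z. z \<notin> K n \<Longrightarrow> \<eta> n z = 0"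
      "\<And>n x z. x \<in> \<Omega> \<Longrightarrow> z \<in> K n \<Longrightarrow> x - z \<in> ball p r \<Longrightarrow> x - z \<in> \<Omega>"
    using inw unfolding inward_mollifiers_def by blast
  have sc: "smooth_compact (\<eta> n)" for n using \<eta> by (simp add: mollifier_def)
  note L2s = L2_smooth[OF open_\<Omega> bounded_\<Omega>] and L2sm = L2_smooth_mult[OF open_\<Omega> bounded_\<Omega>]
  have Lw: "L2 \<Omega> w" and LG: "L2 \<Omega> (\<lambda>x. G x $ j)" for j using wG by (auto simp: weak_grad_def)
  have Lf: "L2 \<Omega> (\<lambda>x. \<zeta> x * w x)" by (intro L2sm \<zeta> Lw)
  have Lg: "L2 \<Omega> (\<lambda>x. \<zeta> x * G x $ j + partial_deriv j \<zeta> x * w x)" for j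
    by (intro L2_add L2sm \<zeta> Lw LG smooth_partial_deriv)
  obtain f where f: "f \<in> borel_measurable borel" "\<And>x. x \<notin> \<Omega> \<Longrightarrow> f x = 0"
      "AE x in lebesgue_on \<Omega>. f x = \<zeta> x * w x" "integrable lborel f" "integrable lborel (\<lambda>x. (f x)\<^sup>2)"
    using L2_borel_version[OF open_\<Omega> bounded_\<Omega> Lf] by blast
  have "L2_lim \<Omega> (\<lambda>n. partial_deriv j (conv (\<eta> n) f)) (\<lambda>x. \<zeta> x * G x $ j + partial_deriv j \<zeta> x * w x)" for j
  proof -
    obtain g where g: "g \<in> borel_measurable borel" "\<And>x. x \<notin> \<Omega> \<Longrightarrow> g x = 0"
        "AE x in lebesgue_on \<Omega>. g x = \<zeta> x * G x $ j + partial_deriv j \<zeta> x * w x"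
        "integrable lborel g" "integrable lborel (\<lambda>x. (g x)\<^sup>2)"
      using L2_borel_version[OF open_\<Omega> bounded_\<Omega> Lg] by blast
    have "partial_deriv j (conv (\<eta> n) f) x = conv (\<eta> n) g x" if x: "x \<in> \<Omega>" for n x
    proof -
      \<comment> \<open>The kernel puts the support into x - K n and the cutoff puts it into a
        closed ball of radius \<rho> < r, so the inward property at x places it inside the
        domain.\<close>
      define \<phi> where "\<phi> = (\<lambda>y. \<zeta> y * \<eta> n (x - y))"
      have sr: "smooth (\<lambda>y. \<eta> n (x - y))" by (intro smooth_reflect smooth_compact_smooth sc)
      have s\<phi>: "smooth \<phi>" unfolding \<phi>_def by (intro smooth_mult \<zeta> sr)
      have cl: "closure {y. \<phi> y \<noteq> 0} \<subseteq> cball p \<rho> \<inter> (\<lambda>y. x - y) -` K n"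
      proof (rule closure_minimal)
        show "{y. \<phi> y \<noteq> 0} \<subseteq> cball p \<rho> \<inter> (\<lambda>y. x - y) -` K n"
          using \<zeta>(2) K(2) by (auto simp: \<phi>_def)
        show "closed (cball p \<rho> \<inter> (\<lambda>y. x - y) -` K n)"
          by (intro closed_Int closed_cball closed_vimage K continuous_intros)
      qed
      have "compact (closure {y. \<phi> y \<noteq> 0})"
        using bounded_subset[OF bounded_cball, of "closure {y. \<phi> y \<noteq> 0}" p \<rho>] cl
        by (simp add: compact_eq_bounded_closed)
      moreover have "closure {y. \<phi> y \<noteq> 0} \<subseteq> \<Omega>"
      proof
        fix y assume "y \<in> closure {y. \<phi> y \<noteq> 0}"
        then have "y \<in> cball p \<rho>" "x - y \<in> K n" using cl by auto
        then show "y \<in> \<Omega>" using K(3)[OF x, of "x - y" n] \<open>\<rho> < r\<close> by auto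
      qed
      ultimately have \<phi>: "test_fun \<Omega> \<phi>" using s\<phi> by (simp add: test_fun_def)
      have d\<phi>: "partial_deriv j \<phi> y = \<zeta> y * - partial_deriv j (\<eta> n) (x - y) + partial_deriv j \<zeta> y * \<eta> n (x - y)" for y
        unfolding \<phi>_def using \<zeta>(1) sr smooth_compact_smooth[OF sc[of n]]
        by (simp add: partial_deriv_mult partial_deriv_reflect smooth_differentiable)
      have i1: "integrable (lebesgue_on \<Omega>) (\<lambda>y. \<eta> n (x - y) * (partial_deriv j \<zeta> y * w y))"
        by (intro L2_mult_integrable L2s L2sm smooth_partial_deriv \<zeta> sr Lw)
      have i2: "integrable (lebesgue_on \<Omega>) (\<lambda>y. w y * partial_deriv j \<phi> y)"
        by (intro L2_mult_integrable L2s smooth_partial_deriv s\<phi> Lw)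
      have i3: "integrable (lebesgue_on \<Omega>) (\<lambda>y. G y $ j * \<phi> y)"
        by (intro L2_mult_integrable L2s s\<phi> LG)
      have "partial_deriv j (conv (\<eta> n) f) x = (\<integral>y. partial_deriv j (\<eta> n) (x - y) * (\<zeta> y * w y) \<partial>lebesgue_on \<Omega>)"
        unfolding partial_deriv_conv[OF f(4) sc]
        by (rule conv_eq_domain[OF open_\<Omega> bounded_\<Omega> f(1-3) L2_measurable[OF Lf]])
          (auto intro: smooth_partial_deriv smooth_compact_smooth sc)
      \<comment> \<open>The product rule for \<open>\<phi>\<close> rearranged: as reflection flips
        the sign, \<zeta> times the derivative of the kernel is the term with the derivative of
        \<zeta> minus the derivative of \<phi>.\<close>
      also have "\<dots> = (\<integral>y. \<eta> n (x - y) * (partial_deriv j \<zeta> y * w y) - w y * partial_deriv j \<phi> y \<partial>lebesgue_on \<Omega>)"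
        by (rule Bochner_Integration.integral_cong) (auto simp: d\<phi> algebra_simps)
      also have "\<dots> = (\<integral>y. \<eta> n (x - y) * (partial_deriv j \<zeta> y * w y) \<partial>lebesgue_on \<Omega>) - (\<integral>y. w y * partial_deriv j \<phi> y \<partial>lebesgue_on \<Omega>)"
        by (rule Bochner_Integration.integral_diff[OF i1 i2])
      also have "\<dots> = (\<integral>y. \<eta> n (x - y) * (partial_deriv j \<zeta> y * w y) \<partial>lebesgue_on \<Omega>) + (\<integral>y. G y $ j * \<phi> y \<partial>lebesgue_on \<Omega>)"
        using wG \<phi> by (simp add: weak_grad_def)
      also have "\<dots> = (\<integral>y. \<eta> n (x - y) * (partial_deriv j \<zeta> y * w y) + G y $ j * \<phi> y \<partial>lebesgue_on \<Omega>)"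
        by (rule Bochner_Integration.integral_add[OF i1 i3, symmetric])
      also have "\<dots> = (\<integral>y. \<eta> n (x - y) * (\<zeta> y * G y $ j + partial_deriv j \<zeta> y * w y) \<partial>lebesgue_on \<Omega>)"
        by (rule Bochner_Integration.integral_cong) (auto simp: \<phi>_def algebra_simps)
      also have "\<dots> = conv (\<eta> n) g x"
        by (rule conv_eq_domain[OF open_\<Omega> bounded_\<Omega> g(1-3) L2_measurable[OF Lg], symmetric])
          (auto intro: smooth_compact_smooth sc)
      finally show ?thesis .
    qed
    then show ?thesis
      using conv_L2_lim[OF open_\<Omega> bounded_\<Omega> Lg g \<eta> d] by (subst L2_lim_cong) auto
  qed
  then show ?thesis
    by (intro exI[of _ "\<lambda>n. conv (\<eta> n) f"] conjI allI smooth_conv[OF f(4) sc]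
        conv_L2_lim[OF open_\<Omega> bounded_\<Omega> Lf f \<eta> d])
qed

text \<open>Bumps on a finite subcover, divided by their sum. The half radius leaves room between
  the closed support ball and radius \<open>r p\<close>, as the localization requires.\<close>

lemma smooth_partition_of_unity:
  assumes r: "\<forall>p\<in>closure \<Omega>. r p > 0"
  shows "\<exists>P \<zeta>. finite P \<and> P \<subseteq> closure \<Omega> \<and> (\<forall>p\<in>P. smooth (\<zeta> p) \<and> (\<forall>x. \<zeta> p x \<noteq> 0 \<longrightarrow> x \<in> cball p (r p / 2))) \<and>
    (\<forall>x\<in>closure \<Omega>. (\<Sum>p\<in>P. \<zeta> p x) = (1::real))"
proof (cases "\<Omega> = {}")
  case False
  have comp: "compact (closure \<Omega>)" using bounded_\<Omega> by simp
  obtain P where P: "P \<subseteq> closure \<Omega>" "finite P" "closure \<Omega> \<subseteq> (\<Union>p\<in>P. ball p (r p / 2))"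
    by (rule compactE_image[OF comp, of "closure \<Omega>" "\<lambda>p. ball p (r p / 2)"]) (use r in auto)
  define b where "b = (\<lambda>p x. flat 0 ((r p / 2)\<^sup>2 - (norm (x - p))\<^sup>2))"
  have sb: "smooth (b p)" for p unfolding b_def by (intro smooth_flat smooth_diff smooth_const smooth_norm2)
  have b0: "b p x \<ge> 0" for p x by (simp add: b_def flat_nonneg)
  have bpos: "b p x > 0 \<longleftrightarrow> norm (x - p) < r p / 2" if "p \<in> P" for p x
    using r[rule_format, of p] P(1) that abs_square_less_1[of "norm (x - p)"] power2_less_imp_less[of "norm (x - p)" "r p / 2"]
      power_strict_mono[of "norm (x - p)" "r p / 2" 2]
    by (auto simp: b_def flat_pos_iff)
  define B where "B = (\<lambda>x. \<Sum>p\<in>P. b p x)"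
  have sB: "smooth B" unfolding B_def by (intro smooth_sum sb)
  have B0: "B x \<ge> 0" for x unfolding B_def by (intro sum_nonneg b0)
  have Bpos: "B x > 0" if "x \<in> closure \<Omega>" for x
  proof -
    obtain p where p: "p \<in> P" "x \<in> ball p (r p / 2)" using P(3) \<open>x \<in> closure \<Omega>\<close> by blast
    then have "b p x > 0" using bpos by (simp add: dist_norm norm_minus_commute)
    then show ?thesis unfolding B_def using P(2) p(1) b0 by (intro sum_pos2[where i=p]) auto
  qed
  obtain x0 where x0: "x0 \<in> closure \<Omega>" "\<And>x. x \<in> closure \<Omega> \<Longrightarrow> B x0 \<le> B x"
    using continuous_attains_inf[OF comp, of B] False smooth_continuous[OF sB]
    by (auto intro: continuous_on_subset)
  \<comment> \<open>\<open>B\<close> may vanish away from the closure, so the denominator is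
    corrected. With m = B x0 > 0 the minimum of \<open>B\<close> on the closure, the added term is
    positive where B < m and zero where B \<ge> m; thus \<open>B'\<close> is positive everywhere and
    equals \<open>B\<close> on the closure.\<close>
  define B' where "B' = (\<lambda>x. B x + flat 0 (B x0 - B x))"
  have sB': "smooth B'" unfolding B'_def by (intro smooth_add smooth_flat smooth_diff smooth_const sB)
  have B': "B' x \<noteq> 0" for x
  proof -
    have "B x > 0 \<or> B x0 - B x > 0" using Bpos[OF x0(1)] by linarith
    then show ?thesis using B0[of x] flat_nonneg[of 0 "B x0 - B x"] flat_pos_iff[of 0 "B x0 - B x"]
      unfolding B'_def by linarith
  qed
  have BB: "B' x = B x" if "x \<in> closure \<Omega>" for x
    using x0(2)[OF that] by (simp add: B'_def flat_eq_0_iff)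
  let ?\<zeta> = "\<lambda>p x. b p x * inverse (B' x)"
  have "smooth (?\<zeta> p)" for p by (intro smooth_mult smooth_inverse sb sB' B')
  moreover have "x \<in> cball p (r p / 2)" if "p \<in> P" "?\<zeta> p x \<noteq> 0" for p x
    using bpos[OF that(1), of x] b0[of p x] that(2) by (simp add: dist_norm norm_minus_commute less_le)
  moreover have "(\<Sum>p\<in>P. ?\<zeta> p x) = 1" if "x \<in> closure \<Omega>" for x
    using Bpos[OF that] BB[OF that] by (simp add: sum_distrib_right[symmetric] B_def)
  ultimately show ?thesis using P(1,2) by (intro exI[of _ P] exI[of _ ?\<zeta>]) blast
qed (intro exI[of _ "{}"], simp)

lemma smooth_dense_H1:
  assumes inw: "\<And>p. p \<in> closure \<Omega> \<Longrightarrow> \<exists>r. inward_mollifiers \<Omega> p r" and wG: "weak_grad \<Omega> w G"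
  shows "\<exists>v. (\<forall>n::nat. smooth (v n)) \<and> L2_lim \<Omega> v w \<and>
    (\<forall>j. L2_lim \<Omega> (\<lambda>n. partial_deriv j (v n)) (\<lambda>x. G x $ j))"
proof -
  obtain r where r: "\<And>p. p \<in> closure \<Omega> \<Longrightarrow> inward_mollifiers \<Omega> p (r p)" using inw by metis
  have rpos: "\<forall>p\<in>closure \<Omega>. r p > 0" using r by (simp add: inward_mollifiers_def)
  from smooth_partition_of_unity[OF rpos] obtain P \<zeta> where P\<zeta>: "finite P \<and> P \<subseteq> closure \<Omega> \<and>
      (\<forall>p\<in>P. smooth (\<zeta> p) \<and> (\<forall>x. \<zeta> p x \<noteq> 0 \<longrightarrow> x \<in> cball p (r p / 2))) \<and>
      (\<forall>x\<in>closure \<Omega>. (\<Sum>p\<in>P. \<zeta> p x) = (1::real))"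
    by (elim exE)
  have P: "finite P" "P \<subseteq> closure \<Omega>" and \<zeta>: "\<And>p. p \<in> P \<Longrightarrow> smooth (\<zeta> p)"
      "\<And>p x. p \<in> P \<Longrightarrow> \<zeta> p x \<noteq> 0 \<Longrightarrow> x \<in> cball p (r p / 2)"
    and one: "\<And>x. x \<in> closure \<Omega> \<Longrightarrow> (\<Sum>p\<in>P. \<zeta> p x) = 1"
    using P\<zeta> by simp_all
  let ?Q = "\<lambda>p v. (\<forall>n::nat. smooth (v n)) \<and> L2_lim \<Omega> v (\<lambda>x. \<zeta> p x * w x) \<and>
    (\<forall>j. L2_lim \<Omega> (\<lambda>n. partial_deriv j (v n)) (\<lambda>x. \<zeta> p x * G x $ j + partial_deriv j (\<zeta> p) x * w x))"
  have "\<exists>v. ?Q p v" if "p \<in> P" for p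
    by (rule localized_approximation[OF wG r \<zeta>(1) \<zeta>(2)[OF that]]) (use P(2) that rpos in auto)
  then obtain v where Qv: "\<And>p. p \<in> P \<Longrightarrow> ?Q p (v p)"
    using bchoice[of P ?Q] by blast
  have v: "\<And>p n. p \<in> P \<Longrightarrow> smooth (v p n)"
      "\<And>p. p \<in> P \<Longrightarrow> L2_lim \<Omega> (v p) (\<lambda>x. \<zeta> p x * w x)"
      "\<And>p j. p \<in> P \<Longrightarrow> L2_lim \<Omega> (\<lambda>n. partial_deriv j (v p n)) (\<lambda>x. \<zeta> p x * G x $ j + partial_deriv j (\<zeta> p) x * w x)"
    using Qv by simp_all
  \<comment> \<open>Differentiating the constant sum 1 on the open domain cancels the terms with
    derivatives of \<zeta>, so the local limits add up to \<open>G\<close>.\<close>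
  have one': "(\<Sum>p\<in>P. \<zeta> p x) = 1" "(\<Sum>p\<in>P. partial_deriv j (\<zeta> p) x) = 0" if x: "x \<in> \<Omega>" for x j
  proof -
    show "(\<Sum>p\<in>P. \<zeta> p x) = 1" using one x closure_subset by blast
    have "(\<Sum>p\<in>P. partial_deriv j (\<zeta> p) x) = partial_deriv j (\<lambda>x. \<Sum>p\<in>P. \<zeta> p x) x"
      using \<zeta>(1) by (simp add: partial_deriv_sum)
    also have "\<dots> = partial_deriv j (\<lambda>x. 1) x"
      using one closure_subset by (intro partial_deriv_cong_open[OF open_\<Omega> x]) blast
    finally show "(\<Sum>p\<in>P. partial_deriv j (\<zeta> p) x) = 0" by (simp add: partial_deriv_const)
  qed
  let ?v = "\<lambda>n x. \<Sum>p\<in>P. v p n x"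
  have "L2_lim \<Omega> ?v (\<lambda>x. \<Sum>p\<in>P. \<zeta> p x * w x)"
    by (rule L2_lim_sum) (rule v(2))
  then have "L2_lim \<Omega> ?v w"
    by (rule L2_lim_cong[THEN iffD1, rotated 2]) (auto simp: sum_distrib_right[symmetric] one')
  moreover have "L2_lim \<Omega> (\<lambda>n. partial_deriv j (?v n)) (\<lambda>x. G x $ j)" for j
  proof -
    have "L2_lim \<Omega> (\<lambda>n x. \<Sum>p\<in>P. partial_deriv j (v p n) x)
        (\<lambda>x. \<Sum>p\<in>P. \<zeta> p x * G x $ j + partial_deriv j (\<zeta> p) x * w x)"
      by (rule L2_lim_sum) (rule v(3))
    then show ?thesis
      by (rule L2_lim_cong[THEN iffD1, rotated 2])
        (auto simp: sum.distrib sum_distrib_right[symmetric] one' partial_deriv_sum v(1))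
  qed
  ultimately show ?thesis
    by (intro exI[of _ ?v] conjI allI smooth_sum v(1))
qed

end

subsection \<open>Lipschitz domains\<close>

text \<open>A normalized bump on the ball of radius \<delta> s about s e. As \<delta> \<le> 1, this
  ball lies within distance 2 s of the origin, so the kernels shrink with s although they are not
  centred at 0.\<close>

lemma mollifier_exists:
  fixes e :: "real^'n"
  assumes "s > 0" "norm e = 1" "0 < \<delta>" "\<delta> \<le> 1"
  shows "\<exists>\<eta>. mollifier (2 * s) \<eta> \<and> (\<forall>z. z \<notin> cball (s *\<^sub>R e) (\<delta> * s) \<longrightarrow> \<eta> z = 0)"
proof -
  define b where "b = (\<lambda>z. flat 0 ((\<delta> * s)\<^sup>2 - (norm (z - s *\<^sub>R e))\<^sup>2))"
  have pos: "\<delta> * s > 0" using assms by simp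
  have sb: "smooth b" unfolding b_def by (intro smooth_flat smooth_diff smooth_const smooth_norm2)
  have bpos: "b z > 0 \<longleftrightarrow> norm (z - s *\<^sub>R e) < \<delta> * s" for z
  proof -
    have "(norm (z - s *\<^sub>R e))\<^sup>2 < (\<delta> * s)\<^sup>2 \<longleftrightarrow> norm (z - s *\<^sub>R e) < \<delta> * s"
    proof
      show "norm (z - s *\<^sub>R e) < \<delta> * s" if "(norm (z - s *\<^sub>R e))\<^sup>2 < (\<delta> * s)\<^sup>2"
        using that pos by (intro power2_less_imp_less[of "norm (z - s *\<^sub>R e)"]) auto
      show "(norm (z - s *\<^sub>R e))\<^sup>2 < (\<delta> * s)\<^sup>2" if "norm (z - s *\<^sub>R e) < \<delta> * s"
        using that by (intro power_strict_mono) auto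
    qed
    then show ?thesis by (simp add: b_def flat_pos_iff)
  qed
  have b0: "b z \<ge> 0" for z by (simp add: b_def flat_nonneg)
  have bz: "b z \<noteq> 0 \<longleftrightarrow> norm (z - s *\<^sub>R e) < \<delta> * s" for z
    using bpos[of z] b0[of z] by linarith
  have nrm: "norm z < 2 * s" if "norm (z - s *\<^sub>R e) < \<delta> * s" for z
  proof -
    have "norm z \<le> norm (z - s *\<^sub>R e) + norm (s *\<^sub>R e)" using norm_triangle_ineq[of "z - s *\<^sub>R e" "s *\<^sub>R e"] by simp
    moreover have "norm (s *\<^sub>R e) = s" using assms by simp
    moreover have "\<delta> * s \<le> 1 * s" using assms by (intro mult_right_mono) auto
    ultimately show ?thesis using that by linarith
  qed
  have scb: "smooth_compact b"
    unfolding smooth_compact_def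
  proof (intro conjI sb exI[of _ "2 * s"] allI impI)
    fix z :: "real^'n" assume "norm z > 2 * s"
    then have "\<not> norm (z - s *\<^sub>R e) < \<delta> * s" using nrm[of z] by linarith
    then show "b z = 0" using bz[of z] by blast
  qed
  define I where "I = (\<integral>z. b z \<partial>lborel)"
  have ib: "integrable lborel b" using scb by (rule smooth_compact_integrable)
  have "I \<ge> 0" unfolding I_def using b0 by (intro integral_nonneg_AE AE_I2)
  \<comment> \<open>The bump is positive on a ball of positive volume, so its integral cannot
    vanish.\<close>
  moreover have "I \<noteq> 0"
  proof
    assume "I = 0"
    then have "AE z in lborel. b z = 0"
      using integral_nonneg_eq_0_iff_AE[OF ib] b0 by (simp add: I_def)
    then have "AE z in lborel. z \<notin> ball (s *\<^sub>R e) (\<delta> * s)"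
    proof eventually_elim
      case (elim z)
      then have "\<not> norm (z - s *\<^sub>R e) < \<delta> * s" using bz[of z] by blast
      then show ?case by (simp add: dist_norm norm_minus_commute)
    qed
    then have "ball (s *\<^sub>R e) (\<delta> * s) \<in> null_sets lborel"
      by (subst AE_iff_null_sets) simp_all
    then have "ennreal (unit_ball_vol (real DIM(real^'n)) * (\<delta> * s) ^ DIM(real^'n)) = 0"
      using emeasure_ball[of "\<delta> * s" "s *\<^sub>R e"] pos by (simp only: null_setsD1 less_imp_le)
    moreover have "unit_ball_vol (real DIM(real^'n)) * (\<delta> * s) ^ DIM(real^'n) > 0"
      by (intro mult_pos_pos[OF unit_ball_vol_pos zero_less_power[OF pos]] of_nat_0_le_iff)
    ultimately show False unfolding ennreal_eq_0_iff by (rule leD[THEN notE])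
  qed
  ultimately have I: "I > 0" by simp
  have "mollifier (2 * s) (\<lambda>z. inverse I * b z)"
    unfolding mollifier_def
  proof (intro conjI allI impI)
    show "smooth_compact (\<lambda>z. inverse I * b z)" by (intro smooth_compact_mult smooth_const scb)
    show "(\<integral>z. inverse I * b z \<partial>lborel) = 1" using I by (simp add: I_def)
    show "0 \<le> inverse I * b z" for z using I b0[of z] by simp
    show "norm z < 2 * s" if "inverse I * b z \<noteq> 0" for z
      using that bz[of z] nrm[of z] by (metis mult_zero_right)
  qed
  moreover have "inverse I * b z = 0" if "z \<notin> cball (s *\<^sub>R e) (\<delta> * s)" for z
  proof -
    have "\<not> norm (z - s *\<^sub>R e) < \<delta> * s" using that by (simp add: dist_norm norm_minus_commute)
    then show ?thesis using bz[of z] by simp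
  qed
  ultimately show ?thesis by blast
qed

text \<open>The displaced balls are scaled copies of one another and sweep out a cone about e; the
  last hypothesis says that shifts by the negatives of its vectors do not leave the domain near
  \<open>p\<close>.\<close>

lemma inward_mollifiersI:
  fixes e :: "real^'n"
  assumes "r > 0" "norm e = 1" "0 < \<delta>" "\<delta> \<le> 1" "s0 > 0"
    and inw: "\<And>s x z. 0 < s \<Longrightarrow> s < s0 \<Longrightarrow> x \<in> \<Omega> \<Longrightarrow> z \<in> cball (s *\<^sub>R e) (\<delta> * s) \<Longrightarrow>
      x - z \<in> ball p r \<Longrightarrow> x - z \<in> \<Omega>"
  shows "inward_mollifiers \<Omega> p r"
proof -
  \<comment> \<open>With n + 2 in the denominator even the scale for n = 0 is strictly below
    s0.\<close>
  define s where "s = (\<lambda>n::nat. s0 / real (n + 2))"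
  have s: "0 < s n" "s n < s0" for n
    using \<open>s0 > 0\<close> divide_strict_left_mono[of 1 "real (n + 2)" s0] by (simp_all add: s_def)
  have "\<forall>n. \<exists>\<eta>. mollifier (2 * s n) \<eta> \<and> (\<forall>z. z \<notin> cball (s n *\<^sub>R e) (\<delta> * s n) \<longrightarrow> \<eta> z = 0)"
    using mollifier_exists[OF s(1) assms(2-4)] by blast
  from choice[OF this] obtain \<eta> where \<eta>: "\<And>n. mollifier (2 * s n) (\<eta> n)"
    "\<And>n z. z \<notin> cball (s n *\<^sub>R e) (\<delta> * s n) \<Longrightarrow> \<eta> n z = 0" by blast
  have "(\<lambda>n. 2 * (s0 * inverse (real (n + 2)))) \<longlonglongrightarrow> 2 * (s0 * 0)"
    by (intro tendsto_intros LIMSEQ_ignore_initial_segment[OF lim_inverse_n])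
  then have "(\<lambda>n. 2 * s n) \<longlonglongrightarrow> 0" by (simp add: s_def divide_inverse)
  moreover have "\<forall>n. mollifier (2 * s n) (\<eta> n) \<and> closed (cball (s n *\<^sub>R e) (\<delta> * s n)) \<and>
      (\<forall>z. z \<notin> cball (s n *\<^sub>R e) (\<delta> * s n) \<longrightarrow> \<eta> n z = 0) \<and>
      (\<forall>x\<in>\<Omega>. \<forall>z\<in>cball (s n *\<^sub>R e) (\<delta> * s n). x - z \<in> ball p r \<longrightarrow> x - z \<in> \<Omega>)"
    using \<eta> inw[OF s] by simp
  ultimately show ?thesis
    unfolding inward_mollifiers_def using \<open>r > 0\<close>
    by (intro conjI exI[of _ \<eta>] exI[of _ "\<lambda>n. 2 * s n"] exI[of _ "\<lambda>n. cball (s n *\<^sub>R e) (\<delta> * s n)"])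
qed

text \<open>Subtracting z, which is s e up to an error of norm \<delta> s, lowers the height by at
  least s - \<delta> s and changes the graph function by at most L \<delta> s. A point below the
  graph therefore stays below it when (L + 1) \<delta> < 1.\<close>

lemma lipschitz_domain_inward_mollifiers:
  fixes \<Omega> :: "(real^'n) set"
  assumes dom: "lipschitz_domain \<Omega>" and p: "p \<in> closure \<Omega>"
  shows "\<exists>r. inward_mollifiers \<Omega> p r"
proof (cases "p \<in> \<Omega>")
  case True
  have "open \<Omega>" using dom[unfolded lipschitz_domain_def] by (elim conjE)
  with True obtain r where r: "r > 0" "ball p r \<subseteq> \<Omega>"
    using openE by blast
  \<comment> \<open>The ball about an interior point already lies in the domain, so any unit vector
    serves as direction; \<open>axis undefined 1\<close> is one.\<close>
  have "inward_mollifiers \<Omega> p r"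
    by (rule inward_mollifiersI[of r "axis undefined 1" 1 1]) (use r in \<open>simp_all add: subsetD\<close>)
  then show ?thesis ..
next
  case False
  have "open \<Omega>" using dom[unfolded lipschitz_domain_def] by (elim conjE)
  then have "p \<in> frontier \<Omega>" using p False by (simp add: frontier_def interior_open)
  then obtain R Q k g L where R: "R > 0" and Q: "orthogonal_transformation (Q :: real^'n \<Rightarrow> real^'n)"
    and g: "\<And>y t. g (\<chi> j. if j = k then t else y $ j) = (g y :: real)"
    and L: "L-lipschitz_on UNIV g"
    and graph: "\<Omega> \<inter> ball p R = {x \<in> ball p R. Q (x - p) $ k < g (Q (x - p))}"
    using dom unfolding lipschitz_domain_def by meson
  have "L \<ge> 0" using L by (rule lipschitz_on_nonneg)
  interpret Q: linear Q using Q by (rule orthogonal_transformation_linear)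
  obtain e where e: "Q e = axis k 1"
    using orthogonal_transformation_surj[OF Q] by (metis surjD)
  have ne: "norm e = 1" using orthogonal_transformation_norm[OF Q, of e] by (simp add: e)
  \<comment> \<open>This makes (L + 1) \<delta> = 1 / 2, leaving a strict drop of s / 2; L + 1 keeps
    the denominator positive when L = 0.\<close>
  define \<delta> where "\<delta> = 1 / (2 * (L + 1))"
  have \<delta>: "0 < \<delta>" "\<delta> \<le> 1" "(L + 1) * \<delta> = 1 / 2" using \<open>L \<ge> 0\<close> by (auto simp: \<delta>_def field_simps)
  \<comment> \<open>Radius R / 2 and s < R / 4 give norm z \<le> 2 s < R / 2, so the unshifted point
    x also lies in the ball of radius R, where the graph describes the domain.\<close>
  have "inward_mollifiers \<Omega> p (R / 2)"
  proof (rule inward_mollifiersI[of "R / 2" e \<delta> "R / 4"])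
    fix s x z assume s: "0 < s" "s < R / 4" and x: "x \<in> \<Omega>" and z: "z \<in> cball (s *\<^sub>R e) (\<delta> * s)"
      and y: "x - z \<in> ball p (R / 2)"
    define q where "q = z - s *\<^sub>R e"
    have nq: "norm q \<le> \<delta> * s" using z by (simp add: q_def dist_norm norm_minus_commute)
    have "\<delta> * s \<le> 1 * s" using s(1) \<delta>(2) by (intro mult_right_mono) auto
    moreover have "norm z \<le> norm q + norm (s *\<^sub>R e)"
      using norm_triangle_ineq[of q "s *\<^sub>R e"] by (simp add: q_def)
    moreover have "norm (s *\<^sub>R e) = s" using s(1) ne by simp
    ultimately have "norm z \<le> 2 * s" using nq by linarith
    moreover have "norm (x - p) \<le> norm (x - z - p) + norm z"
      using norm_triangle_ineq[of "x - z - p" z] by simp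
    moreover have "norm (x - z - p) < R / 2"
      using y by (simp add: dist_norm norm_minus_commute)
    ultimately have "dist x p < R" unfolding dist_norm using s(2) by linarith
    then have "x \<in> \<Omega> \<inter> ball p R" using x by (simp add: dist_commute)
    then have gx: "Q (x - p) $ k < g (Q (x - p))" unfolding graph by simp
    define X where "X = Q (x - p)"
    define Y where "Y = Q (x - z - p)"
    have "X = Q (x - z - p + q + s *\<^sub>R e)" unfolding X_def by (simp add: q_def algebra_simps)
    also have "\<dots> = Y + Q q + s *\<^sub>R axis k 1" by (simp add: Q.add Q.scale e Y_def)
    finally have XY: "X = Y + Q q + s *\<^sub>R axis k 1" .
    have nQ: "norm (Q q) \<le> \<delta> * s" using nq orthogonal_transformation_norm[OF Q, of q] by simp
    text \<open>\<open>g\<close> ignores the \<open>k\<close>-th coordinate, so the shift by \<open>s *\<^sub>R axis k 1\<close> does not affect it.\<close>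
    have "g X = g (\<chi> j. if j = k then X $ k - s else X $ j)" by (rule g[symmetric])
    also have "(\<chi> j. if j = k then X $ k - s else X $ j) = Y + Q q"
      unfolding XY by (auto simp: vec_eq_iff axis_def)
    finally have "g X = g (Y + Q q)" .
    moreover have "\<bar>g (Y + Q q) - g Y\<bar> \<le> L * norm (Q q)"
      using lipschitz_onD[OF L, of "Y + Q q" Y] by (simp add: dist_norm)
    moreover have "L * norm (Q q) \<le> L * (\<delta> * s)" using nQ \<open>L \<ge> 0\<close> by (rule mult_left_mono)
    moreover have "Y $ k = X $ k - Q q $ k - s" unfolding XY by simp
    moreover have "\<bar>Q q $ k\<bar> \<le> \<delta> * s" using component_le_norm_cart[of "Q q" k] nQ by linarith
    moreover have "L * (\<delta> * s) + \<delta> * s = s / 2"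
    proof -
      have "L * (\<delta> * s) + \<delta> * s = ((L + 1) * \<delta>) * s" by (simp add: algebra_simps)
      then show ?thesis by (simp add: \<delta>(3))
    qed
    ultimately have "Y $ k < g Y" using gx s unfolding X_def[symmetric] by linarith
    then have "x - z \<in> \<Omega> \<inter> ball p R" unfolding graph using y R by (simp add: Y_def)
    then show "x - z \<in> \<Omega>" by simp
  qed (use R ne \<delta>(1,2) in auto)
  then show ?thesis ..
qed

section \<open>Compositions with Caratheodory functions\<close>

lemma borel_measurable_AE_domain:
  fixes f g :: "real^'n \<Rightarrow> real"
  assumes "open \<Omega>" and f: "f \<in> borel_measurable (lebesgue_on \<Omega>)" and ae: "AE x in lebesgue_on \<Omega>. f x = g x"
  shows "g \<in> borel_measurable (lebesgue_on \<Omega>)"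
proof -
  have S: "\<Omega> \<in> sets lebesgue" using assms(1) by simp
  have "(\<lambda>x. if x \<in> \<Omega> then f x else 0) \<in> borel_measurable lebesgue"
    using f S by (simp add: borel_measurable_if)
  moreover have "AE x in lebesgue. x \<in> \<Omega> \<longrightarrow> f x = g x"
    using ae S by (subst (asm) AE_restrict_space_iff) auto
  then have "AE x in lebesgue. (if x \<in> \<Omega> then f x else 0) = (if x \<in> \<Omega> then g x else 0)"
    by eventually_elim auto
  ultimately have "(\<lambda>x. if x \<in> \<Omega> then g x else 0) \<in> borel_measurable lebesgue"
    by (rule borel_measurable_AE)
  then show ?thesis using S by (simp add: borel_measurable_if)
qed

text \<open>Replacing \<open>u\<close> by functions with countably many values keeps the composition
  measurable; continuity in s recovers it as an a.e. limit, and completeness of Lebesgue measure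
  absorbs the exceptional set.\<close>

lemma Caratheodory_measurable:
  fixes F :: "real^'n \<Rightarrow> real \<Rightarrow> real"
  assumes "open \<Omega>" and F: "\<And>s. (\<lambda>x. F x s) \<in> borel_measurable (lebesgue_on \<Omega>)"
    and cont: "AE x in lebesgue_on \<Omega>. continuous_on UNIV (F x)"
    and u: "u \<in> borel_measurable (lebesgue_on \<Omega>)"
  shows "(\<lambda>x. F x (u x)) \<in> borel_measurable (lebesgue_on \<Omega>)"
proof -
  note [measurable] = u F
  \<comment> \<open>Rounding down to multiples of 1 / (n + 1) leaves countably many values and an
    error of at most 1 / (n + 1).\<close>
  define U where "U = (\<lambda>(n::nat) x. real_of_int \<lfloor>real (Suc n) * u x\<rfloor> / real (Suc n))"
  have U: "(\<lambda>n. U n x) \<longlonglongrightarrow> u x" for x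
  proof -
    have "\<bar>U n x - u x\<bar> \<le> 1 / real (Suc n)" for n
    proof -
      have "U n x - u x = (real_of_int \<lfloor>real (Suc n) * u x\<rfloor> - real (Suc n) * u x) / real (Suc n)"
        by (simp add: U_def field_simps)
      moreover have "\<bar>real_of_int \<lfloor>real (Suc n) * u x\<rfloor> - real (Suc n) * u x\<bar> \<le> 1" by linarith
      ultimately show ?thesis by (simp add: divide_right_mono del: of_nat_Suc)
    qed
    then have "\<forall>n. norm (U n x - u x) \<le> inverse (real (Suc n))"
      by (simp add: inverse_eq_divide del: of_nat_Suc)
    from Lim_null_comparison[OF always_eventually[OF this] LIMSEQ_inverse_real_of_nat]
    have "(\<lambda>n. U n x - u x) \<longlonglongrightarrow> 0" .
    then show ?thesis by (rule LIM_zero_cancel)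
  qed
  have "(\<lambda>x. F x (U n x)) \<in> borel_measurable (lebesgue_on \<Omega>)" for n
    unfolding U_def
    by (rule measurable_compose_countable[where f="\<lambda>i x. F x (real_of_int i / real (Suc n))"]) measurable
  \<comment> \<open>\<open>lim\<close> is total, so measurability can be stated before convergence,
    which holds only a.e.\<close>
  then have "(\<lambda>x. lim (\<lambda>n. F x (U n x))) \<in> borel_measurable (lebesgue_on \<Omega>)"
    by (rule borel_measurable_lim_metric)
  moreover have "AE x in lebesgue_on \<Omega>. lim (\<lambda>n. F x (U n x)) = F x (u x)"
    using cont
  proof eventually_elim
    case (elim x)
    then have "(\<lambda>n. F x (U n x)) \<longlonglongrightarrow> F x (u x)"
      using U by (intro isCont_tendsto_compose[of "u x" "F x"]) (auto simp: continuous_on_eq_continuous_at)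
    then show ?case by (rule limI)
  qed
  ultimately show ?thesis by (rule borel_measurable_AE_domain[OF assms(1)])
qed

subsection \<open>Truncated test functions\<close>

text \<open>The smoothness of this truncation only needs products and inverses of smooth functions, not
  the general composition with a smooth function.\<close>

definition trunc :: "real \<Rightarrow> real \<Rightarrow> real" where
  "trunc d t = t * inverse (1 + (d * t)\<^sup>2)"

definition trunc_deriv :: "real \<Rightarrow> real \<Rightarrow> real" where
  "trunc_deriv d t = (1 - (d * t)\<^sup>2) * (inverse (1 + (d * t)\<^sup>2))\<^sup>2"

lemma one_plus_square_pos: "1 + (t::real)\<^sup>2 > 0"
  using zero_le_power2[of t] by linarith

lemma one_plus_square_nz: "1 + (t::real)\<^sup>2 \<noteq> 0"
  using one_plus_square_pos[of t] by linarith

lemma inverse_one_plus_square: "0 \<le> inverse (1 + (t::real)\<^sup>2)" "inverse (1 + (t::real)\<^sup>2) \<le> 1"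
  using one_plus_square_pos[of t] by (simp_all add: inverse_le_1_iff)

lemma abs_trunc_le: "\<bar>trunc d t\<bar> \<le> \<bar>t\<bar>"
  using inverse_one_plus_square[of "d * t"] mult_left_le[of "inverse (1 + (d * t)\<^sup>2)" "\<bar>t\<bar>"]
  by (simp only: trunc_def abs_mult abs_of_nonneg abs_ge_zero)

text \<open>With a = |d t| the claim reduces to a \<le> 1 + a^2.\<close>

lemma abs_trunc_bounded:
  assumes "d > 0"
  shows "\<bar>trunc d t\<bar> \<le> 1 / d"
proof -
  have "a \<le> 1 + a\<^sup>2" if "a \<ge> 0" for a :: real
  proof -
    have "2 * a * 1 \<le> a\<^sup>2 + 1\<^sup>2" by (rule sum_squares_bound)
    then have "2 * a \<le> a\<^sup>2 + 1" by simp
    then show ?thesis using that by linarith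
  qed
  from this[of "\<bar>d * t\<bar>"] have "\<bar>d * t\<bar> \<le> 1 + (d * t)\<^sup>2" by simp
  then have "\<bar>d * t\<bar> / (1 + (d * t)\<^sup>2) \<le> 1" using one_plus_square_pos[of "d * t"] by (simp only: divide_le_eq_1_pos)
  moreover have "\<bar>d * t\<bar> / (1 + (d * t)\<^sup>2) = d * \<bar>trunc d t\<bar>"
    using \<open>d > 0\<close> one_plus_square_pos[of "d * t"] by (simp add: trunc_def abs_mult divide_inverse)
  ultimately have "d * \<bar>trunc d t\<bar> \<le> 1" by simp
  then show ?thesis using \<open>d > 0\<close> by (simp add: pos_le_divide_eq mult.commute)
qed

text \<open>With y = (d t)^2 this is |1 - y| \<le> 1 + y \<le> (1 + y)^2. The bound does not depend
  on d, so the gradients of all truncations are dominated by the gradient of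
  \<open>w\<close>.\<close>

lemma abs_trunc_deriv_le: "\<bar>trunc_deriv d t\<bar> \<le> 1"
proof -
  define y where "y = (d * t)\<^sup>2"
  have y: "y \<ge> 0" by (simp add: y_def)
  have "\<bar>1 - y\<bar> \<le> 1 + y" using y by linarith
  also have "1 + y \<le> (1 + y)\<^sup>2" using y by (simp add: power2_eq_square algebra_simps)
  finally have "\<bar>1 - y\<bar> / (1 + y)\<^sup>2 \<le> 1" using y by (simp add: divide_le_eq_1)
  moreover have "\<bar>trunc_deriv d t\<bar> = \<bar>1 - y\<bar> / (1 + y)\<^sup>2"
    by (simp add: trunc_deriv_def y_def[symmetric] abs_mult divide_inverse power_inverse)
  ultimately show ?thesis by simp
qed

lemma DERIV_trunc: "(trunc d has_real_derivative trunc_deriv d t) (at t)"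
proof -
  have "((\<lambda>t. inverse (1 + (d * t)\<^sup>2)) has_real_derivative
      - (inverse (1 + (d * t)\<^sup>2) * (2 * (d * t) * d) * inverse (1 + (d * t)\<^sup>2))) (at t)"
    by (rule DERIV_inverse') (auto intro!: derivative_eq_intros simp: one_plus_square_nz)
  from DERIV_mult[OF DERIV_ident this]
  have "((\<lambda>t. t * inverse (1 + (d * t)\<^sup>2)) has_real_derivative
      1 * inverse (1 + (d * t)\<^sup>2) + - (inverse (1 + (d * t)\<^sup>2) * (2 * (d * t) * d) * inverse (1 + (d * t)\<^sup>2)) * t) (at t)" .
  moreover have "1 * inverse (1 + (d * t)\<^sup>2) + - (inverse (1 + (d * t)\<^sup>2) * (2 * (d * t) * d) * inverse (1 + (d * t)\<^sup>2)) * t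
      = trunc_deriv d t"
  proof -
    define i where "i = inverse (1 + (d * t)\<^sup>2)"
    have "(1 + (d * t)\<^sup>2) * i = 1" unfolding i_def using one_plus_square_nz by (rule right_inverse)
    then have "i = ((1 + (d * t)\<^sup>2) * i) * i" by simp
    then have "1 * i + - (i * (2 * (d * t) * d) * i) * t = ((1 + (d * t)\<^sup>2) * i) * i - 2 * (d * t)\<^sup>2 * i\<^sup>2"
      by (simp add: power2_eq_square algebra_simps)
    also have "\<dots> = (1 - (d * t)\<^sup>2) * i\<^sup>2" by (simp add: power2_eq_square algebra_simps)
    finally show ?thesis by (simp add: trunc_deriv_def i_def)
  qed
  ultimately have "((\<lambda>t. t * inverse (1 + (d * t)\<^sup>2)) has_real_derivative trunc_deriv d t) (at t)"
    by (rule DERIV_cong)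
  then show ?thesis by (simp add: trunc_def[abs_def])
qed

lemma continuous_trunc: "continuous_on UNIV (trunc d)"
  by (intro continuous_at_imp_continuous_on ballI DERIV_isCont[OF DERIV_trunc])

lemma continuous_trunc_deriv: "continuous_on UNIV (trunc_deriv d)"
  unfolding trunc_deriv_def[abs_def] by (intro continuous_intros ballI one_plus_square_nz)

lemma measurable_trunc [measurable]:
  "trunc d \<in> borel_measurable borel" "trunc_deriv d \<in> borel_measurable borel"
  by (rule borel_measurable_continuous_onI, rule continuous_trunc)
    (rule borel_measurable_continuous_onI, rule continuous_trunc_deriv)

lemma smooth_trunc:
  assumes "smooth f"
  shows "smooth (\<lambda>x. trunc d (f x))"
  unfolding trunc_def power2_eq_square
  by (intro smooth_mult smooth_inverse smooth_add smooth_const assms)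
    (simp add: one_plus_square_nz flip: power2_eq_square)

lemma grad_trunc:
  assumes "smooth f"
  shows "grad (\<lambda>x. trunc d (f x)) x $ i = trunc_deriv d (f x) * partial_deriv i f x"
  using partial_deriv_chain(1)[OF smooth_differentiable[OF assms] DERIV_trunc] by (simp add: grad_def)

lemma tendsto_factor:
  assumes "d \<longlonglongrightarrow> 0"
  shows "(\<lambda>n. inverse (1 + (d n * t)\<^sup>2)) \<longlonglongrightarrow> (1::real)"
proof -
  have "(\<lambda>n. inverse (1 + (d n * t)\<^sup>2)) \<longlonglongrightarrow> inverse (1 + (0 * t)\<^sup>2)"
    by (intro tendsto_intros assms one_plus_square_nz)
  then show ?thesis by simp
qed

lemma tendsto_trunc:
  assumes "d \<longlonglongrightarrow> 0"
  shows "(\<lambda>n. trunc (d n) t) \<longlonglongrightarrow> t" and "(\<lambda>n. trunc_deriv (d n) t) \<longlonglongrightarrow> 1"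
proof -
  have "(\<lambda>n. trunc (d n) t) \<longlonglongrightarrow> t * 1"
    unfolding trunc_def by (intro tendsto_mult tendsto_const tendsto_factor assms)
  then show "(\<lambda>n. trunc (d n) t) \<longlonglongrightarrow> t" by simp
  have "(\<lambda>n. trunc_deriv (d n) t) \<longlonglongrightarrow> (1 - (0 * t)\<^sup>2) * 1\<^sup>2"
    unfolding trunc_deriv_def
    by (intro tendsto_mult tendsto_power tendsto_diff tendsto_const tendsto_factor assms)
  then show "(\<lambda>n. trunc_deriv (d n) t) \<longlonglongrightarrow> 1" by simp
qed

section \<open>The equation for truncations of \<open>w\<close> and its limit as d tends to
  0\<close>

context
  fixes \<Omega> :: "(real^'n) set" and P :: "'n \<Rightarrow> real^'n \<Rightarrow> real" and F :: "real^'n \<Rightarrow> real"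
    and \<omega> :: "(real^'n \<Rightarrow> real) \<Rightarrow> real" and w :: "real^'n \<Rightarrow> real" and G :: "real^'n \<Rightarrow> real^'n"
  assumes open_\<Omega>: "open \<Omega>" and bounded_\<Omega>: "bounded \<Omega>"
    and inw: "\<And>p. p \<in> closure \<Omega> \<Longrightarrow> \<exists>r. inward_mollifiers \<Omega> p r"
    and P: "\<And>i. L2 \<Omega> (P i)" and F: "integrable (lebesgue_on \<Omega>) F" and \<omega>: "H1_dual \<Omega> \<omega>"
    and eq: "\<And>v. smooth v \<Longrightarrow> (\<Sum>i\<in>UNIV. \<integral>x. grad v x $ i * P i x \<partial>lebesgue_on \<Omega>)
        + 1/2 * (\<integral>x. F x * v x \<partial>lebesgue_on \<Omega>) = \<omega> v"
    and wG: "weak_grad \<Omega> w G"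
begin

text \<open>For smooth v n tending to \<open>w\<close>, the functions trunc d (v n) are smooth,
  bounded by 1 / d and convergent in H1. This controls each term: \<open>P\<close> stands for the
  components of A(x,u) grad u and is in L2, \<open>F\<close> stands for the quadratic gradient term
  and is in L1.\<close>

lemma truncated_equation:
  assumes "d > 0"
  shows "weak_grad \<Omega> (\<lambda>x. trunc d (w x)) (\<lambda>x. trunc_deriv d (w x) *\<^sub>R G x)"
    and "(\<Sum>i\<in>UNIV. \<integral>x. (trunc_deriv d (w x) * G x $ i) * P i x \<partial>lebesgue_on \<Omega>)
        + 1/2 * (\<integral>x. F x * trunc d (w x) \<partial>lebesgue_on \<Omega>) = \<omega> (\<lambda>x. trunc d (w x))"
proof -
  obtain v0 where v0: "\<forall>n::nat. smooth (v0 n)" "L2_lim \<Omega> v0 w"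
      "\<forall>j. L2_lim \<Omega> (\<lambda>n. partial_deriv j (v0 n)) (\<lambda>x. G x $ j)"
    using smooth_dense_H1[OF open_\<Omega> bounded_\<Omega> inw wG] by auto
  \<comment> \<open>Pointwise a.e. convergence is required for the bounded factor
    \<open>trunc_deriv d (v n x)\<close> and for dominated convergence in the \<open>F\<close>
    term.\<close>
  obtain r :: "nat \<Rightarrow> nat" where r: "strict_mono r" "AE x in lebesgue_on \<Omega>. (\<lambda>n. v0 (r n) x) \<longlonglongrightarrow> w x"
    using L2_lim_AE_subseq[OF v0(2)] by blast
  define v where "v = (\<lambda>n. v0 (r n))"
  have v: "smooth (v n)" "L2_lim \<Omega> (\<lambda>n. partial_deriv j (v n)) (\<lambda>x. G x $ j)"
      "AE x in lebesgue_on \<Omega>. (\<lambda>n. v n x) \<longlonglongrightarrow> w x" for n j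
    using v0(1) L2_lim_subseq[OF v0(3)[rule_format] r(1)] r(2) by (simp_all add: v_def)
  have vm: "v n \<in> borel_measurable (lebesgue_on \<Omega>)" for n
    by (intro borel_imp_lebesgue_on smooth_imp_borel v)
  have wm: "w \<in> borel_measurable (lebesgue_on \<Omega>)"
    using wG by (simp add: weak_grad_def L2_measurable)
  note [measurable] = vm wm borel_measurable_integrable[OF F]
  have sT: "smooth (\<lambda>x. trunc d (v n x))" for n by (intro smooth_trunc v)
  note wgT = smooth_weak_grad[OF open_\<Omega> bounded_\<Omega> sT]
  have lim: "AE x in lebesgue_on \<Omega>. (\<lambda>n. trunc d (v n x)) \<longlonglongrightarrow> trunc d (w x)"
    using v(3)
  proof eventually_elim
    case (elim x)
    then show ?case using continuous_trunc[of d]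
      by (intro isCont_tendsto_compose[of _ "trunc d"]) (simp_all add: continuous_on_eq_continuous_at)
  qed
  have lim': "AE x in lebesgue_on \<Omega>. (\<lambda>n. trunc_deriv d (v n x)) \<longlonglongrightarrow> trunc_deriv d (w x)"
    using v(3)
  proof eventually_elim
    case (elim x)
    then show ?case using continuous_trunc_deriv[of d]
      by (intro isCont_tendsto_compose[of _ "trunc_deriv d"]) (simp_all add: continuous_on_eq_continuous_at)
  qed
  have bd: "\<bar>trunc d t\<bar> \<le> \<bar>1 / d\<bar>" for t using abs_trunc_bounded[OF \<open>d > 0\<close>, of t] by linarith
  have T: "L2_lim \<Omega> (\<lambda>n x. trunc d (v n x)) (\<lambda>x. trunc d (w x))"
  proof (rule L2_lim_dominated[OF L2_const[OF open_\<Omega> bounded_\<Omega>, of "1 / d"] _ _ _ lim])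
    show "AE x in lebesgue_on \<Omega>. \<bar>trunc d (v n x)\<bar> \<le> \<bar>1 / d\<bar>" for n by (rule AE_I2) (rule bd)
  qed measurable
  have "L2_lim \<Omega> (\<lambda>n x. trunc_deriv d (v n x) * partial_deriv i (v n) x) (\<lambda>x. trunc_deriv d (w x) * G x $ i)" for i
  proof (rule L2_lim_bounded_mult[where B=1, OF v(2) _ _ _ lim'])
    show "AE x in lebesgue_on \<Omega>. \<bar>trunc_deriv d (v n x)\<bar> \<le> 1" for n
      by (rule AE_I2) (rule abs_trunc_deriv_le)
  qed measurable
  then have D: "L2_lim \<Omega> (\<lambda>n x. grad (\<lambda>x. trunc d (v n x)) x $ i) (\<lambda>x. trunc_deriv d (w x) * G x $ i)" for i
    by (simp add: grad_trunc[OF v(1)])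
  show wg: "weak_grad \<Omega> (\<lambda>x. trunc d (w x)) (\<lambda>x. trunc_deriv d (w x) *\<^sub>R G x)"
    by (rule weak_grad_lim[OF open_\<Omega> bounded_\<Omega> wgT T]) (use D in simp)
  have "(\<lambda>n. \<omega> (\<lambda>x. trunc d (v n x))) \<longlonglongrightarrow> \<omega> (\<lambda>x. trunc d (w x))"
    by (rule H1_dual_tendsto[OF open_\<Omega> bounded_\<Omega> \<omega> wgT wg T]) (use D in simp)
  moreover have "(\<lambda>n. \<omega> (\<lambda>x. trunc d (v n x))) \<longlonglongrightarrow>
      (\<Sum>i\<in>UNIV. \<integral>x. (trunc_deriv d (w x) * G x $ i) * P i x \<partial>lebesgue_on \<Omega>)
        + 1/2 * (\<integral>x. F x * trunc d (w x) \<partial>lebesgue_on \<Omega>)"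
    unfolding eq[OF sT, symmetric]
  proof (intro tendsto_add tendsto_sum tendsto_mult tendsto_const)
    show "(\<lambda>n. \<integral>x. grad (\<lambda>x. trunc d (v n x)) x $ i * P i x \<partial>lebesgue_on \<Omega>)
        \<longlonglongrightarrow> (\<integral>x. (trunc_deriv d (w x) * G x $ i) * P i x \<partial>lebesgue_on \<Omega>)" for i
      by (rule L2_lim_integral[OF D P])
    \<comment> \<open>Boundedness of the truncation provides the dominating function |F| / d; H1
      convergence by itself would provide none.\<close>
    show "(\<lambda>n. \<integral>x. F x * trunc d (v n x) \<partial>lebesgue_on \<Omega>) \<longlonglongrightarrow> (\<integral>x. F x * trunc d (w x) \<partial>lebesgue_on \<Omega>)"
    proof (rule integral_dominated_convergence[where w="\<lambda>x. \<bar>F x\<bar> * (1 / d)"])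
      show "AE x in lebesgue_on \<Omega>. norm (F x * trunc d (v n x)) \<le> \<bar>F x\<bar> * (1 / d)" for n
        unfolding real_norm_def abs_mult
        by (intro AE_I2 mult_left_mono abs_trunc_bounded \<open>d > 0\<close>) simp
      show "AE x in lebesgue_on \<Omega>. (\<lambda>n. F x * trunc d (v n x)) \<longlonglongrightarrow> F x * trunc d (w x)"
        using lim by eventually_elim (rule tendsto_mult[OF tendsto_const])
      show "integrable (lebesgue_on \<Omega>) (\<lambda>x. \<bar>F x\<bar> * (1 / d))"
        using F by (intro integrable_mult_left integrable_abs)
    qed measurable
  qed
  ultimately show "(\<Sum>i\<in>UNIV. \<integral>x. (trunc_deriv d (w x) * G x $ i) * P i x \<partial>lebesgue_on \<Omega>)
        + 1/2 * (\<integral>x. F x * trunc d (w x) \<partial>lebesgue_on \<Omega>) = \<omega> (\<lambda>x. trunc d (w x))"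
    by (rule LIMSEQ_unique[rotated])
qed

text \<open>The equations for truncations determine the limit of the integrals of q \<theta> n, with
  q = F w, before q is known to be integrable. Adding the negative part, which converges by
  domination, leaves convergent integrals of the increasing functions max 0 q times \<theta>
  n.\<close>

lemma integrable_and_equation_if_negative_part_integrable:
  assumes neg: "integrable (lebesgue_on \<Omega>) (\<lambda>x. max 0 (- (F x * w x)))"
  shows "integrable (lebesgue_on \<Omega>) (\<lambda>x. F x * w x)"
    and "(\<Sum>i\<in>UNIV. \<integral>x. G x $ i * P i x \<partial>lebesgue_on \<Omega>)
        + 1/2 * (\<integral>x. F x * w x \<partial>lebesgue_on \<Omega>) = \<omega> w"
proof -
  define d where "d = (\<lambda>n. inverse (real (Suc n)))"
  have d: "d n > 0" for n by (simp add: d_def)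
  have d0: "d \<longlonglongrightarrow> 0" unfolding d_def by (rule LIMSEQ_inverse_real_of_nat)
  have Lw: "L2 \<Omega> w" and LG: "L2 \<Omega> (\<lambda>x. G x $ i)" for i using wG by (simp_all add: weak_grad_def)
  note [measurable] = L2_measurable[OF Lw] L2_measurable[OF LG] borel_measurable_integrable[OF F]
  have T: "L2_lim \<Omega> (\<lambda>n x. trunc (d n) (w x)) w"
  proof (rule L2_lim_dominated[OF Lw])
    show "AE x in lebesgue_on \<Omega>. \<bar>trunc (d n) (w x)\<bar> \<le> \<bar>w x\<bar>" for n by (rule AE_I2) (rule abs_trunc_le)
    show "AE x in lebesgue_on \<Omega>. (\<lambda>n. trunc (d n) (w x)) \<longlonglongrightarrow> w x"
      by (rule AE_I2) (rule tendsto_trunc(1)[OF d0])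
  qed measurable
  have D: "L2_lim \<Omega> (\<lambda>n x. trunc_deriv (d n) (w x) * G x $ i) (\<lambda>x. 1 * G x $ i)" for i
  proof (rule L2_lim_bounded_mult[OF L2_lim_const[OF LG], where B=1])
    show "AE x in lebesgue_on \<Omega>. \<bar>trunc_deriv (d n) (w x)\<bar> \<le> 1" for n
      by (rule AE_I2) (rule abs_trunc_deriv_le)
    show "AE x in lebesgue_on \<Omega>. (\<lambda>n. trunc_deriv (d n) (w x)) \<longlonglongrightarrow> 1"
      by (rule AE_I2) (rule tendsto_trunc(2)[OF d0])
  qed measurable
  \<comment> \<open>The value that the equation forces on the integral of F w, written down before
    that integral is known to be meaningful.\<close>
  define I where "I = 2 * (\<omega> w - (\<Sum>i\<in>UNIV. \<integral>x. G x $ i * P i x \<partial>lebesgue_on \<Omega>))"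
  have I: "(\<lambda>n. \<integral>x. F x * trunc (d n) (w x) \<partial>lebesgue_on \<Omega>) \<longlonglongrightarrow> I"
  proof -
    have "(\<lambda>n. \<omega> (\<lambda>x. trunc (d n) (w x))) \<longlonglongrightarrow> \<omega> w"
      by (rule H1_dual_tendsto[OF open_\<Omega> bounded_\<Omega> \<omega> truncated_equation(1)[OF d] wG T]) (use D in simp)
    moreover have "(\<lambda>n. \<Sum>i\<in>UNIV. \<integral>x. (trunc_deriv (d n) (w x) * G x $ i) * P i x \<partial>lebesgue_on \<Omega>)
        \<longlonglongrightarrow> (\<Sum>i\<in>UNIV. \<integral>x. G x $ i * P i x \<partial>lebesgue_on \<Omega>)"
      using L2_lim_integral[OF D P] by (intro tendsto_sum) simp
    ultimately have "(\<lambda>n. 2 * (\<omega> (\<lambda>x. trunc (d n) (w x))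
        - (\<Sum>i\<in>UNIV. \<integral>x. (trunc_deriv (d n) (w x) * G x $ i) * P i x \<partial>lebesgue_on \<Omega>))) \<longlonglongrightarrow> I"
      unfolding I_def by (intro tendsto_mult tendsto_diff tendsto_const)
    moreover have "2 * (\<omega> (\<lambda>x. trunc (d n) (w x))
        - (\<Sum>i\<in>UNIV. \<integral>x. (trunc_deriv (d n) (w x) * G x $ i) * P i x \<partial>lebesgue_on \<Omega>))
        = (\<integral>x. F x * trunc (d n) (w x) \<partial>lebesgue_on \<Omega>)" for n
    proof -
      have "2 * (c - a) = b" if "a + 1/2 * b = c" for a b c :: real using that by simp
      from this[OF truncated_equation(2)[OF d]] show ?thesis .
    qed
    ultimately show ?thesis by simp
  qed
  \<comment> \<open>The truncation is \<open>w\<close> times this factor. It takes values in [0, 1]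
    and increases to 1 with n whatever the sign of q, so the positive and negative parts can be
    treated separately.\<close>
  define \<theta> where "\<theta> = (\<lambda>n x. inverse (1 + (d n * w x)\<^sup>2))"
  have \<theta>: "0 \<le> \<theta> n x" "\<theta> n x \<le> 1" "(\<lambda>n. \<theta> n x) \<longlonglongrightarrow> 1" for n x
    unfolding \<theta>_def by (intro inverse_one_plus_square tendsto_factor d0)+
  have \<theta>_mono: "\<theta> m x \<le> \<theta> n x" if "m \<le> n" for m n x
  proof -
    have "d n \<le> d m" using that by (simp add: d_def le_imp_inverse_le)
    then have "\<bar>d n * w x\<bar> \<le> \<bar>d m * w x\<bar>"
      using d[of m] d[of n] by (simp add: abs_mult mult_right_mono)
    then have "(d n * w x)\<^sup>2 \<le> (d m * w x)\<^sup>2" by (simp only: abs_le_square_iff)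
    then show ?thesis unfolding \<theta>_def using one_plus_square_pos by (intro le_imp_inverse_le) auto
  qed
  have [measurable]: "\<theta> n \<in> borel_measurable (lebesgue_on \<Omega>)" for n unfolding \<theta>_def by measurable
  define q where "q = (\<lambda>x. F x * w x)"
  have q\<theta>: "F x * trunc (d n) (w x) = q x * \<theta> n x" for n x by (simp add: q_def trunc_def \<theta>_def)
  have [measurable]: "q \<in> borel_measurable (lebesgue_on \<Omega>)" unfolding q_def by measurable
  have neg: "integrable (lebesgue_on \<Omega>) (\<lambda>x. max 0 (- q x))" using assms by (simp add: q_def)
  have i\<theta>: "integrable (lebesgue_on \<Omega>) (\<lambda>x. q x * \<theta> n x)" for n
    unfolding q\<theta>[symmetric]
  proof (rule Bochner_Integration.integrable_bound)
    show "integrable (lebesgue_on \<Omega>) (\<lambda>x. F x * (1 / d n))" using F by simp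
    show "AE x in lebesgue_on \<Omega>. norm (F x * trunc (d n) (w x)) \<le> norm (F x * (1 / d n))"
    proof (rule AE_I2)
      fix x
      have "\<bar>F x\<bar> * \<bar>trunc (d n) (w x)\<bar> \<le> \<bar>F x\<bar> * \<bar>1 / d n\<bar>"
        using abs_trunc_bounded[OF d, of n "w x"] by (intro mult_left_mono) linarith+
      then show "norm (F x * trunc (d n) (w x)) \<le> norm (F x * (1 / d n))"
        by (simp only: real_norm_def abs_mult)
    qed
  qed measurable
  have n\<theta>: "norm (max 0 (- q x) * \<theta> n x) \<le> max 0 (- q x)" for n x
    using \<theta>(1,2)[of n x] mult_left_le[of "\<theta> n x" "max 0 (- q x)"] by simp
  have in\<theta>: "integrable (lebesgue_on \<Omega>) (\<lambda>x. max 0 (- q x) * \<theta> n x)" for n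
  proof (rule Bochner_Integration.integrable_bound[OF neg])
    show "AE x in lebesgue_on \<Omega>. norm (max 0 (- q x) * \<theta> n x) \<le> norm (max 0 (- q x))"
      using n\<theta> by (intro AE_I2) (metis abs_of_nonneg max.cobounded1 real_norm_def)
  qed measurable
  have neg_lim: "(\<lambda>n. \<integral>x. max 0 (- q x) * \<theta> n x \<partial>lebesgue_on \<Omega>) \<longlonglongrightarrow> (\<integral>x. max 0 (- q x) \<partial>lebesgue_on \<Omega>)"
  proof (rule integral_dominated_convergence[OF _ _ neg])
    show "AE x in lebesgue_on \<Omega>. (\<lambda>n. max 0 (- q x) * \<theta> n x) \<longlonglongrightarrow> max 0 (- q x)"
      using tendsto_mult[OF tendsto_const \<theta>(3)] by (intro AE_I2) fastforce
    show "AE x in lebesgue_on \<Omega>. norm (max 0 (- q x) * \<theta> n x) \<le> max 0 (- q x)" for n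
      using n\<theta> by (intro AE_I2)
  qed measurable
  have split: "max 0 (q x) * \<theta> n x = q x * \<theta> n x + max 0 (- q x) * \<theta> n x" for n x
    by (simp add: max_def algebra_simps)
  have ip: "integrable (lebesgue_on \<Omega>) (\<lambda>x. max 0 (q x))"
  proof (rule integrable_monotone_convergence[where f="\<lambda>n x. max 0 (q x) * \<theta> n x"])
    show "integrable (lebesgue_on \<Omega>) (\<lambda>x. max 0 (q x) * \<theta> n x)" for n
      unfolding split by (intro Bochner_Integration.integrable_add i\<theta> in\<theta>)
    show "AE x in lebesgue_on \<Omega>. mono (\<lambda>n. max 0 (q x) * \<theta> n x)"
      by (intro AE_I2 monoI mult_left_mono \<theta>_mono) auto
    show "AE x in lebesgue_on \<Omega>. (\<lambda>n. max 0 (q x) * \<theta> n x) \<longlonglongrightarrow> max 0 (q x)"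
      using tendsto_mult[OF tendsto_const \<theta>(3)] by (intro AE_I2) fastforce
    show "(\<lambda>n. \<integral>x. max 0 (q x) * \<theta> n x \<partial>lebesgue_on \<Omega>) \<longlonglongrightarrow> I + (\<integral>x. max 0 (- q x) \<partial>lebesgue_on \<Omega>)"
      unfolding split Bochner_Integration.integral_add[OF i\<theta> in\<theta>]
      using I neg_lim unfolding q\<theta> by (rule tendsto_add)
  qed measurable
  have "integrable (lebesgue_on \<Omega>) (\<lambda>x. max 0 (q x) - max 0 (- q x))"
    by (rule Bochner_Integration.integrable_diff[OF ip neg])
  moreover have "(\<lambda>x. max 0 (q x) - max 0 (- q x)) = q" by (auto simp: max_def fun_eq_iff)
  ultimately have iq: "integrable (lebesgue_on \<Omega>) q" by simp
  then show "integrable (lebesgue_on \<Omega>) (\<lambda>x. F x * w x)" by (simp add: q_def)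
  \<comment> \<open>Now that q is integrable, |q| dominates q \<theta> n, and uniqueness of limits
    identifies \<open>I\<close> with the integral of q.\<close>
  have "(\<lambda>n. \<integral>x. q x * \<theta> n x \<partial>lebesgue_on \<Omega>) \<longlonglongrightarrow> (\<integral>x. q x \<partial>lebesgue_on \<Omega>)"
  proof (rule integral_dominated_convergence[where w="\<lambda>x. \<bar>q x\<bar>"])
    show "AE x in lebesgue_on \<Omega>. (\<lambda>n. q x * \<theta> n x) \<longlonglongrightarrow> q x"
      using tendsto_mult[OF tendsto_const \<theta>(3)] by (intro AE_I2) fastforce
    show "AE x in lebesgue_on \<Omega>. norm (q x * \<theta> n x) \<le> \<bar>q x\<bar>" for n
    proof (rule AE_I2)
      fix x
      show "norm (q x * \<theta> n x) \<le> \<bar>q x\<bar>"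
        using \<theta>(1,2)[of n x] mult_left_le[of "\<theta> n x" "\<bar>q x\<bar>"] by (simp add: abs_mult)
    qed
    show "integrable (lebesgue_on \<Omega>) (\<lambda>x. \<bar>q x\<bar>)" using iq by (rule integrable_abs)
  qed measurable
  with I have "I = (\<integral>x. F x * w x \<partial>lebesgue_on \<Omega>)"
    unfolding q\<theta> by (simp only: q_def) (rule LIMSEQ_unique)
  moreover have "a + 1/2 * b = c" if "2 * (c - a) = b" for a b c :: real using that by simp
  ultimately show "(\<Sum>i\<in>UNIV. \<integral>x. G x $ i * P i x \<partial>lebesgue_on \<Omega>)
        + 1/2 * (\<integral>x. F x * w x \<partial>lebesgue_on \<Omega>) = \<omega> w"
    unfolding I_def by blast
qed

end

text \<open>Each matrix entry composed with \<open>u\<close> is measurable as a Caratheodory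
  composition and bounded by C, so every summand of the product is an L2 function times a bounded
  one.\<close>

lemma L2_matrix_vector_component:
  fixes B :: "real^'n \<Rightarrow> real \<Rightarrow> real^'n^'n"
  assumes "open \<Omega>" and B: "\<And>s i j. (\<lambda>x. B x s $ i $ j) \<in> borel_measurable (lebesgue_on \<Omega>)"
    and cont: "AE x in lebesgue_on \<Omega>. \<forall>i j. continuous_on UNIV (\<lambda>s. B x s $ i $ j)"
    and bd: "AE x in lebesgue_on \<Omega>. \<forall>s i j. \<bar>B x s $ i $ j\<bar> \<le> C"
    and u: "u \<in> borel_measurable (lebesgue_on \<Omega>)" and H: "\<And>j. L2 \<Omega> (\<lambda>x. H x $ j)"
  shows "L2 \<Omega> (\<lambda>x. (B x (u x) *v H x) $ i)"
proof -
  have "L2 \<Omega> (\<lambda>x. B x (u x) $ i $ j * H x $ j)" for j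
  proof (rule L2_bounded_mult[OF H, where B=C])
    show "(\<lambda>x. B x (u x) $ i $ j) \<in> borel_measurable (lebesgue_on \<Omega>)"
      by (rule Caratheodory_measurable[where F="\<lambda>x s. B x s $ i $ j", OF assms(1) B _ u])
        (use cont in \<open>eventually_elim, blast\<close>)
    show "AE x in lebesgue_on \<Omega>. \<bar>B x (u x) $ i $ j\<bar> \<le> C" using bd by eventually_elim blast
  qed
  then show ?thesis
    by (simp only: matrix_vector_mult_def vec_lambda_beta) (intro L2_sum)
qed

theorem theorem3p1:
  fixes \<Omega> :: "(real^'n) set"
    and A DA :: "real^'n \<Rightarrow> real \<Rightarrow> real^'n^'n"
    and C \<nu> :: real
    and u w :: "real^'n \<Rightarrow> real"
    and Du Dw :: "real^'n \<Rightarrow> real^'n"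
    and \<omega> :: "(real^'n \<Rightarrow> real) \<Rightarrow> real"
  assumes N: "CARD('n) \<ge> 2"
    and dom: "lipschitz_domain \<Omega>"
    and coeff: "coeff_assms \<Omega> A DA C \<nu>"
    and u: "weak_grad \<Omega> u Du"
    and om: "H1_dual \<Omega> \<omega>"
    and eq: "\<And>v. smooth_up_to_boundary \<Omega> v \<Longrightarrow>
        integral\<^sup>L (lebesgue_on \<Omega>) (\<lambda>x. (A x (u x) *v Du x) \<bullet> grad v x)
        + 1/2 * integral\<^sup>L (lebesgue_on \<Omega>) (\<lambda>x. ((DA x (u x) *v Du x) \<bullet> Du x) * v x)
        = \<omega> v"
    and w: "weak_grad \<Omega> w Dw"
    and neg: "integrable (lebesgue_on \<Omega>) (\<lambda>x. max 0 (- (((DA x (u x) *v Du x) \<bullet> Du x) * w x)))"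
  shows "integrable (lebesgue_on \<Omega>) (\<lambda>x. w x * ((DA x (u x) *v Du x) \<bullet> Du x)) \<and>
      integral\<^sup>L (lebesgue_on \<Omega>) (\<lambda>x. (A x (u x) *v Du x) \<bullet> Dw x)
        + 1/2 * integral\<^sup>L (lebesgue_on \<Omega>) (\<lambda>x. ((DA x (u x) *v Du x) \<bullet> Du x) * w x)
        = \<omega> w"
proof -
  have open_\<Omega>: "open \<Omega>" using dom[unfolded lipschitz_domain_def] by (elim conjE)
  have bounded_\<Omega>: "bounded \<Omega>" using dom[unfolded lipschitz_domain_def] by (elim conjE)
  note inw = lipschitz_domain_inward_mollifiers[OF dom]
  have meas: "(\<lambda>x. A x s $ i $ j) \<in> borel_measurable (lebesgue_on \<Omega>)"
      "(\<lambda>x. DA x s $ i $ j) \<in> borel_measurable (lebesgue_on \<Omega>)" for s i j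
    using coeff[unfolded coeff_assms_def] by blast+
  have ae: "AE x in lebesgue_on \<Omega>.
        (\<forall>s. transpose (A x s) = A x s) \<and>
        (\<forall>s i j. ((\<lambda>t. A x t $ i $ j) has_real_derivative DA x s $ i $ j) (at s)) \<and>
        (\<forall>i j. continuous_on UNIV (\<lambda>s. DA x s $ i $ j)) \<and>
        (\<forall>s i j. \<bar>A x s $ i $ j\<bar> \<le> C \<and> \<bar>DA x s $ i $ j\<bar> \<le> C) \<and>
        (\<forall>s \<xi>. (A x s *v \<xi>) \<bullet> \<xi> \<ge> \<nu> * (norm \<xi>)\<^sup>2)"
    using coeff[unfolded coeff_assms_def] by (elim conjE)
  \<comment> \<open>Continuity of the entries of \<open>A\<close> in s follows from their
    differentiability; for \<open>DA\<close> it is part of the assumption.\<close>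
  have contA: "AE x in lebesgue_on \<Omega>. \<forall>i j. continuous_on UNIV (\<lambda>s. A x s $ i $ j)"
    using ae
  proof eventually_elim
    case (elim x)
    then have "((\<lambda>t. A x t $ i $ j) has_real_derivative DA x s $ i $ j) (at s)" for s i j by blast
    then show ?case by (intro allI continuous_at_imp_continuous_on ballI DERIV_isCont)
  qed
  have contDA: "AE x in lebesgue_on \<Omega>. \<forall>i j. continuous_on UNIV (\<lambda>s. DA x s $ i $ j)"
    using ae by eventually_elim blast
  have bdA: "AE x in lebesgue_on \<Omega>. \<forall>s i j. \<bar>A x s $ i $ j\<bar> \<le> C"
    using ae by eventually_elim blast
  have bdDA: "AE x in lebesgue_on \<Omega>. \<forall>s i j. \<bar>DA x s $ i $ j\<bar> \<le> C"
    using ae by eventually_elim blast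
  have Lu: "L2 \<Omega> u" and LDu: "L2 \<Omega> (\<lambda>x. Du x $ j)" for j using u by (simp_all add: weak_grad_def)
  define P where "P = (\<lambda>i x. (A x (u x) *v Du x) $ i)"
  define F where "F = (\<lambda>x. (DA x (u x) *v Du x) \<bullet> Du x)"
  have LP: "L2 \<Omega> (P i)" for i unfolding P_def
    by (rule L2_matrix_vector_component[OF open_\<Omega> meas(1) contA bdA L2_measurable[OF Lu] LDu])
  have "L2 \<Omega> (\<lambda>x. (DA x (u x) *v Du x) $ i)" for i
    by (rule L2_matrix_vector_component[OF open_\<Omega> meas(2) contDA bdDA L2_measurable[OF Lu] LDu])
  \<comment> \<open>The quadratic term is a finite sum of products of two L2 functions.\<close>
  then have IF: "integrable (lebesgue_on \<Omega>) F" unfolding F_def inner_vec_def inner_real_def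
    by (intro Bochner_Integration.integrable_sum L2_mult_integrable LDu)
  \<comment> \<open>Components are paired one at a time because L2 convergence is formulated for
    scalar functions; integrability of each product justifies exchanging sum and integral.\<close>
  have inner: "(\<integral>x. (A x (u x) *v Du x) \<bullet> H x \<partial>lebesgue_on \<Omega>) =
      (\<Sum>i\<in>UNIV. \<integral>x. H x $ i * P i x \<partial>lebesgue_on \<Omega>)" if "\<And>i. L2 \<Omega> (\<lambda>x. H x $ i)" for H
    using L2_mult_integrable[OF that LP] by (simp add: inner_vec_def P_def mult.commute)
  have eq': "(\<Sum>i\<in>UNIV. \<integral>x. grad v x $ i * P i x \<partial>lebesgue_on \<Omega>)
        + 1/2 * (\<integral>x. F x * v x \<partial>lebesgue_on \<Omega>) = \<omega> v" if "smooth v" for v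
  proof -
    have "smooth_up_to_boundary \<Omega> v" using that by (auto simp: smooth_up_to_boundary_def)
    moreover have "L2 \<Omega> (\<lambda>x. grad v x $ i)" for i
      using smooth_weak_grad[OF open_\<Omega> bounded_\<Omega> that] by (simp add: weak_grad_def)
    ultimately show ?thesis using eq[of v] inner[of "grad v"] by (simp add: F_def)
  qed
  have neg': "integrable (lebesgue_on \<Omega>) (\<lambda>x. max 0 (- (F x * w x)))"
    using neg by (simp add: F_def)
  note main = integrable_and_equation_if_negative_part_integrable
    [OF open_\<Omega> bounded_\<Omega> inw LP IF om eq' w neg']
  have "L2 \<Omega> (\<lambda>x. Dw x $ i)" for i using w by (simp add: weak_grad_def)
  then show ?thesis
    using main inner[of Dw] by (simp add: F_def mult.commute)
qed

end
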